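(* Let $M$ be an indecomposable symmetrizable generalized intersection matrix of size $n\times n$ with $n\ge 3$. If there exists a diagonal matrix $S$ with positive diagonal entries such that $SM$ is (symmetric and) positive definite, then the partial reflection algebra $\mathsf{Pra}(M)$ is a finite dimensional simple Lie algebra (over $\mathbb C$).
   Context: Generalized intersection matrix (GIM): an $n\times n$ integer matrix $M=(m_{ij})$ with $m_{ii}=2$ and, for $i\neq j$, $m_{ij}<0$ iff $m_{ji}<0$, and $m_{ij}>0$ iff $m_{ji}>0$. $M$ is symmetrizable if there is a non-degenerate diagonal matrix $S$ such that $SM$ is symmetric. $M$ is indecomposable if the index set cannot be partitioned into two non-empty subsets $I,J$ with $m_{ij}=m_{ji}=0$ for all $i\in I,j\in J$. Put $K=n-\operatorname{rank}(M)$. Prime root system: a linearly independent set $\Pi=\{\alpha_1,\dots,\alpha_n\}$ in a complex vector space $V$ of dimension $2n-\operatorname{rank}(M)=n+K$ with a non-degenerate symmetric bilinear form $(\cdot,\cdot)$ such that $\frac{2(\alpha_i,\alpha_j)}{(\alpha_i,\alpha_i)}=m_{ij}$ for all $i,j$. The form is normalized so that $(\alpha_i,\alpha_i)>0$ for all $i$. For $v\in V$ with $(v,v)\ne 0$, the reflection is $\rho_v(\lambda)=\lambda-\frac{2(\lambda,v)}{(v,v)}v$. Braid-equivalence: $\Pi\sim\Pi'$ if $\Pi'$ is obtained from $\Pi$ by a finite sequence of transformations $\Pi_k\mapsto\Pi_{k+1}=(\Pi_k\setminus\{\beta\})\cup\{\rho_\alpha(\beta)\}$ with $\alpha,\beta\in\Pi_k$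 ($\alpha=\beta$ is allowed, giving $\beta\mapsto-\beta$). Partial reflection algebra $\mathsf{Pra}(M)$ of a symmetrizable GIM $M$: let $H$ be the complex vector space with basis $h_1,\dots,h_n,d_1,\dots,d_K$, and let $\Pi=\{\alpha_1,\dots,\alpha_n\}\subset H^*$ be a linearly independent set with $\alpha_i(h_j)=m_{ji}$. Equip $H^*$ with a non-degenerate symmetric bilinear form $(\cdot,\cdot)$ such that $\frac{2(\alpha_i,\alpha_j)}{(\alpha_i,\alpha_i)}=m_{ij}$ for all $i,j$ and $(\alpha_i,\alpha_i)>0$ for all $i$, making $\Pi$ a prime root system of $M$ in $V=H^*$. $\mathsf{Pra}(M)$ is the complex Lie algebra generated by $H$ (an abelian subalgebra) and $e_i,f_i$ ($1\le i\le n$) with relations $$[e_i,f_i]=h_i,\quad [h,e_i]=\alpha_i(h)e_i,\quad [h,f_i]=-\alpha_i(h)f_i\qquad(h\in H),$$ together with the following relations, stated using the weight spaces $\mathsf{Pra}(M)_\alpha=\{v\mid [h,v]=\alpha(h)v\ \forall h\in H\}$: for every $\mathcal B\sim\Pi$, all $\alpha,\beta\in\mathcal B$, and all $x\in\mathsf{Pra}(M)_\alpha$, $y\in\mathsf{Pra}(M)_\beta$, $z\in\mathsf{Pra}(M)_{-\alpha}$, - if $(\alpha,\beta)<0$: $(\operatorname{ad}x)^{1-\frac{2(\alpha,\beta)}{(\alpha,\alpha)}}(y)=0$ and $[z,y]=0$; - if $(\alpha,\beta)>0$: $(\operatorname{ad}z)^{1+\frac{2(\alpha,\beta)}{(\alpha,\alpha)}}(y)=0$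 and $[x,y]=0$; - if $(\alpha,\beta)=0$: $[x,y]=0$ and $[z,y]=0$. (Equivalently, $\mathsf{Pra}(M)$ is the quotient of the Lie algebra defined by the first group of relations by the ideal generated by the left-hand sides of the second group, with $x,y,z$ ranging over its weight spaces.) *)

theory Defs
  imports
    "HOL-Analysis.Analysis"
    "HOL-Library.Complex_Order"
    "HOL-Algebra.Algebraic_Closure_Type"
    "Jordan_Normal_Form.Missing_VectorSpace"
begin

no_notation fps_nth (infixl \<open>$\<close> 75)
no_notation AbelCoset.set_add (infixl \<open><+>\<index>\<close> 60)

section \<open>Generalized intersection matrices\<close>

definition generalized_intersection_matrix :: "int^'n^'n \<Rightarrow> bool" where
  "generalized_intersection_matrix M \<longleftrightarrow>
     (\<forall>i. M $ i $ i = 2) \<and>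
     (\<forall>i j. i \<noteq> j \<longrightarrow> (M $ i $ j < 0 \<longleftrightarrow> M $ j $ i < 0) \<and> (M $ i $ j > 0 \<longleftrightarrow> M $ j $ i > 0))"

definition diagonal_matrix :: "'a::zero^'n^'n \<Rightarrow> bool" where
  "diagonal_matrix S \<longleftrightarrow> (\<forall>i j. i \<noteq> j \<longrightarrow> S $ i $ j = 0)"

definition symmetric_matrix :: "'a^'n^'n \<Rightarrow> bool" where
  "symmetric_matrix A \<longleftrightarrow> transpose A = A"

definition positive_definite :: "real^'n^'n \<Rightarrow> bool" where
  "positive_definite A \<longleftrightarrow> symmetric_matrix A \<and> (\<forall>x. x \<noteq> 0 \<longrightarrow> 0 < x \<bullet> (A *v x))"

definition symmetrizable :: "int^'n^'n \<Rightarrow> bool" where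
  "symmetrizable M \<longleftrightarrow>
     (\<exists>S :: real^'n^'n. diagonal_matrix S \<and> invertible S \<and>
        symmetric_matrix (S ** map_matrix of_int M))"

definition indecomposable :: "int^'n^'n \<Rightarrow> bool" where
  "indecomposable M \<longleftrightarrow>
     \<not> (\<exists>I J. I \<noteq> {} \<and> J \<noteq> {} \<and> I \<inter> J = {} \<and> I \<union> J = UNIV \<and>
          (\<forall>i\<in>I. \<forall>j\<in>J. M $ i $ j = 0 \<and> M $ j $ i = 0))"

definition corank :: "int^'n^'n \<Rightarrow> nat" where
  "corank M = CARD('n) - rank (map_matrix of_int M :: complex^'n^'n)"


section \<open>Prime root systems\<close>

text \<open>The Cartan space \<open>H\<close> is an arbitrary complex vector space whose elements form the type \<open>'h\<close>;
  its dual is a set of functions on that type.\<close>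

definition dual_space :: "(complex \<Rightarrow> 'h \<Rightarrow> 'h::ab_group_add) \<Rightarrow> ('h \<Rightarrow> complex) set" where
  "dual_space smul = {\<phi>. Vector_Spaces.linear smul (*) \<phi>}"

type_synonym 'h dual_form = "('h \<Rightarrow> complex) \<Rightarrow> ('h \<Rightarrow> complex) \<Rightarrow> complex"

definition nondegenerate_symmetric_form ::
    "(complex \<Rightarrow> 'h \<Rightarrow> 'h::ab_group_add) \<Rightarrow> 'h dual_form \<Rightarrow> bool" where
  "nondegenerate_symmetric_form smul form \<longleftrightarrow>
     (\<forall>\<phi>\<in>dual_space smul. \<forall>\<psi>\<in>dual_space smul. form \<phi> \<psi> = form \<psi> \<phi>) \<and>
     (\<forall>\<phi>\<in>dual_space smul. \<forall>\<psi>\<in>dual_space smul. \<forall>\<xi>\<in>dual_space smul.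
        form (\<lambda>x. \<phi> x + \<psi> x) \<xi> = form \<phi> \<xi> + form \<psi> \<xi>) \<and>
     (\<forall>c. \<forall>\<phi>\<in>dual_space smul. \<forall>\<psi>\<in>dual_space smul.
        form (\<lambda>x. c * \<phi> x) \<psi> = c * form \<phi> \<psi>) \<and>
     (\<forall>\<phi>\<in>dual_space smul. (\<forall>\<psi>\<in>dual_space smul. form \<phi> \<psi> = 0) \<longrightarrow> \<phi> = (\<lambda>x. 0))"

text \<open>The order on \<^typ>\<open>complex\<close> used here and below is that of \<^theory>\<open>HOL-Library.Complex_Order\<close>:
  \<open>0 < z\<close> says that \<open>z\<close> is real and positive.\<close>

locale pra_realization = vector_space smul
  for smul :: "complex \<Rightarrow> 'h \<Rightarrow> 'h::ab_group_add" +
  fixes M :: "int^'n^'n"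
    and h :: "'n \<Rightarrow> 'h" and d :: "nat \<Rightarrow> 'h"
    and \<alpha> :: "'n \<Rightarrow> 'h \<Rightarrow> complex"
    and form :: "'h dual_form"
  assumes basis_inj: "inj_on (case_sum h d) (UNIV <+> {..<corank M})"
    and basis_independent: "independent (case_sum h d ` (UNIV <+> {..<corank M}))"
    and basis_span: "span (case_sum h d ` (UNIV <+> {..<corank M})) = UNIV"
    and root_dual: "\<alpha> i \<in> dual_space smul"
    and roots_independent: "(\<And>x. (\<Sum>i\<in>UNIV. c i * \<alpha> i x) = 0) \<Longrightarrow> c i = 0"
    and root_coroot: "\<alpha> i (h j) = of_int (M $ j $ i)"
    and form: "nondegenerate_symmetric_form smul form"
    and form_root: "2 * form (\<alpha> i) (\<alpha> j) / form (\<alpha> i) (\<alpha> i) = of_int (M $ i $ j)"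
    and form_normalized: "0 < form (\<alpha> i) (\<alpha> i)"

definition reflection :: "'h dual_form \<Rightarrow> ('h \<Rightarrow> complex) \<Rightarrow> ('h \<Rightarrow> complex) \<Rightarrow> ('h \<Rightarrow> complex)" where
  "reflection form v \<phi> = (\<lambda>x. \<phi> x - 2 * form \<phi> v / form v v * v x)"

definition braid_step :: "'h dual_form \<Rightarrow> ('h \<Rightarrow> complex) set \<Rightarrow> ('h \<Rightarrow> complex) set \<Rightarrow> bool" where
  "braid_step form P Q \<longleftrightarrow> (\<exists>\<alpha>\<in>P. \<exists>\<beta>\<in>P. Q = (P - {\<beta>}) \<union> {reflection form \<alpha> \<beta>})"

definition braid_equivalent :: "'h dual_form \<Rightarrow> ('h \<Rightarrow> complex) set \<Rightarrow> ('h \<Rightarrow> complex) set \<Rightarrow> bool" where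
  "braid_equivalent form = (braid_step form)\<^sup>*\<^sup>*"


section \<open>Lie algebras\<close>

text \<open>Of the inherited record fields only \<^term>\<open>carrier\<close>, \<^term>\<open>zero\<close>, \<^term>\<open>add\<close> and \<^term>\<open>smult\<close>
  are relevant; the ring multiplication and unit play no role.\<close>

record ('a, 'b) lie_alg = "('a, 'b) module" +
  lie_bracket :: "'b \<Rightarrow> 'b \<Rightarrow> 'b"

locale lie_algebra = vectorspace K L
  for K :: "('k, 'm) ring_scheme" (structure) and L :: "('k, 'b, 'c) lie_alg_scheme" (structure) +
  assumes bracket_closed:
      "\<lbrakk>x \<in> carrier L; y \<in> carrier L\<rbrakk> \<Longrightarrow> lie_bracket L x y \<in> carrier L"
    and bracket_add_left:
      "\<lbrakk>x \<in> carrier L; y \<in> carrier L; z \<in> carrier L\<rbrakk> \<Longrightarrow>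
        lie_bracket L (x \<oplus>\<^bsub>L\<^esub> y) z = lie_bracket L x z \<oplus>\<^bsub>L\<^esub> lie_bracket L y z"
    and bracket_add_right:
      "\<lbrakk>x \<in> carrier L; y \<in> carrier L; z \<in> carrier L\<rbrakk> \<Longrightarrow>
        lie_bracket L x (y \<oplus>\<^bsub>L\<^esub> z) = lie_bracket L x y \<oplus>\<^bsub>L\<^esub> lie_bracket L x z"
    and bracket_smult_left:
      "\<lbrakk>c \<in> carrier K; x \<in> carrier L; y \<in> carrier L\<rbrakk> \<Longrightarrow>
        lie_bracket L (c \<odot>\<^bsub>L\<^esub> x) y = c \<odot>\<^bsub>L\<^esub> lie_bracket L x y"
    and bracket_smult_right:
      "\<lbrakk>c \<in> carrier K; x \<in> carrier L; y \<in> carrier L\<rbrakk> \<Longrightarrow>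
        lie_bracket L x (c \<odot>\<^bsub>L\<^esub> y) = c \<odot>\<^bsub>L\<^esub> lie_bracket L x y"
    and bracket_self: "x \<in> carrier L \<Longrightarrow> lie_bracket L x x = \<zero>\<^bsub>L\<^esub>"
    and jacobi:
      "\<lbrakk>x \<in> carrier L; y \<in> carrier L; z \<in> carrier L\<rbrakk> \<Longrightarrow>
        lie_bracket L x (lie_bracket L y z) \<oplus>\<^bsub>L\<^esub> lie_bracket L y (lie_bracket L z x)
          \<oplus>\<^bsub>L\<^esub> lie_bracket L z (lie_bracket L x y) = \<zero>\<^bsub>L\<^esub>"

definition lie_ideal :: "('k, 'm) ring_scheme \<Rightarrow> 'b set \<Rightarrow> ('k, 'b, 'c) lie_alg_scheme \<Rightarrow> bool" where
  "lie_ideal K I L \<longleftrightarrow>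
     VectorSpace.subspace K I L \<and> (\<forall>x\<in>carrier L. \<forall>y\<in>I. lie_bracket L x y \<in> I)"

locale simple_lie_algebra = lie_algebra K L
  for K :: "('k, 'm) ring_scheme" (structure) and L :: "('k, 'b, 'c) lie_alg_scheme" (structure) +
  assumes nonabelian: "\<exists>x\<in>carrier L. \<exists>y\<in>carrier L. lie_bracket L x y \<noteq> \<zero>\<^bsub>L\<^esub>"
    and ideal_trivial: "lie_ideal K I L \<Longrightarrow> I = {\<zero>\<^bsub>L\<^esub>} \<or> I = carrier L"


section \<open>The partial reflection algebra\<close>

text \<open>The algebra is the set of all formal Lie expressions in the generators, modulo the least
  congruence that contains the Lie algebra axioms and the defining relations.\<close>

datatype ('h, 'n) lie_term =
    Cartan 'h
  | E 'n
  | F 'n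
  | Zero
  | Plus "('h, 'n) lie_term" "('h, 'n) lie_term"
  | Scale complex "('h, 'n) lie_term"
  | Bracket "('h, 'n) lie_term" "('h, 'n) lie_term"

definition weight_vector ::
    "(('h, 'n) lie_term \<Rightarrow> ('h, 'n) lie_term \<Rightarrow> bool) \<Rightarrow> ('h \<Rightarrow> complex) \<Rightarrow> ('h, 'n) lie_term \<Rightarrow> bool" where
  "weight_vector R \<phi> v \<longleftrightarrow> (\<forall>t. R (Bracket (Cartan t) v) (Scale (\<phi> t) v))"

lemma weight_vector_mono [mono]:
  "(\<And>s t. R s t \<longrightarrow> R' s t) \<Longrightarrow> weight_vector R \<phi> v \<longrightarrow> weight_vector R' \<phi> v"
  by (auto simp: weight_vector_def)

text \<open>The six rules at the end are the relations for weight vectors of the algebra itself. In them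
  \<open>\<alpha>'\<close> and \<open>\<beta>\<close> range over the members of a set \<open>B\<close> that is braid-equivalent to the prime root system
  \<open>{\<alpha> i | i}\<close>, and \<open>k\<close> is the prescribed exponent of \<open>ad x\<close> or \<open>ad z\<close>.\<close>

inductive pra_cong ::
    "(complex \<Rightarrow> 'h \<Rightarrow> 'h::ab_group_add) \<Rightarrow> ('n \<Rightarrow> 'h) \<Rightarrow> ('n \<Rightarrow> 'h \<Rightarrow> complex) \<Rightarrow> 'h dual_form \<Rightarrow>
      ('h, 'n) lie_term \<Rightarrow> ('h, 'n) lie_term \<Rightarrow> bool"
  for smul h \<alpha> form
where
  refl: "pra_cong smul h \<alpha> form s s"
| sym: "pra_cong smul h \<alpha> form s t \<Longrightarrow> pra_cong smul h \<alpha> form t s"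
| trans: "\<lbrakk>pra_cong smul h \<alpha> form s t; pra_cong smul h \<alpha> form t u\<rbrakk> \<Longrightarrow> pra_cong smul h \<alpha> form s u"
| plus_cong:
    "\<lbrakk>pra_cong smul h \<alpha> form s s'; pra_cong smul h \<alpha> form t t'\<rbrakk> \<Longrightarrow>
      pra_cong smul h \<alpha> form (Plus s t) (Plus s' t')"
| scale_cong: "pra_cong smul h \<alpha> form s s' \<Longrightarrow> pra_cong smul h \<alpha> form (Scale c s) (Scale c s')"
| bracket_cong:
    "\<lbrakk>pra_cong smul h \<alpha> form s s'; pra_cong smul h \<alpha> form t t'\<rbrakk> \<Longrightarrow>
      pra_cong smul h \<alpha> form (Bracket s t) (Bracket s' t')"
| plus_assoc: "pra_cong smul h \<alpha> form (Plus (Plus s t) u) (Plus s (Plus t u))"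
| plus_commute: "pra_cong smul h \<alpha> form (Plus s t) (Plus t s)"
| plus_zero: "pra_cong smul h \<alpha> form (Plus Zero s) s"
| plus_inverse: "pra_cong smul h \<alpha> form (Plus s (Scale (- 1) s)) Zero"
| scale_plus: "pra_cong smul h \<alpha> form (Scale c (Plus s t)) (Plus (Scale c s) (Scale c t))"
| scale_add: "pra_cong smul h \<alpha> form (Scale (b + c) s) (Plus (Scale b s) (Scale c s))"
| scale_scale: "pra_cong smul h \<alpha> form (Scale b (Scale c s)) (Scale (b * c) s)"
| scale_one: "pra_cong smul h \<alpha> form (Scale 1 s) s"
| bracket_plus_left:
    "pra_cong smul h \<alpha> form (Bracket (Plus s t) u) (Plus (Bracket s u) (Bracket t u))"
| bracket_plus_right:
    "pra_cong smul h \<alpha> form (Bracket s (Plus t u)) (Plus (Bracket s t) (Bracket s u))"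
| bracket_scale_left: "pra_cong smul h \<alpha> form (Bracket (Scale c s) t) (Scale c (Bracket s t))"
| bracket_scale_right: "pra_cong smul h \<alpha> form (Bracket s (Scale c t)) (Scale c (Bracket s t))"
| bracket_self: "pra_cong smul h \<alpha> form (Bracket s s) Zero"
| jacobi:
    "pra_cong smul h \<alpha> form
      (Plus (Plus (Bracket s (Bracket t u)) (Bracket t (Bracket u s))) (Bracket u (Bracket s t))) Zero"
| cartan_add: "pra_cong smul h \<alpha> form (Cartan (x + y)) (Plus (Cartan x) (Cartan y))"
| cartan_scale: "pra_cong smul h \<alpha> form (Cartan (smul c x)) (Scale c (Cartan x))"
| cartan_abelian: "pra_cong smul h \<alpha> form (Bracket (Cartan x) (Cartan y)) Zero"
| e_f: "pra_cong smul h \<alpha> form (Bracket (E i) (F i)) (Cartan (h i))"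
| cartan_e: "pra_cong smul h \<alpha> form (Bracket (Cartan x) (E i)) (Scale (\<alpha> i x) (E i))"
| cartan_f: "pra_cong smul h \<alpha> form (Bracket (Cartan x) (F i)) (Scale (- \<alpha> i x) (F i))"
| negative_ad:
    "\<lbrakk>braid_equivalent form (range \<alpha>) B; \<alpha>' \<in> B; \<beta> \<in> B; form \<alpha>' \<beta> < 0;
      of_nat k = 1 - 2 * form \<alpha>' \<beta> / form \<alpha>' \<alpha>';
      weight_vector (pra_cong smul h \<alpha> form) \<alpha>' x; weight_vector (pra_cong smul h \<alpha> form) \<beta> y\<rbrakk> \<Longrightarrow>
      pra_cong smul h \<alpha> form ((Bracket x ^^ k) y) Zero"
| negative_bracket:
    "\<lbrakk>braid_equivalent form (range \<alpha>) B; \<alpha>' \<in> B; \<beta> \<in> B; form \<alpha>' \<beta> < 0;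
      weight_vector (pra_cong smul h \<alpha> form) (- \<alpha>') z; weight_vector (pra_cong smul h \<alpha> form) \<beta> y\<rbrakk> \<Longrightarrow>
      pra_cong smul h \<alpha> form (Bracket z y) Zero"
| positive_ad:
    "\<lbrakk>braid_equivalent form (range \<alpha>) B; \<alpha>' \<in> B; \<beta> \<in> B; form \<alpha>' \<beta> > 0;
      of_nat k = 1 + 2 * form \<alpha>' \<beta> / form \<alpha>' \<alpha>';
      weight_vector (pra_cong smul h \<alpha> form) (- \<alpha>') z; weight_vector (pra_cong smul h \<alpha> form) \<beta> y\<rbrakk> \<Longrightarrow>
      pra_cong smul h \<alpha> form ((Bracket z ^^ k) y) Zero"
| positive_bracket:
    "\<lbrakk>braid_equivalent form (range \<alpha>) B; \<alpha>' \<in> B; \<beta> \<in> B; form \<alpha>' \<beta> > 0;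
      weight_vector (pra_cong smul h \<alpha> form) \<alpha>' x; weight_vector (pra_cong smul h \<alpha> form) \<beta> y\<rbrakk> \<Longrightarrow>
      pra_cong smul h \<alpha> form (Bracket x y) Zero"
| orthogonal_bracket:
    "\<lbrakk>braid_equivalent form (range \<alpha>) B; \<alpha>' \<in> B; \<beta> \<in> B; form \<alpha>' \<beta> = 0;
      weight_vector (pra_cong smul h \<alpha> form) \<alpha>' x; weight_vector (pra_cong smul h \<alpha> form) \<beta> y\<rbrakk> \<Longrightarrow>
      pra_cong smul h \<alpha> form (Bracket x y) Zero"
| orthogonal_bracket_opposite:
    "\<lbrakk>braid_equivalent form (range \<alpha>) B; \<alpha>' \<in> B; \<beta> \<in> B; form \<alpha>' \<beta> = 0;
      weight_vector (pra_cong smul h \<alpha> form) (- \<alpha>') z; weight_vector (pra_cong smul h \<alpha> form) \<beta> y\<rbrakk> \<Longrightarrow>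
      pra_cong smul h \<alpha> form (Bracket z y) Zero"

definition partial_reflection_algebra ::
    "(complex \<Rightarrow> 'h \<Rightarrow> 'h::ab_group_add) \<Rightarrow> ('n \<Rightarrow> 'h) \<Rightarrow> ('n \<Rightarrow> 'h \<Rightarrow> complex) \<Rightarrow> 'h dual_form \<Rightarrow>
      (complex, ('h, 'n) lie_term set) lie_alg" where
  "partial_reflection_algebra smul h \<alpha> form =
     (let r = {(s, t). pra_cong smul h \<alpha> form s t} in
      \<lparr>carrier = UNIV // r,
       monoid.mult = undefined,
       one = undefined,
       zero = r `` {Zero},
       add = (\<lambda>S T. \<Union>s\<in>S. \<Union>t\<in>T. r `` {Plus s t}),
       smult = (\<lambda>c S. \<Union>s\<in>S. r `` {Scale c s}),
       lie_bracket = (\<lambda>S T. \<Union>s\<in>S. \<Union>t\<in>T. r `` {Bracket s t})\<rparr>)"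

end

theory Submission
  imports Defs
begin

text \<open>Work in the root lattice with the Euclidean form that \<open>M\<close> determines. Among the finitely many
  bases that are braid-equivalent to the prime root system, one that minimises the total absolute
  height is, up to signs, of Cartan type. The relations for braid-equivalent bases make the generators
  \<open>e\<close> and \<open>f\<close> ad-nilpotent, and the automorphisms \<open>exp (ad e) exp (- ad f) exp (ad e)\<close> transport the
  generators along braid moves. Hence the algebra is generated by Chevalley generators for the base of
  Cartan type. It follows that its nonzero weights are roots, that the root spaces are at most
  one-dimensional and that the weight space of \<open>0\<close> is the Cartan space, so that the algebra is finite
  dimensional. A nonzero ideal contains a weight vector, hence by reflections a generator, hence
  everything, because \<open>M\<close> is indecomposable.

  That the algebra is not zero is shown by a model, namely the Lie algebra of operators on an
  irreducible quotient of a Verma module for the base of Cartan type. There the Serre relations hold,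
  so the weights of the model are again roots, and each relation for weight vectors asserts that an
  element vanishes whose weight is neither zero nor a root.\<close>

section \<open>Lie algebras given by a bilinear operation on a type\<close>

text \<open>The relations are imposed on all weight vectors of the quotient, for every
  braid-equivalent base. Inside the algebra this is a gift: generators transported to another base
  are again weight vectors, so the relations apply to them directly and no Serre relation has to be
  carried along a braid move. For the model it is the obstacle: nothing can be checked on generators
  alone, and all weights of the model must be known. A base of Cartan type matters in both places
  because its nonpositive inner products make [e i, f j] vanish for i \<noteq> j, and this gives the
  triangular decomposition. Roots are described arithmetically, by length and by integrality of root
  and coroot coordinates. Finiteness and closure under reflections are then direct, and the weights
  forbidden by the relations are excluded by comparing lengths. One structure theory, for a
  subalgebra \<open>G\<close> of an ambient type, serves both the algebra and the model. It does not
  assume that the Cartan space embeds: for the algebra, even a nonzero image of the Cartan space is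
  known only once the model has been built.\<close>

locale lie_bilinear = vector_space scale
  for scale :: "complex \<Rightarrow> 'a \<Rightarrow> 'a::ab_group_add" +
  fixes br :: "'a \<Rightarrow> 'a \<Rightarrow> 'a"
  assumes br_add_left: "br (x + y) z = br x z + br y z"
    and br_add_right: "br x (y + z) = br x y + br x z"
    and br_scale_left: "br (scale c x) y = scale c (br x y)"
    and br_scale_right: "br x (scale c y) = scale c (br x y)"
    and br_self: "br x x = 0"
    and br_jacobi: "br x (br y z) + br y (br z x) + br z (br x y) = 0"
begin

lemma br_zero_left [simp]: "br 0 x = 0"
  using br_add_left[of 0 0 x] by simp

lemma br_zero_right [simp]: "br x 0 = 0"
  using br_add_right[of x 0 0] by simp

lemma br_minus_left: "br (- x) y = - br x y"
  using br_add_left[of x "- x" y] by (simp add: eq_neg_iff_add_eq_0 add.commute)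

lemma br_minus_right: "br x (- y) = - br x y"
  using br_add_right[of x y "- y"] by (simp add: eq_neg_iff_add_eq_0 add.commute)

lemma br_diff_right: "br x (y - z) = br x y - br x z"
  using br_add_right[of x y "- z"] by (simp add: br_minus_right)

lemma br_swap: "br x y = - br y x"
proof -
  have "br (x + y) (x + y) = br x x + br y x + (br x y + br y y)"
    by (simp only: br_add_left br_add_right)
  then show ?thesis
    by (simp add: br_self eq_neg_iff_add_eq_0 add.commute)
qed

lemma br_sum_left: "br (sum g A) y = (\<Sum>i\<in>A. br (g i) y)"
  by (induction A rule: infinite_finite_induct) (auto simp: br_add_left)

lemma br_sum_right: "br x (sum g A) = (\<Sum>i\<in>A. br x (g i))"
  by (induction A rule: infinite_finite_induct) (auto simp: br_add_right)

lemma br_br: "br x (br y z) = br (br x y) z + br y (br x z)"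
proof -
  have "br x (br y z) = - br y (br z x) - br z (br x y)"
    using br_jacobi[of x y z] by (simp add: algebra_simps eq_neg_iff_add_eq_0)
  also have "br y (br z x) = - br y (br x z)"
    by (metis br_swap br_minus_right)
  also have "br z (br x y) = - br (br x y) z"
    by (rule br_swap)
  finally show ?thesis by simp
qed

section \<open>Divided powers and exponentials of a locally nilpotent ad x\<close>

lemma br_pow_zero [simp]: "(br x ^^ n) 0 = 0"
  by (induction n) auto

lemma br_pow_add: "(br x ^^ n) (y + z) = (br x ^^ n) y + (br x ^^ n) z"
  by (induction n) (auto simp: br_add_right)

lemma br_pow_scale: "(br x ^^ n) (scale c y) = scale c ((br x ^^ n) y)"
  by (induction n) (auto simp: br_scale_right)

lemma br_pow_minus: "(br (- x) ^^ n) y = scale ((-1) ^ n) ((br x ^^ n) y)"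
  by (induction n) (auto simp: br_minus_left br_scale_right)

lemma br_pow_eq_0_mono: "(br x ^^ n) y = 0 \<Longrightarrow> n \<le> m \<Longrightarrow> (br x ^^ m) y = 0"
  by (metis le_add_diff_inverse2 funpow_add comp_apply br_pow_zero)

text \<open>Dividing by \<open>fact n\<close> removes the binomial coefficients from the Leibniz
  rule and makes the exponential a plain sum.\<close>

definition divpow :: "'a \<Rightarrow> nat \<Rightarrow> 'a \<Rightarrow> 'a" where
  "divpow x n y = scale (1 / fact n) ((br x ^^ n) y)"

lemma divpow_Suc: "scale (of_nat (Suc n)) (divpow x (Suc n) y) = br x (divpow x n y)"
  by (simp add: divpow_def br_scale_right del: of_nat_Suc)

lemma divpow_br: "divpow x n (br y z) = (\<Sum>k\<le>n. br (divpow x k y) (divpow x (n - k) z))"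
proof (induction n)
  case 0
  then show ?case by (simp add: divpow_def)
next
  case (Suc n)
  let ?g = "\<lambda>k. br (divpow x k y) (divpow x (Suc n - k) z)"
  \<comment> \<open>Both sides are multiplied by n + 1; the k-th product is then reached once with
    factor k and once with factor n + 1 - k.\<close>
  have "scale (of_nat (Suc n)) (divpow x (Suc n) (br y z))
      = (\<Sum>k\<le>n. br x (br (divpow x k y) (divpow x (n - k) z)))"
    by (simp only: divpow_Suc Suc br_sum_right)
  also have "\<dots> = (\<Sum>k\<le>n. scale (of_nat (Suc k)) (?g (Suc k)) + scale (of_nat (Suc n - k)) (?g k))"
  proof (rule sum.cong)
    fix k assume "k \<in> {..n}"
    then have *: "Suc n - k = Suc (n - k)" by auto
    show "br x (br (divpow x k y) (divpow x (n - k) z))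
      = scale (of_nat (Suc k)) (?g (Suc k)) + scale (of_nat (Suc n - k)) (?g k)"
      unfolding br_br[of x] divpow_Suc[symmetric] * by (simp only: br_scale_left br_scale_right diff_Suc_Suc)
  qed simp
  also have "\<dots> = (\<Sum>k\<le>Suc n. scale (of_nat k) (?g k)) + (\<Sum>k\<le>Suc n. scale (of_nat (Suc n - k)) (?g k))"
  proof -
    have "(\<Sum>k\<le>Suc n. scale (of_nat k) (?g k)) = (\<Sum>k\<le>n. scale (of_nat (Suc k)) (?g (Suc k)))"
      by (subst sum.atMost_Suc_shift) simp
    moreover have "(\<Sum>k\<le>Suc n. scale (of_nat (Suc n - k)) (?g k)) = (\<Sum>k\<le>n. scale (of_nat (Suc n - k)) (?g k))"
      by (subst sum.atMost_Suc) simp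
    ultimately show ?thesis by (simp only: sum.distrib)
  qed
  also have "\<dots> = (\<Sum>k\<le>Suc n. scale (of_nat (Suc n)) (?g k))"
    unfolding sum.distrib[symmetric] scale_left_distrib[symmetric]
    by (intro sum.cong) (simp_all del: of_nat_Suc flip: of_nat_add)
  finally have "scale (of_nat (Suc n)) (divpow x (Suc n) (br y z)) = scale (of_nat (Suc n)) (sum ?g {..Suc n})"
    by (simp only: scale_sum_right)
  then show ?case by (simp del: of_nat_Suc)
qed

lemma divpow_divpow: "divpow x k (divpow x l y) = scale (of_nat ((k + l) choose k)) (divpow x (k + l) y)"
  unfolding divpow_def br_pow_scale
  by (simp add: binomial_fact funpow_add)

lemma divpow_add: "divpow x n (y + z) = divpow x n y + divpow x n z"
  by (simp add: divpow_def br_pow_add scale_right_distrib)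

lemma divpow_scale: "divpow x n (scale c y) = scale c (divpow x n y)"
  by (simp add: divpow_def br_pow_scale mult.commute)

lemma divpow_zero [simp]: "divpow x n 0 = 0"
  by (simp add: divpow_def)

lemma divpow_sum: "divpow x n (sum g A) = (\<Sum>i\<in>A. divpow x n (g i))"
  by (induction A rule: infinite_finite_induct) (auto simp: divpow_add)

definition nilp :: "'a \<Rightarrow> 'a \<Rightarrow> bool" where
  "nilp x y \<longleftrightarrow> (\<exists>n. (br x ^^ n) y = 0)"

lemma nilpI: "(br x ^^ n) y = 0 \<Longrightarrow> nilp x y"
  by (auto simp: nilp_def)

lemma divpow_eq_0: "(br x ^^ n) y = 0 \<Longrightarrow> n \<le> m \<Longrightarrow> divpow x m y = 0"
  by (simp add: divpow_def br_pow_eq_0_mono)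

lemma nilp_zero [simp]: "nilp x 0"
  by (rule nilpI[where n = 0]) simp

lemma nilp_add: "nilp x y \<Longrightarrow> nilp x z \<Longrightarrow> nilp x (y + z)"
  unfolding nilp_def br_pow_add
  by (metis add_0 br_pow_eq_0_mono nle_le)

lemma nilp_scale: "nilp x y \<Longrightarrow> nilp x (scale c y)"
  unfolding nilp_def br_pow_scale by auto

text \<open>This is the Cauchy product for finite sums: terms outside the square vanish, so the
  square can be enlarged to the triangle \<open>i + j < 2 * n\<close>, which is then summed along
  its antidiagonals.\<close>

lemma sum_square_triangle:
  fixes g :: "nat \<Rightarrow> nat \<Rightarrow> 'a"
  assumes "\<And>i j. n \<le> i \<Longrightarrow> g i j = 0" "\<And>i j. n \<le> j \<Longrightarrow> g i j = 0"
  shows "(\<Sum>i<n. \<Sum>j<n. g i j) = (\<Sum>m<2 * n. \<Sum>i\<le>m. g i (m - i))"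
proof -
  have "(\<Sum>i<n. \<Sum>j<n. g i j) = (\<Sum>(i, j)\<in>{..<n} \<times> {..<n}. g i j)"
    by (simp add: sum.cartesian_product)
  also have "\<dots> = (\<Sum>(i, j)\<in>{(i, j). i + j < 2 * n}. g i j)"
  proof (rule sum.mono_neutral_left)
    show "finite {(i, j). i + j < 2 * n}"
      by (rule finite_subset[of _ "{..<2*n} \<times> {..<2*n}"]) auto
    show "\<forall>i\<in>{(i, j). i + j < 2 * n} - {..<n} \<times> {..<n}. (case i of (i, j) \<Rightarrow> g i j) = 0"
      using assms by (auto simp: not_less) (meson not_le)+
  qed auto
  also have "\<dots> = (\<Sum>m<2 * n. \<Sum>i\<le>m. g i (m - i))"
    by (rule sum.triangle_reindex)
  finally show ?thesis .
qed

text \<open>With exponent a + b, every term of the Leibniz rule contains at least a factors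
  \<open>ad x\<close> on \<open>y\<close> or at least b on \<open>z\<close>.\<close>

lemma nilp_br:
  assumes "nilp x y" "nilp x z"
  shows "nilp x (br y z)"
proof -
  obtain a b where ab: "(br x ^^ a) y = 0" "(br x ^^ b) z = 0"
    using assms by (auto simp: nilp_def)
  have "divpow x (a + b) (br y z) = 0"
    unfolding divpow_br
  proof (rule sum.neutral, rule ballI)
    fix k show "br (divpow x k y) (divpow x (a + b - k) z) = 0"
      using divpow_eq_0[OF ab(1), of k] divpow_eq_0[OF ab(2), of "a + b - k"]
      by (cases "a \<le> k") auto
  qed
  then show ?thesis by (auto simp: divpow_def intro: nilpI)
qed

text \<open>The sum is the junk value \<open>0\<close> unless \<open>ad x\<close> is nilpotent on \<open>y\<close>.\<close>

definition lie_exp :: "'a \<Rightarrow> 'a \<Rightarrow> 'a" where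
  "lie_exp x y = (\<Sum>k\<in>{k. (br x ^^ k) y \<noteq> 0}. divpow x k y)"

lemma lie_exp_eq:
  assumes "(br x ^^ n) y = 0"
  shows "lie_exp x y = (\<Sum>k<n. divpow x k y)"
  unfolding lie_exp_def
proof (rule sum.mono_neutral_left)
  show "{k. (br x ^^ k) y \<noteq> 0} \<subseteq> {..<n}"
    using br_pow_eq_0_mono[OF assms] by (auto simp: not_le[symmetric])
qed (auto simp: divpow_def)

lemma nilp_common:
  assumes "nilp x y" "nilp x z"
  obtains n where "(br x ^^ n) y = 0" "(br x ^^ n) z = 0"
  using assms unfolding nilp_def by (metis br_pow_eq_0_mono nle_le)

lemma lie_exp_add: "nilp x y \<Longrightarrow> nilp x z \<Longrightarrow> lie_exp x (y + z) = lie_exp x y + lie_exp x z"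
proof (erule (1) nilp_common)
  fix n assume n: "(br x ^^ n) y = 0" "(br x ^^ n) z = 0"
  then have "(br x ^^ n) (y + z) = 0" by (simp add: br_pow_add)
  then show ?thesis by (simp add: n[THEN lie_exp_eq] lie_exp_eq divpow_add sum.distrib)
qed

lemma lie_exp_scale: "nilp x y \<Longrightarrow> lie_exp x (scale c y) = scale c (lie_exp x y)"
  unfolding nilp_def
proof (elim exE)
  fix n assume n: "(br x ^^ n) y = 0"
  then have "(br x ^^ n) (scale c y) = 0" by (simp add: br_pow_scale)
  then show ?thesis by (simp add: n[THEN lie_exp_eq] lie_exp_eq divpow_scale scale_sum_right)
qed

text \<open>The Leibniz rule for divided powers is exactly the Cauchy product of the two exponential
  series; hence the exponential of a locally nilpotent derivation is multiplicative.\<close>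

lemma lie_exp_br:
  assumes "nilp x y" "nilp x z"
  shows "lie_exp x (br y z) = br (lie_exp x y) (lie_exp x z)"
proof -
  obtain n where n: "(br x ^^ n) y = 0" "(br x ^^ n) z = 0"
    using assms by (rule nilp_common)
  have "divpow x (2 * n) (br y z) = 0"
    unfolding divpow_br
  proof (rule sum.neutral, rule ballI)
    fix k show "br (divpow x k y) (divpow x (2 * n - k) z) = 0"
      using divpow_eq_0[OF n(1), of k] divpow_eq_0[OF n(2), of "2 * n - k"]
      by (cases "n \<le> k") auto
  qed
  then have "(br x ^^ (2 * n)) (br y z) = 0" by (simp add: divpow_def)
  then have "lie_exp x (br y z) = (\<Sum>m<2 * n. \<Sum>k\<le>m. br (divpow x k y) (divpow x (m - k) z))"
    by (subst lie_exp_eq[where n = "2 * n"]) (simp_all add: divpow_br)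
  also have "\<dots> = (\<Sum>i<n. \<Sum>j<n. br (divpow x i y) (divpow x j z))"
    by (rule sum_square_triangle[symmetric]) (auto simp: divpow_eq_0[OF n(1)] divpow_eq_0[OF n(2)])
  also have "\<dots> = br (lie_exp x y) (lie_exp x z)"
    unfolding lie_exp_eq[OF n(1)] lie_exp_eq[OF n(2)] br_sum_left br_sum_right by (rule sum.swap)
  finally show ?thesis .
qed

text \<open>In the product of the two series the coefficient of \<open>divpow x m y\<close> is the
  alternating sum of the binomial coefficients of m, which vanishes for m > 0.\<close>

lemma lie_exp_inverse:
  assumes "nilp x y"
  shows "lie_exp (- x) (lie_exp x y) = y"
proof (cases "y = 0")
  case True
  then show ?thesis by (simp add: lie_exp_def)
next
  case False
  obtain n where n: "(br x ^^ n) y = 0" using assms by (auto simp: nilp_def)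
  with False have "n > 0" by (cases n) auto
  have m: "divpow (- x) k z = scale ((-1) ^ k) (divpow x k z)" for k z
    by (simp add: divpow_def br_pow_minus mult.commute)
  have "divpow x n (lie_exp x y) = 0"
    by (simp add: lie_exp_eq[OF n] divpow_sum divpow_divpow divpow_eq_0[OF n])
  then have "(br (- x) ^^ n) (lie_exp x y) = 0" by (simp add: br_pow_minus divpow_def)
  then have "lie_exp (- x) (lie_exp x y) = (\<Sum>k<n. \<Sum>l<n. scale ((-1) ^ k * of_nat ((k + l) choose k)) (divpow x (k + l) y))"
    by (subst lie_exp_eq[where n = n]) (simp_all add: lie_exp_eq[OF n] m divpow_sum divpow_divpow scale_sum_right)
  also have "\<dots> = (\<Sum>m<2 * n. \<Sum>k\<le>m. scale ((-1) ^ k * of_nat ((k + (m - k)) choose k)) (divpow x (k + (m - k)) y))"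
    by (rule sum_square_triangle) (auto simp: divpow_eq_0[OF n])
  also have "\<dots> = (\<Sum>m<2 * n. scale (\<Sum>k\<le>m. (-1) ^ k * of_nat (m choose k)) (divpow x m y))"
    by (intro sum.cong) (auto simp: scale_sum_left)
  also have "\<dots> = (\<Sum>m<2 * n. if m = 0 then y else 0)"
  proof (rule sum.cong)
    fix m
    show "scale (\<Sum>k\<le>m. (-1) ^ k * of_nat (m choose k)) (divpow x m y) = (if m = 0 then y else 0)"
    proof (cases "m = 0")
      case False
      then have "(\<Sum>k\<le>m. (-1) ^ k * of_nat (m choose k)) = (0 :: complex)"
        by (intro choose_alternating_sum) simp
      with False show ?thesis by simp
    qed (simp add: divpow_def)
  qed simp
  also have "\<dots> = y" using \<open>n > 0\<close> by (simp add: sum.delta)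
  finally show ?thesis .
qed

lemma lie_exp_closed:
  assumes "subspace S" "\<And>y. y \<in> S \<Longrightarrow> br x y \<in> S" "y \<in> S"
  shows "lie_exp x y \<in> S"
proof -
  have "(br x ^^ n) y \<in> S" for n
    by (induction n) (auto intro: assms)
  then show ?thesis unfolding lie_exp_def divpow_def
    by (intro subspace_sum subspace_scale assms(1)) auto
qed

lemma nilp_minus: "nilp (- x) y \<longleftrightarrow> nilp x y"
  by (simp add: nilp_def br_pow_minus)

definition subalg :: "'a set \<Rightarrow> bool" where
  "subalg S \<longleftrightarrow> subspace S \<and> (\<forall>x\<in>S. \<forall>y\<in>S. br x y \<in> S)"

lemma subalg_subspace: "subalg S \<Longrightarrow> subspace S"
  and subalg_br: "subalg S \<Longrightarrow> x \<in> S \<Longrightarrow> y \<in> S \<Longrightarrow> br x y \<in> S"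
  by (auto simp: subalg_def)

text \<open>By the Leibniz rule, local nilpotency of \<open>ad x\<close> passes to brackets; it is
  therefore enough to check it on generators.\<close>

lemma subalg_nilp: "subalg {y. nilp x y}"
  by (auto simp: subalg_def subspace_def nilp_add nilp_scale nilp_br)

end

section \<open>Weights with respect to a commuting family\<close>

locale lie_torus = lie_bilinear scale br + torus: vector_space tscale
  for scale :: "complex \<Rightarrow> 'a \<Rightarrow> 'a::ab_group_add" and br
    and tscale :: "complex \<Rightarrow> 'h \<Rightarrow> 'h::ab_group_add" +
  fixes T :: "'h \<Rightarrow> 'a"
  assumes T_add: "T (s + t) = T s + T t"
    and T_scale: "T (tscale c t) = scale c (T t)"
    and T_comm: "br (T s) (T t) = 0"
begin

lemma T_zero [simp]: "T 0 = 0"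
  using T_add[of 0 0] by simp

lemma T_minus: "T (- t) = - T t"
  using T_add[of t "- t"] by (simp add: eq_neg_iff_add_eq_0 add.commute)

lemma T_diff: "T (s - t) = T s - T t"
  using T_add[of s "- t"] by (simp add: T_minus)

lemma subspace_range_T: "subspace (range T)"
  unfolding subspace_def by (metis (no_types, lifting) T_add T_scale T_zero rangeE rangeI)

definition wt :: "('h \<Rightarrow> complex) \<Rightarrow> 'a \<Rightarrow> bool" where
  "wt \<phi> x \<longleftrightarrow> (\<forall>t. br (T t) x = scale (\<phi> t) x)"

lemma wt_zero [simp]: "wt \<phi> 0"
  by (simp add: wt_def)

lemma wt_add: "wt \<phi> x \<Longrightarrow> wt \<phi> y \<Longrightarrow> wt \<phi> (x + y)"
  by (simp add: wt_def br_add_right scale_right_distrib)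

lemma wt_scale: "wt \<phi> x \<Longrightarrow> wt \<phi> (scale c x)"
  by (simp add: wt_def br_scale_right mult.commute)

lemma wt_diff: "wt \<phi> x \<Longrightarrow> wt \<phi> y \<Longrightarrow> wt \<phi> (x - y)"
  by (simp add: wt_def br_diff_right scale_right_diff_distrib)

lemma subspace_wt: "subspace {x. wt \<phi> x}"
  by (auto simp: subspace_def wt_add wt_scale)

lemma wt_br: "wt \<phi> x \<Longrightarrow> wt \<psi> y \<Longrightarrow> wt (\<lambda>t. \<phi> t + \<psi> t) (br x y)"
  by (simp add: wt_def br_br[of "T _"] br_scale_left br_scale_right scale_left_distrib)

lemma wt_br_pow: "wt \<phi> x \<Longrightarrow> wt \<psi> y \<Longrightarrow> wt (\<lambda>t. of_nat n * \<phi> t + \<psi> t) ((br x ^^ n) y)"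
proof (induction n)
  case (Suc n)
  then have "wt (\<lambda>t. \<phi> t + (of_nat n * \<phi> t + \<psi> t)) (br x ((br x ^^ n) y))"
    by (intro wt_br) auto
  then show ?case by (simp add: algebra_simps)
qed simp

lemma br_T_right: "wt \<phi> x \<Longrightarrow> br x (T t) = - scale (\<phi> t) x"
  by (metis br_swap wt_def)

text \<open>Applying \<open>T t\<close> and subtracting \<open>\<phi> t\<close> times the vector
  removes the component of weight \<open>\<phi>\<close> and multiplies that of weight
  \<open>\<psi>\<close> by the number \<open>\<psi> t - \<phi> t\<close>, nonzero for suitable t.
  With \<open>J = {0}\<close> this is the independence of weight spaces; for an ideal it extracts
  weight components.\<close>

lemma weight_components:
  assumes "subspace J" "\<And>t y. y \<in> J \<Longrightarrow> br (T t) y \<in> J" "finite A"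
    and "\<And>\<psi>. \<psi> \<in> A \<Longrightarrow> wt \<psi> (x \<psi>)" "(\<Sum>\<psi>\<in>A. x \<psi>) \<in> J" "\<psi> \<in> A"
  shows "x \<psi> \<in> J"
  using assms(3-6)
proof (induction A arbitrary: x \<psi> rule: finite_induct)
  case (insert \<phi> A)
  have mem: "x \<psi> \<in> J" if "\<psi> \<in> A" for \<psi>
  proof -
    from that insert have "\<psi> \<noteq> \<phi>" by auto
    then obtain t where t: "\<psi> t \<noteq> \<phi> t" by auto
    have "br (T t) (\<Sum>\<psi>\<in>insert \<phi> A. x \<psi>) - scale (\<phi> t) (\<Sum>\<psi>\<in>insert \<phi> A. x \<psi>) \<in> J"
      by (intro subspace_diff subspace_scale assms(1,2) insert.prems)
    also have "br (T t) (\<Sum>\<psi>\<in>insert \<phi> A. x \<psi>) = (\<Sum>\<psi>\<in>insert \<phi> A. scale (\<psi> t) (x \<psi>))"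
      unfolding br_sum_right using insert.prems(1) by (intro sum.cong) (auto simp: wt_def)
    also have "\<dots> - scale (\<phi> t) (\<Sum>\<psi>\<in>insert \<phi> A. x \<psi>) = (\<Sum>\<psi>\<in>A. scale (\<psi> t - \<phi> t) (x \<psi>))"
      using insert.hyps by (simp add: scale_right_distrib scale_sum_right scale_left_diff_distrib sum_subtractf)
    finally have "scale (\<psi> t - \<phi> t) (x \<psi>) \<in> J"
      by (intro insert.IH[where x = "\<lambda>\<psi>. scale (\<psi> t - \<phi> t) (x \<psi>)"])
        (auto intro: wt_scale insert.prems that)
    then have "scale (1 / (\<psi> t - \<phi> t)) (scale (\<psi> t - \<phi> t) (x \<psi>)) \<in> J"
      by (rule subspace_scale[OF assms(1)])
    with t show ?thesis by simp
  qed
  then have "(\<Sum>\<psi>\<in>A. x \<psi>) \<in> J" by (intro subspace_sum assms(1))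
  with insert.prems(2) insert.hyps have "x \<phi> \<in> J"
    using subspace_diff[OF assms(1), of "x \<phi> + sum x A" "sum x A"] by simp
  with mem insert.prems show ?case by auto
qed simp

lemma span_weight_decomposition:
  assumes "x \<in> span Y" "\<And>y. y \<in> Y \<Longrightarrow> wt (w y) y"
  shows "\<exists>c. finite {\<psi>. c \<psi> \<noteq> 0} \<and> x = (\<Sum>\<psi>\<in>{\<psi>. c \<psi> \<noteq> 0}. c \<psi>) \<and>
    (\<forall>\<psi>. c \<psi> \<in> span {y \<in> Y. w y = \<psi>} \<and> wt \<psi> (c \<psi>))"
proof -
  obtain t r where tr: "finite t" "t \<subseteq> Y" "x = (\<Sum>a\<in>t. scale (r a) a)"
    using assms(1) unfolding span_explicit by auto
  define c where "c \<psi> = (\<Sum>a\<in>{a \<in> t. w a = \<psi>}. scale (r a) a)" for \<psi>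
  have sub: "{\<psi>. c \<psi> \<noteq> 0} \<subseteq> w ` t"
  proof
    fix \<psi> assume "\<psi> \<in> {\<psi>. c \<psi> \<noteq> 0}"
    then have "{a. a \<in> t \<and> w a = \<psi>} \<noteq> {}" unfolding c_def by (metis (mono_tags, lifting) mem_Collect_eq sum.empty)
    then show "\<psi> \<in> w ` t" by auto
  qed
  have fin: "finite {\<psi>. c \<psi> \<noteq> 0}" by (rule finite_subset[OF sub]) (use tr in auto)
  have "x = (\<Sum>\<psi>\<in>w ` t. c \<psi>)"
    unfolding tr(3) c_def using tr(1) by (rule sum.image_gen)
  also have "\<dots> = (\<Sum>\<psi>\<in>{\<psi>. c \<psi> \<noteq> 0}. c \<psi>)"
    by (rule sum.mono_neutral_right) (use tr sub in auto)
  finally have eq: "x = (\<Sum>\<psi>\<in>{\<psi>. c \<psi> \<noteq> 0}. c \<psi>)" .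
  have sp: "c \<psi> \<in> span {y \<in> Y. w y = \<psi>}" for \<psi>
    unfolding c_def using tr(2) by (intro span_sum span_scale span_base) auto
  have "wt \<psi> (c \<psi>)" for \<psi>
    using span_minimal[OF _ subspace_wt[of \<psi>], of "{y \<in> Y. w y = \<psi>}"] assms(2) sp[of \<psi>] by auto
  with fin eq sp show ?thesis by blast
qed

lemma wt_span_eq:
  assumes "x \<in> span Y" "\<And>y. y \<in> Y \<Longrightarrow> wt (w y) y" "wt \<phi> x"
  shows "x \<in> span {y \<in> Y. w y = \<phi>}"
proof -
  obtain c where "finite {\<psi>. c \<psi> \<noteq> 0} \<and> x = (\<Sum>\<psi>\<in>{\<psi>. c \<psi> \<noteq> 0}. c \<psi>) \<and>
    (\<forall>\<psi>. c \<psi> \<in> span {y \<in> Y. w y = \<psi>} \<and> wt \<psi> (c \<psi>))"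
    using span_weight_decomposition[OF assms(1,2)] ..
  then have c: "finite {\<psi>. c \<psi> \<noteq> 0}" "x = (\<Sum>\<psi>\<in>{\<psi>. c \<psi> \<noteq> 0}. c \<psi>)"
    "\<And>\<psi>. c \<psi> \<in> span {y \<in> Y. w y = \<psi>}" "\<And>\<psi>. wt \<psi> (c \<psi>)"
    by blast+
  let ?A = "insert \<phi> {\<psi>. c \<psi> \<noteq> 0}"
  \<comment> \<open>Subtracting \<open>x\<close> from the component of its own weight gives a
    vanishing sum of weight vectors, so each term vanishes.\<close>
  have "(\<Sum>\<psi>\<in>?A. c \<psi> - (if \<psi> = \<phi> then x else 0)) = (\<Sum>\<psi>\<in>?A. c \<psi>) - x"
    using c(1) by (simp add: sum_subtractf sum.delta)
  also have "(\<Sum>\<psi>\<in>?A. c \<psi>) = x"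
    unfolding c(2) by (rule sum.mono_neutral_right) (use c(1) in auto)
  finally have sum: "(\<Sum>\<psi>\<in>?A. c \<psi> - (if \<psi> = \<phi> then x else 0)) \<in> {0}" by simp
  have "wt \<psi> (c \<psi> - (if \<psi> = \<phi> then x else 0))" for \<psi>
    using assms(3) c(4) by (auto intro: wt_diff)
  then have "c \<phi> - (if \<phi> = \<phi> then x else 0) \<in> {0}"
    by (intro weight_components[OF _ _ _ _ sum]) (auto simp: c(1))
  then show ?thesis using c(3)[of \<phi>] by simp
qed

section \<open>Triples of type sl2 and the reflections that they induce\<close>

definition sl2 :: "('h \<Rightarrow> complex) \<Rightarrow> 'h \<Rightarrow> 'a \<Rightarrow> 'a \<Rightarrow> bool" where
  "sl2 \<phi> k e f \<longleftrightarrow> wt \<phi> e \<and> wt (\<lambda>t. - \<phi> t) f \<and> br e f = T k \<and> \<phi> k = 2"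

text \<open>For an \<open>sl2\<close> triple this is the usual lift of the reflection to the Lie
  algebra; the lemmas below determine its effect on the torus and on weights.\<close>

definition theta :: "'a \<Rightarrow> 'a \<Rightarrow> 'a \<Rightarrow> 'a" where
  "theta e f x = lie_exp e (lie_exp (- f) (lie_exp e x))"

lemma theta_T:
  assumes "sl2 \<phi> k e f"
  shows "theta e f (T t) = T (t - tscale (\<phi> t) k)"
proof -
  have e: "br e (T s) = - scale (\<phi> s) e" for s using assms br_T_right by (auto simp: sl2_def)
  have f: "br f (T s) = scale (\<phi> s) f" for s using assms br_T_right[of "\<lambda>t. - \<phi> t" f s] by (auto simp: sl2_def)
  have ef: "br e f = T k" "br f e = - T k" "\<phi> k = 2" using assms br_swap[of f e] by (auto simp: sl2_def)
  \<comment> \<open>On the vectors that occur here the three exponentials stop after two, three and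
    two terms.\<close>
  have 1: "lie_exp e (T t) = T t - scale (\<phi> t) e"
    by (subst lie_exp_eq[where n = 2])
      (simp_all add: numeral_2_eq_2 divpow_def e br_minus_right br_scale_right br_self)
  have 2: "lie_exp (- f) (T t - scale (\<phi> t) e) = T t - scale (\<phi> t) (T k) - scale (\<phi> t) e"
    by (subst lie_exp_eq[where n = 3])
      (simp_all add: numeral_3_eq_3 numeral_2_eq_2 divpow_def f br_minus_right br_minus_left br_scale_right
        br_diff_right ef br_self scale_right_diff_distrib mult.commute)
  have "scale (\<phi> t * 2) e - scale (\<phi> t) e = scale (\<phi> t) e"
    by (simp flip: scale_left_diff_distrib)
  then have 3: "lie_exp e (T t - scale (\<phi> t) (T k) - scale (\<phi> t) e) = T t - scale (\<phi> t) (T k)"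
    by (subst lie_exp_eq[where n = 2])
      (simp_all add: numeral_2_eq_2 divpow_def e br_minus_right br_minus_left br_scale_right
        br_diff_right ef br_self scale_right_diff_distrib mult.commute)
  show ?thesis unfolding theta_def 1 2 3 by (simp add: T_diff T_scale)
qed

end

text \<open>\<open>lie_exp\<close> has a default value where \<open>ad e\<close> is not nilpotent,
  so \<open>theta\<close> is known to respect brackets only on a subalgebra \<open>G\<close> on
  which \<open>ad e\<close> and \<open>ad f\<close> are locally nilpotent.\<close>

locale lie_sl2 = lie_torus scale br tscale T
  for scale :: "complex \<Rightarrow> 'a \<Rightarrow> 'a::ab_group_add" and br
    and tscale :: "complex \<Rightarrow> 'h \<Rightarrow> 'h::ab_group_add" and T +
  fixes G \<phi> k e f
  assumes G: "subalg G" "range T \<subseteq> G" "e \<in> G" "f \<in> G"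
    and nilp_e: "x \<in> G \<Longrightarrow> nilp e x" and nilp_f: "x \<in> G \<Longrightarrow> nilp f x"
    and sl2: "sl2 \<phi> k e f"
    and \<phi>_diff: "\<phi> (s - t) = \<phi> s - \<phi> t" and \<phi>_scale: "\<phi> (tscale c t) = c * \<phi> t"
begin

lemma exp_closed:
  assumes "subspace S" "\<And>x. x \<in> S \<Longrightarrow> br e x \<in> S" "\<And>x. x \<in> S \<Longrightarrow> br f x \<in> S" "x \<in> S"
  shows "lie_exp e x \<in> S" "lie_exp (- e) x \<in> S" "lie_exp f x \<in> S" "lie_exp (- f) x \<in> S"
proof -
  have "br (- e) y \<in> S" "br (- f) y \<in> S" if "y \<in> S" for y
    using assms(2,3)[OF that] by (simp_all add: br_minus_left subspace_neg[OF assms(1)])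
  then show "lie_exp e x \<in> S" "lie_exp (- e) x \<in> S" "lie_exp f x \<in> S" "lie_exp (- f) x \<in> S"
    using assms(2,3) by (simp_all add: lie_exp_closed[OF assms(1) _ assms(4)])
qed

lemma theta_closed:
  assumes "subspace S" "\<And>x. x \<in> S \<Longrightarrow> br e x \<in> S" "\<And>x. x \<in> S \<Longrightarrow> br f x \<in> S" "x \<in> S"
  shows "theta e f x \<in> S"
  unfolding theta_def using assms by (blast intro: exp_closed)

lemma G_closed: "x \<in> G \<Longrightarrow> lie_exp e x \<in> G" "x \<in> G \<Longrightarrow> lie_exp (- f) x \<in> G" "x \<in> G \<Longrightarrow> theta e f x \<in> G"
  using exp_closed[of G x] theta_closed[of G x] G by (auto simp: subalg_def)

lemma theta_add: "x \<in> G \<Longrightarrow> y \<in> G \<Longrightarrow> theta e f (x + y) = theta e f x + theta e f y"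
  unfolding theta_def by (simp add: lie_exp_add nilp_e nilp_f nilp_minus G_closed)

lemma theta_scale: "x \<in> G \<Longrightarrow> theta e f (scale c x) = scale c (theta e f x)"
  unfolding theta_def by (simp add: lie_exp_scale nilp_e nilp_f nilp_minus G_closed)

lemma theta_br: "x \<in> G \<Longrightarrow> y \<in> G \<Longrightarrow> theta e f (br x y) = br (theta e f x) (theta e f y)"
  unfolding theta_def by (simp add: lie_exp_br nilp_e nilp_f nilp_minus G_closed)

text \<open>Undoing the three exponentials never leaves a subspace that is stable under
  \<open>ad e\<close> and \<open>ad f\<close>, so membership is pulled back from
  \<open>theta e f x\<close> to \<open>x\<close>. With \<open>S = {0}\<close> this gives
  injectivity; for subalgebras it shows that generation is invariant under braid moves.\<close>

lemma theta_reflects: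
  assumes "subspace S" "\<And>x. x \<in> S \<Longrightarrow> br e x \<in> S" "\<And>x. x \<in> S \<Longrightarrow> br f x \<in> S"
    and "x \<in> G" "theta e f x \<in> S"
  shows "x \<in> S"
proof -
  have "x = lie_exp (- e) (lie_exp (- (- f)) (lie_exp (- e) (theta e f x)))"
    unfolding theta_def using assms(4)
    by (simp add: lie_exp_inverse nilp_e nilp_f nilp_minus G_closed del: minus_minus)
  then show ?thesis using assms by (metis exp_closed(2,3) minus_minus)
qed

lemma theta_eq_0: "x \<in> G \<Longrightarrow> theta e f x = 0 \<Longrightarrow> x = 0"
  by (rule theta_reflects[of "{0}" x, simplified]) simp_all

lemma theta_wt:
  assumes "x \<in> G" "wt \<psi> x" "\<And>s t. \<psi> (s - t) = \<psi> s - \<psi> t" "\<And>c t. \<psi> (tscale c t) = c * \<psi> t"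
  shows "wt (\<lambda>t. \<psi> t - \<phi> t * \<psi> k) (theta e f x)"
  unfolding wt_def
proof
  fix t
  \<comment> \<open>The reflection of t: \<open>theta\<close> maps \<open>T ?s\<close> to
    \<open>T t\<close>, so acting by \<open>T t\<close> after \<open>theta\<close> amounts to acting
    by \<open>T ?s\<close> before it.\<close>
  let ?s = "t - tscale (\<phi> t) k"
  have "\<phi> k = 2" using sl2 unfolding sl2_def by blast
  then have "\<phi> ?s = - \<phi> t" unfolding \<phi>_diff \<phi>_scale by simp
  then have "theta e f (T ?s) = T t"
    unfolding theta_T[OF sl2] by simp
  then have "br (T t) (theta e f x) = theta e f (br (T ?s) x)"
    using G assms(1) by (subst theta_br) auto
  also have "br (T ?s) x = scale (\<psi> ?s) x" using assms(2) unfolding wt_def by blast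
  also have "\<psi> ?s = \<psi> t - \<phi> t * \<psi> k" unfolding assms(3,4) ..
  finally show "br (T t) (theta e f x) = scale (\<psi> t - \<phi> t * \<psi> k) (theta e f x)"
    by (simp only: theta_scale[OF assms(1)])
qed

end

section \<open>Bases of a root system under braid moves\<close>

lemma between_0_1_not_int: "0 < x \<Longrightarrow> x < 1 \<Longrightarrow> (x :: real) \<notin> \<int>"
  by (auto elim!: Ints_cases)

locale integral_form =
  fixes g :: "'n::finite \<Rightarrow> 'n \<Rightarrow> real"
  assumes g_sym: "g i j = g j i"
    and g_pos: "(v :: real^'n) \<noteq> 0 \<Longrightarrow> 0 < (\<Sum>i\<in>UNIV. \<Sum>j\<in>UNIV. v $ i * v $ j * g i j)"
    and g_int: "2 * g i j / g i i \<in> \<int>"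
begin

definition ip :: "real^'n \<Rightarrow> real^'n \<Rightarrow> real" where
  "ip u v = (\<Sum>i\<in>UNIV. \<Sum>j\<in>UNIV. u $ i * v $ j * g i j)"

lemma ip_commute: "ip u v = ip v u"
  unfolding ip_def by (subst sum.swap) (simp add: g_sym mult.commute mult.left_commute)

lemma ip_pos: "v \<noteq> 0 \<Longrightarrow> 0 < ip v v"
  unfolding ip_def by (rule g_pos)

lemma ip_eq_0_iff [simp]: "ip v v = 0 \<longleftrightarrow> v = 0"
  using ip_pos[of v] by (cases "v = 0") (auto simp: ip_def)

lemma ip_add_left: "ip (u + v) w = ip u w + ip v w"
  by (simp add: ip_def algebra_simps sum.distrib)

lemma ip_add_right: "ip w (u + v) = ip w u + ip w v"
  by (simp add: ip_def algebra_simps sum.distrib)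

lemma ip_scale_left: "ip (r *\<^sub>R u) v = r * ip u v"
  by (simp add: ip_def sum_distrib_left mult.assoc)

lemma ip_scale_right: "ip u (r *\<^sub>R v) = r * ip u v"
  by (simp add: ip_def sum_distrib_left mult.assoc mult.left_commute)

lemma ip_minus_left [simp]: "ip (- u) v = - ip u v"
  using ip_scale_left[of "-1" u v] by simp

lemma ip_minus_right [simp]: "ip u (- v) = - ip u v"
  using ip_scale_right[of u "-1" v] by simp

lemma ip_diff_left: "ip (u - v) w = ip u w - ip v w"
  using ip_add_left[of u "- v" w] by simp

lemma ip_diff_right: "ip w (u - v) = ip w u - ip w v"
  using ip_add_right[of w u "- v"] by simp

lemma ip_zero [simp]: "ip 0 v = 0" "ip v 0 = 0"
  by (simp_all add: ip_def)

lemma ip_sum_right: "ip u (sum f A) = (\<Sum>i\<in>A. ip u (f i))"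
  by (induction A rule: infinite_finite_induct) (auto simp: ip_add_right)

lemma ip_axis: "ip (axis i 1) (axis j 1) = g i j"
proof -
  have "axis i 1 $ k * axis j 1 $ l * g k l = (if l = j then if k = i then g k l else 0 else 0)" for k l :: 'n
    by (simp add: axis_def)
  then show ?thesis by (simp add: ip_def)
qed

lemma g_diag_pos: "0 < g i i"
  using ip_pos[of "axis i 1"] by (simp add: ip_axis)

lemmas ip_simps = ip_add_left ip_add_right ip_diff_left ip_diff_right ip_scale_left ip_scale_right

section \<open>Reflections and the finite set of roots\<close>

definition refl :: "real^'n \<Rightarrow> real^'n \<Rightarrow> real^'n" where
  "refl a v = v - (2 * ip v a / ip a a) *\<^sub>R a"

lemma ip_refl: "ip (refl a u) (refl a v) = ip u v"
  by (cases "a = 0") (simp_all add: refl_def ip_simps field_simps ip_commute[of a v])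

lemma refl_self: "refl a a = - a"
  by (cases "a = 0") (simp_all add: refl_def scaleR_2)

lemma refl_minus: "refl a (- v) = - refl a v"
  by (simp add: refl_def)

lemma refl_refl [simp]: "refl a (refl a v) = v"
  by (cases "a = 0") (simp_all add: refl_def ip_simps divide_simps flip: scaleR_left_distrib)

text \<open>The conditions are, in turn: the length of some prime root, integral coordinates in the
  root lattice, and integral coordinates of the coroot \<open>2 v / (v, v)\<close> in the coroot
  lattice. Membership is thus a coordinatewise condition and not one about orbits of the Weyl
  group.\<close>

definition roots :: "(real^'n) set" where
  "roots = {v. (\<exists>i. ip v v = g i i) \<and> (\<forall>i. v $ i \<in> \<int>) \<and> (\<forall>i. v $ i * g i i / ip v v \<in> \<int>)}"

lemma root_nonzero: "v \<in> roots \<Longrightarrow> v \<noteq> 0"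
  using g_diag_pos unfolding roots_def by (force simp: less_le)

lemma axis_root: "axis i 1 \<in> roots"
proof -
  have "g i i \<noteq> 0" using g_diag_pos[of i] by simp
  then have "axis i 1 $ k \<in> \<int>" "axis i 1 $ k * g k k / g i i \<in> \<int>" for k
    by (auto simp: axis_def)
  then show ?thesis by (auto simp: roots_def ip_axis)
qed

text \<open>Expand \<open>u\<close> in coroot coordinates and \<open>v\<close> in root coordinates:
  both are integral, and what remains are Cartan integers of prime roots.\<close>

lemma root_cartan_int:
  assumes "u \<in> roots" "v \<in> roots"
  shows "2 * ip u v / ip u u \<in> \<int>"
proof -
  have "2 * ip u v / ip u u = (\<Sum>i\<in>UNIV. \<Sum>j\<in>UNIV. (u $ i * g i i / ip u u) * v $ j * (2 * g i j / g i i))"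
    unfolding ip_def[of u v] sum_distrib_left sum_divide_distrib
    using g_diag_pos by (intro sum.cong) (simp_all add: less_le)
  also have "\<dots> \<in> \<int>"
    using assms by (intro Ints_sum Ints_mult g_int) (auto simp: roots_def)
  finally show ?thesis .
qed

lemma refl_root:
  assumes "a \<in> roots" "v \<in> roots"
  shows "refl a v \<in> roots"
proof -
  let ?m = "2 * ip v a / ip a a" and ?m' = "2 * ip v a / ip v v"
  have nz: "ip a a \<noteq> 0" "ip v v \<noteq> 0" using assms root_nonzero by auto
  have m: "?m \<in> \<int>" "?m' \<in> \<int>"
    using root_cartan_int[OF assms] root_cartan_int[OF assms(2,1)] by (auto simp: ip_commute[of v a])
  have "ip (refl a v) (refl a v) = ip v v" by (rule ip_refl)
  moreover have "refl a v $ i \<in> \<int>" for i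
    unfolding refl_def vector_minus_component vector_scaleR_component real_scaleR_def
    using assms m by (intro Ints_diff Ints_mult) (auto simp: roots_def)
  moreover have "refl a v $ i * g i i / ip v v \<in> \<int>" for i
  proof -
    \<comment> \<open>The coroot is reflected as well, with the Cartan integer taken relative to
      \<open>v\<close> instead of \<open>a\<close>.\<close>
    have "refl a v $ i * g i i / ip v v = v $ i * g i i / ip v v - ?m' * (a $ i * g i i / ip a a)"
      using nz by (simp add: refl_def field_simps)
    also have "\<dots> \<in> \<int>"
      using assms m by (intro Ints_diff Ints_mult) (auto simp: roots_def)
    finally show ?thesis .
  qed
  ultimately show ?thesis using assms(2) by (auto simp: roots_def)
qed

lemma minus_root: "v \<in> roots \<Longrightarrow> - v \<in> roots"
  by (metis refl_root refl_self)

lemma continuous_on_ip: "continuous_on S (\<lambda>v. ip v v)"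
  unfolding ip_def by (intro continuous_intros)

text \<open>On the unit sphere the form has a positive minimum. Vectors of bounded length are
  therefore bounded in the Euclidean norm, and a bounded set contains only finitely many integral
  vectors.\<close>

lemma finite_roots: "finite roots"
proof -
  have ne: "sphere (0 :: real^'n) 1 \<noteq> {}" by simp
  obtain z :: "real^'n" where z: "z \<in> sphere 0 1" "\<And>v. v \<in> sphere 0 1 \<Longrightarrow> ip z z \<le> ip v v"
    using continuous_attains_inf[OF compact_sphere ne continuous_on_ip] by auto
  then have pos: "0 < ip z z" by (intro ip_pos) auto
  define C where "C = Max (range (\<lambda>i. g i i)) / ip z z"
  have bound: "(norm v)\<^sup>2 \<le> C" if "v \<in> roots" for v
  proof -
    have nz: "norm v \<noteq> 0" using root_nonzero[OF that] by simp
    have "ip z z \<le> ip ((1 / norm v) *\<^sub>R v) ((1 / norm v) *\<^sub>R v)"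
      using nz by (intro z) simp
    then have "ip z z * (norm v)\<^sup>2 \<le> ip v v"
      using nz by (simp add: ip_simps field_simps power2_eq_square)
    also have "\<dots> \<le> Max (range (\<lambda>i. g i i))"
      using that by (auto simp: roots_def)
    finally show ?thesis using pos by (simp add: C_def field_simps)
  qed
  let ?A = "real_of_int ` {- \<lceil>C\<rceil>..\<lceil>C\<rceil>}"
  have "roots \<subseteq> vec_lambda ` (UNIV \<rightarrow>\<^sub>E ?A)"
  proof
    fix v assume v: "v \<in> roots"
    have "v $ i \<in> ?A" for i
    proof -
      obtain k where k: "v $ i = of_int k" using v unfolding roots_def by (metis (mono_tags, lifting) Ints_cases mem_Collect_eq)
      have "\<bar>k\<bar> \<le> k\<^sup>2"
      proof (cases "k = 0")
        case False
        then have "\<bar>k\<bar> * 1 \<le> \<bar>k\<bar> * \<bar>k\<bar>" by (intro mult_left_mono) auto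
        then show ?thesis by (simp add: power2_eq_square)
      qed simp
      then have "real_of_int \<bar>k\<bar> \<le> real_of_int (k\<^sup>2)" by (simp only: of_int_le_iff)
      then have "\<bar>v $ i\<bar> \<le> (v $ i)\<^sup>2" using k by simp
      also have "\<dots> \<le> (norm v)\<^sup>2"
        using power_mono[OF component_le_norm_cart[of v i], of 2] by simp
      also have "\<dots> \<le> C" by (rule bound[OF v])
      finally have "\<bar>k\<bar> \<le> \<lceil>C\<rceil>" using k by linarith
      then have "k \<in> {- \<lceil>C\<rceil>..\<lceil>C\<rceil>}" by (auto simp: abs_le_iff)
      then show ?thesis using k by blast
    qed
    then show "v \<in> vec_lambda ` (UNIV \<rightarrow>\<^sub>E ?A)"
      by (intro image_eqI[of _ _ "vec_nth v"]) auto
  qed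
  moreover have "finite (UNIV \<rightarrow>\<^sub>E ?A :: ('n \<Rightarrow> real) set)" by (intro finite_PiE) auto
  ultimately show ?thesis using finite_surj by blast
qed

section \<open>Braid moves on indexed bases\<close>

definition step :: "('n \<Rightarrow> real^'n) \<Rightarrow> ('n \<Rightarrow> real^'n) \<Rightarrow> bool" where
  "step b b' \<longleftrightarrow> (\<exists>i j. b' = b(j := refl (b i) (b j)))"

abbreviation steps :: "('n \<Rightarrow> real^'n) \<Rightarrow> ('n \<Rightarrow> real^'n) \<Rightarrow> bool" where
  "steps \<equiv> step\<^sup>*\<^sup>*"

abbreviation std :: "'n \<Rightarrow> real^'n" where
  "std \<equiv> \<lambda>i. axis i 1"

definition comb :: "('n \<Rightarrow> real^'n) \<Rightarrow> ('n \<Rightarrow> real) \<Rightarrow> real^'n" where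
  "comb b c = (\<Sum>i\<in>UNIV. c i *\<^sub>R b i)"

text \<open>The same pair of indices undoes the move: a reflection is an involution, and for equal
  indices the move is a change of sign.\<close>

lemma step_sym:
  assumes "step b b'"
  shows "step b' b"
proof -
  obtain i j where b': "b' = b(j := refl (b i) (b j))"
    using assms[unfolded step_def] by (elim exE)
  have "refl (b' i) (b' j) = b j"
    by (cases "i = j") (simp_all add: b' refl_self)
  then have "b = b'(j := refl (b' i) (b' j))"
    by (simp only: b' fun_upd_upd fun_upd_triv)
  then show ?thesis unfolding step_def by (intro exI)
qed

lemma steps_sym: "steps b b' \<Longrightarrow> steps b' b"
  by (induction rule: rtranclp_induct)
    (auto intro: step_sym converse_rtranclp_into_rtranclp)

lemma comb_upd_vector: "comb (b(j := b j - m *\<^sub>R b i)) c = comb b (c(i := c i - m * c j))"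
proof -
  have "comb (b(j := b j - m *\<^sub>R b i)) c = (\<Sum>k\<in>UNIV. c k *\<^sub>R b k - (if k = j then (c j * m) *\<^sub>R b i else 0))"
    unfolding comb_def by (intro sum.cong) (auto simp: algebra_simps)
  also have "\<dots> = (\<Sum>k\<in>UNIV. c k *\<^sub>R b k) - (c j * m) *\<^sub>R b i"
    by (simp add: sum_subtractf)
  also have "\<dots> = (\<Sum>k\<in>UNIV. c k *\<^sub>R b k - (if k = i then (c j * m) *\<^sub>R b i else 0))"
    by (simp add: sum_subtractf)
  also have "\<dots> = comb b (c(i := c i - m * c j))"
    unfolding comb_def by (intro sum.cong) (auto simp: algebra_simps)
  finally show ?thesis .
qed

lemma comb_inject_upd: "comb b (c(i := c i + r)) = comb b c + r *\<^sub>R b i"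
proof -
  have "comb b (c(i := c i + r)) = (\<Sum>k\<in>UNIV. c k *\<^sub>R b k + (if k = i then r *\<^sub>R b i else 0))"
    unfolding comb_def by (intro sum.cong) (auto simp: algebra_simps)
  also have "\<dots> = comb b c + r *\<^sub>R b i" by (simp add: sum.distrib comb_def)
  finally show ?thesis .
qed

lemma comb_zero: "comb b (\<lambda>i. 0) = 0"
  by (simp add: comb_def)

lemma comb_single: "comb b ((\<lambda>i. 0)(i := r)) = r *\<^sub>R b i"
  using comb_inject_upd[of b "\<lambda>i. 0" i r] by (simp add: comb_zero)

lemma comb_diff: "comb b (\<lambda>i. c i - d i) = comb b c - comb b d"
  by (simp add: comb_def scaleR_left_diff_distrib sum_subtractf)

text \<open>The invariant carried along braid moves. Its last clause says that the coordinates of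
  roots in the base, and those of their coroots in the coroots of the base, stay integral in every
  base reached from the prime root system.\<close>

definition good :: "('n \<Rightarrow> real^'n) \<Rightarrow> bool" where
  "good b \<longleftrightarrow> range b \<subseteq> roots \<and> (\<forall>c. comb b c = 0 \<longrightarrow> c = (\<lambda>i. 0)) \<and>
    (\<forall>v\<in>roots. \<exists>c. v = comb b c \<and> (\<forall>i. c i \<in> \<int> \<and> c i * ip (b i) (b i) / ip v v \<in> \<int>))"

lemma good_inj:
  assumes "good b" "comb b c = comb b d"
  shows "c = d"
proof -
  have "comb b (\<lambda>i. c i - d i) = 0" using assms(2) by (simp add: comb_diff)
  then have "(\<lambda>i. c i - d i) = (\<lambda>i. 0)" using assms(1) by (simp add: good_def)
  then have "c i - d i = 0" for i by (rule fun_cong)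
  then show ?thesis by auto
qed

lemma good_root: "good b \<Longrightarrow> b i \<in> roots"
  by (auto simp: good_def)

lemma good_std: "good std"
proof -
  have c: "comb std (vec_nth v) = v" for v
    by (simp add: comb_def vec_eq_iff axis_def if_distrib cong: if_cong)
  have "c = (\<lambda>i. 0)" if "comb std c = 0" for c
  proof -
    have "comb std c = (\<chi> i. c i)" using c[of "\<chi> i. c i"] by (simp add: comb_def)
    then show ?thesis using that by (auto simp: vec_eq_iff)
  qed
  moreover have "\<exists>c. v = comb std c \<and> (\<forall>i. c i \<in> \<int> \<and> c i * ip (std i) (std i) / ip v v \<in> \<int>)"
    if "v \<in> roots" for v
    using that by (intro exI[of _ "vec_nth v"]) (auto simp: c ip_axis roots_def)
  ultimately show ?thesis by (auto simp: good_def axis_root)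
qed

lemma good_step:
  assumes "good b" "step b b'"
  shows "good b'"
proof -
  obtain i j where b': "b' = b(j := refl (b i) (b j))" using assms(2) by (auto simp: step_def)
  let ?m = "2 * ip (b j) (b i) / ip (b i) (b i)" and ?m' = "2 * ip (b j) (b i) / ip (b j) (b j)"
  have b'': "b' = b(j := b j - ?m *\<^sub>R b i)" by (simp add: b' refl_def)
  have nz: "ip (b i) (b i) \<noteq> 0" "ip (b j) (b j) \<noteq> 0" using good_root[OF assms(1)] root_nonzero by auto
  have m: "?m \<in> \<int>" "?m' \<in> \<int>"
    using root_cartan_int[of "b i" "b j"] root_cartan_int[of "b j" "b i"] good_root[OF assms(1)]
    by (auto simp: ip_commute[of "b j" "b i"])
  have m2: "i = j \<Longrightarrow> ?m = 2" using nz by simp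
  have norm: "ip (b' k) (b' k) = ip (b k) (b k)" for k by (simp add: b' ip_refl)
  have "range b' \<subseteq> roots"
    using good_root[OF assms(1)] by (auto simp: b' refl_root)
  moreover have "c = (\<lambda>i. 0)" if "comb b' c = 0" for c
  proof -
    have "c(i := c i - ?m * c j) = (\<lambda>i. 0)"
      using that assms(1) unfolding b'' comb_upd_vector good_def by blast
    then have "(c(i := c i - ?m * c j)) k = 0" for k by simp
    note * = this[of i] this
    have "c j = 0" using *(1) *(2)[of j] m2 by (cases "i = j") auto
    show ?thesis
    proof
      show "c k = 0" for k using *(1) *(2)[of k] \<open>c j = 0\<close> by (cases "k = i") auto
    qed
  qed
  moreover have "\<exists>c. v = comb b' c \<and> (\<forall>i. c i \<in> \<int> \<and> c i * ip (b' i) (b' i) / ip v v \<in> \<int>)"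
    if v: "v \<in> roots" for v
  proof -
    obtain c where c: "v = comb b c" "\<And>i. c i \<in> \<int>" "\<And>i. c i * ip (b i) (b i) / ip v v \<in> \<int>"
      using assms(1) v unfolding good_def by blast
    show ?thesis
    proof (cases "i = j")
      case True
      have "v = comb b' (c(i := - c i))"
        unfolding b'' comb_upd_vector using True m2 c(1) by simp
      moreover have "(c(i := - c i)) k \<in> \<int>" "(c(i := - c i)) k * ip (b' k) (b' k) / ip v v \<in> \<int>" for k
        using c(2)[of k] c(3)[of k] by (auto simp: norm)
      ultimately show ?thesis by blast
    next
      case False
      have "v = comb b' (c(i := c i + ?m * c j))"
        unfolding b'' comb_upd_vector using False c(1) by simp
      moreover have "(c(i := c i + ?m * c j)) k \<in> \<int>" for k
        unfolding fun_upd_apply using c(2) m by (auto intro!: Ints_add Ints_mult[of ?m] simp del: times_divide_eq_left)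
      moreover have "(c(i := c i + ?m * c j)) k * ip (b' k) (b' k) / ip v v \<in> \<int>" for k
      proof (cases "k = i")
        case True
        \<comment> \<open>Rescaled to coroots, the correction term is the other Cartan integer
          \<open>?m'\<close> times the rescaled coefficient of \<open>b j\<close>.\<close>
        have "(c i + ?m * c j) * ip (b i) (b i) / ip v v
            = c i * ip (b i) (b i) / ip v v + ?m' * (c j * ip (b j) (b j) / ip v v)"
          using nz by (simp add: add_divide_distrib distrib_right)
        also have "\<dots> \<in> \<int>" using c m by (intro Ints_add Ints_mult)
        finally show ?thesis using True by (simp add: norm)
      next
        case False
        then show ?thesis using c(3)[of k] by (simp add: norm)
      qed
      ultimately show ?thesis by blast
    qed
  qed
  ultimately show ?thesis by (auto simp: good_def)
qed

lemma good_steps: "steps b b' \<Longrightarrow> good b \<Longrightarrow> good b'"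
  by (induction rule: rtranclp_induct) (auto intro: good_step)

text \<open>The coefficients of a root with respect to a base, rescaled to coroots, are integers; a root
  with a coefficient 1 can therefore not be longer than the corresponding base vector.\<close>

lemma non_root:
  assumes "good b" "i \<noteq> j" "0 < r * (2 * ip (b i) (b j)) + r\<^sup>2 * ip (b i) (b i)"
  shows "b j + r *\<^sub>R b i \<notin> insert 0 roots"
proof
  assume mem: "b j + r *\<^sub>R b i \<in> insert 0 roots"
  let ?v = "b j + r *\<^sub>R b i" and ?c = "(\<lambda>k. 0)(j := 1, i := r)"
  have v: "?v = comb b ?c"
    using comb_inject_upd[of b "(\<lambda>k. 0)(j := 1)" i r] assms(2) by (simp add: comb_single)
  have cj: "?c j = 1" using assms(2) by simp
  then have "?c \<noteq> (\<lambda>k. 0)" by (metis zero_neq_one)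
  then have "?v \<noteq> 0" using assms(1) v unfolding good_def by metis
  with mem have root: "?v \<in> roots" by simp
  then obtain c where c: "?v = comb b c" "\<And>k. c k * ip (b k) (b k) / ip ?v ?v \<in> \<int>"
    using assms(1) unfolding good_def by blast
  have "c = ?c" using good_inj[OF assms(1)] v c(1) by metis
  with c(2)[of j] cj have int: "ip (b j) (b j) / ip ?v ?v \<in> \<int>" by simp
  have pos: "0 < ip (b j) (b j)" using good_root[OF assms(1)] by (intro ip_pos root_nonzero)
  have "ip ?v ?v = ip (b j) (b j) + (r * (2 * ip (b i) (b j)) + r\<^sup>2 * ip (b i) (b i))"
    by (simp add: ip_simps ip_commute[of "b j" "b i"] power2_eq_square algebra_simps)
  with assms(3) have less: "ip (b j) (b j) < ip ?v ?v" by linarith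
  then have "0 < ip (b j) (b j) / ip ?v ?v" "ip (b j) (b j) / ip ?v ?v < 1" using pos by simp_all
  with int show False using between_0_1_not_int by blast
qed

text \<open>Twice a base vector would have a coroot coordinate 1/2. This covers the relations in
  which \<open>\<alpha>'\<close> and \<open>\<beta>\<close> coincide.\<close>

lemma twice_non_root:
  assumes "good b"
  shows "2 *\<^sub>R b j \<notin> insert 0 roots"
proof
  assume mem: "2 *\<^sub>R b j \<in> insert 0 roots"
  have pos: "0 < ip (b j) (b j)" "b j \<noteq> 0"
    using good_root[OF assms] ip_pos root_nonzero by blast+
  with mem have "2 *\<^sub>R b j \<in> roots" by simp
  then obtain c where c: "2 *\<^sub>R b j = comb b c" "\<And>k. c k * ip (b k) (b k) / ip (2 *\<^sub>R b j) (2 *\<^sub>R b j) \<in> \<int>"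
    using assms unfolding good_def by blast
  have "c = (\<lambda>k. 0)(j := 2)" using good_inj[OF assms] c(1) comb_single by metis
  with c(2)[of j] pos have "(1 / 2 :: real) \<in> \<int>" by (simp add: ip_simps)
  then show False using between_0_1_not_int[of "1 / 2"] by simp
qed

section \<open>Descent to a base of Cartan type\<close>

lemma steps_flip:
  assumes "finite A"
  shows "steps b (\<lambda>i. if i \<in> A then - b i else b i)"
  using assms
proof (induction A rule: finite_induct)
  case (insert j A)
  let ?b = "\<lambda>i. if i \<in> A then - b i else b i"
  have "(\<lambda>i. if i \<in> insert j A then - b i else b i) = ?b(j := refl (?b j) (?b j))"
    using insert.hyps by (auto simp: refl_self)
  then have "step ?b (\<lambda>i. if i \<in> insert j A then - b i else b i)"
    unfolding step_def by blast
  then show ?case by (rule rtranclp.rtrancl_into_rtrancl[OF insert.IH])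
qed simp

text \<open>Finitely many hyperplanes do not cover the space.\<close>

lemma generic_functional: "\<exists>w. \<forall>v\<in>roots. w \<bullet> v \<noteq> 0"
proof -
  have "negligible (\<Union>v\<in>roots. {w. v \<bullet> w = 0})"
    using finite_roots root_nonzero by (intro negligible_Union) (auto intro: negligible_hyperplane)
  then have "(\<Union>v\<in>roots. {w. v \<bullet> w = 0}) \<noteq> UNIV" by (metis non_negligible_UNIV)
  then show ?thesis by (auto simp: inner_commute)
qed

text \<open>Think of \<open>x\<close> and \<open>y\<close> as the heights of \<open>u\<close> and
  \<open>v\<close>. If neither reflection lowers the absolute height, multiplying the two resulting
  inequalities gives \<open>ip u u * ip v v \<le> (ip u v)^2\<close>, against the strict
  Cauchy-Schwarz inequality for independent vectors.\<close>

lemma pair_descent: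
  assumes "u \<noteq> 0" "v \<noteq> 0" "\<And>r. v \<noteq> r *\<^sub>R u" "0 < ip u v" "0 < x" "0 < y"
  shows "\<bar>y - 2 * ip v u / ip u u * x\<bar> < y \<or> \<bar>x - 2 * ip u v / ip v v * y\<bar> < x"
proof (rule ccontr)
  assume "\<not> ?thesis"
  then have *: "y \<le> \<bar>y - 2 * ip v u / ip u u * x\<bar>" "x \<le> \<bar>x - 2 * ip u v / ip v v * y\<bar>" by auto
  let ?p = "ip u v"
  have pos: "0 < ip u u" "0 < ip v v" using assms ip_pos by auto
  have "0 < 2 * ip v u / ip u u * x" "0 < 2 * ip u v / ip v v * y"
    using assms pos by (simp_all add: ip_commute[of v u])
  with * have "2 * y \<le> 2 * ip v u / ip u u * x" "2 * x \<le> 2 * ip u v / ip v v * y" by linarith+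
  then have 1: "y * ip u u \<le> ?p * x" "x * ip v v \<le> ?p * y"
    using pos by (simp_all add: field_simps ip_commute[of v u])
  have "(y * ip u u) * (x * ip v v) \<le> (?p * x) * (?p * y)"
    using assms pos by (intro mult_mono[OF 1]) simp_all
  then have "ip u u * ip v v \<le> ?p * ?p" using assms by (simp add: field_simps)
  moreover have "0 < ip (v - (?p / ip u u) *\<^sub>R u) (v - (?p / ip u u) *\<^sub>R u)"
    using assms(3) by (intro ip_pos) simp
  then have "?p * ?p / ip u u < ip v v"
    using pos assms(1) by (simp add: ip_simps ip_commute[of v u])
  then have "?p * ?p < ip u u * ip v v"
    using pos by (simp add: pos_divide_less_eq mult.commute)
  ultimately show False by simp
qed

text \<open>A base that minimises the total absolute height with respect to a generic functional is, up to
  signs, a base of Cartan type.\<close>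

lemma cartan_base_exists: "\<exists>b. steps std b \<and> (\<forall>i j. i \<noteq> j \<longrightarrow> ip (b i) (b j) \<le> 0)"
proof -
  obtain w where w: "\<And>v. v \<in> roots \<Longrightarrow> w \<bullet> v \<noteq> 0" using generic_functional by blast
  let ?B = "{b. steps std b}" and ?f = "\<lambda>b. \<Sum>i\<in>UNIV. \<bar>w \<bullet> b i\<bar>"
  have "?B \<subseteq> UNIV \<rightarrow>\<^sub>E roots"
    using good_steps good_std good_root by fastforce
  then have "finite ?B"
    by (rule finite_subset) (intro finite_PiE finite_roots finite)
  moreover have "?B \<noteq> {}" by auto
  ultimately have "arg_min_on ?f ?B \<in> ?B" "\<And>b. b \<in> ?B \<Longrightarrow> ?f (arg_min_on ?f ?B) \<le> ?f b"
    by (rule arg_min_if_finite, rule arg_min_least)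
  then obtain b0 where b0: "b0 \<in> ?B" "\<And>b. b \<in> ?B \<Longrightarrow> ?f b0 \<le> ?f b" by blast
  \<comment> \<open>Sign changes are braid moves and preserve absolute heights, so all heights may
    be taken positive.\<close>
  define b where "b = (\<lambda>i. if i \<in> {i. w \<bullet> b0 i < 0} then - b0 i else b0 i)"
  have b: "steps std b"
    using b0(1) steps_flip[of "{i. w \<bullet> b0 i < 0}" b0] unfolding b_def by auto
  have good: "good b" using b good_steps good_std by blast
  have "?f b = ?f b0" by (intro sum.cong) (auto simp: b_def)
  with b0 have min: "?f b \<le> ?f b'" if "steps std b'" for b' using that by auto
  have pos: "0 < w \<bullet> b i" for i
    using w[OF good_root[OF good], of i] by (auto simp: b_def split: if_splits)
  have "ip (b i) (b j) \<le> 0" if "i \<noteq> j" for i j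
  proof (rule ccontr)
    assume "\<not> ?thesis"
    then have ip: "0 < ip (b i) (b j)" by simp
    have less: False if "step b b'" "\<And>k. k \<noteq> l \<Longrightarrow> b' k = b k" "\<bar>w \<bullet> b' l\<bar> < w \<bullet> b l" for b' l
    proof -
      have "?f b' < ?f b"
      proof (rule sum_strict_mono_ex1)
        show "\<forall>k\<in>UNIV. \<bar>w \<bullet> b' k\<bar> \<le> \<bar>w \<bullet> b k\<bar>"
        proof
          show "\<bar>w \<bullet> b' k\<bar> \<le> \<bar>w \<bullet> b k\<bar>" for k
            using that(2)[of k] that(3) by (cases "k = l") auto
        qed
        show "\<exists>k\<in>UNIV. \<bar>w \<bullet> b' k\<bar> < \<bar>w \<bullet> b k\<bar>" 
          by (intro bexI[of _ l] less_le_trans[OF that(3) abs_ge_self]) simp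
      qed simp
      moreover have "steps std b'" using b that(1) by simp
      ultimately show False using min by (meson not_le)
    qed
    have ne: "b j \<noteq> r *\<^sub>R b i" for r
    proof
      assume "b j = r *\<^sub>R b i"
      then have "comb b ((\<lambda>k. 0)(j := 1)) = comb b ((\<lambda>k. 0)(i := r))" by (simp only: comb_single scaleR_one)
      then have "((\<lambda>k. 0)(j := 1)) = ((\<lambda>k. 0)(i := r))" by (rule good_inj[OF good])
      then have "((\<lambda>k. 0)(j := 1 :: real)) j = ((\<lambda>k. 0)(i := r)) j" by simp
      then show False using that by simp
    qed
    have "\<bar>w \<bullet> b j - 2 * ip (b j) (b i) / ip (b i) (b i) * (w \<bullet> b i)\<bar> < w \<bullet> b j \<or>
        \<bar>w \<bullet> b i - 2 * ip (b i) (b j) / ip (b j) (b j) * (w \<bullet> b j)\<bar> < w \<bullet> b i"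
      using good_root[OF good] root_nonzero ne ip pos by (intro pair_descent) auto
    then have "\<bar>w \<bullet> refl (b i) (b j)\<bar> < w \<bullet> b j \<or> \<bar>w \<bullet> refl (b j) (b i)\<bar> < w \<bullet> b i"
      by (simp add: refl_def inner_diff_right)
    then show False
      using less[of "b(j := refl (b i) (b j))" j] less[of "b(i := refl (b j) (b i))" i]
      unfolding step_def by (metis fun_upd_other fun_upd_same)
  qed
  with b show ?thesis by blast
qed

text \<open>This plays the part of induction on the height of positive roots. Since
  \<open>0 < ip v v\<close>, some \<open>b i\<close> with a positive coefficient has a positive
  product with \<open>v\<close>, and reflecting in it lowers that coefficient alone. Either the sum
  of the coefficients drops, or the image is negative and then \<open>v\<close> is a multiple of
  \<open>b i\<close>.\<close>

lemma one_signed_induct_pos: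
  fixes c :: "'n \<Rightarrow> nat"
  assumes "good b"
    and signed: "\<And>v. v \<in> P \<Longrightarrow> v \<noteq> 0 \<and> (\<exists>c :: 'n \<Rightarrow> nat. v = comb b (\<lambda>i. c i) \<or> v = - comb b (\<lambda>i. c i))"
    and closed: "\<And>v i. v \<in> P \<Longrightarrow> refl (b i) v \<in> P"
    and base: "\<And>r i. r *\<^sub>R b i \<in> P \<Longrightarrow> D (r *\<^sub>R b i)"
    and descend: "\<And>v i. v \<in> P \<Longrightarrow> D (refl (b i) v) \<Longrightarrow> D v"
    and "v \<in> P" "v = comb b (\<lambda>i. c i)"
  shows "D v"
  using assms(6,7)
proof (induction "\<Sum>i\<in>UNIV. c i" arbitrary: v c rule: less_induct)
  case less
  have "0 < ip v v" using signed[OF less.prems(1)] by (intro ip_pos) blast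
  also have "ip v v = (\<Sum>i\<in>UNIV. c i * ip v (b i))"
    by (subst (2) less.prems(2)) (simp add: comb_def ip_sum_right ip_scale_right)
  finally have "\<exists>i. 0 < c i * ip v (b i)"
    by (metis (no_types, lifting) not_le sum_nonpos)
  then obtain i where i: "0 < c i * ip v (b i)" ..
  then have ci: "0 < c i" "0 < ip v (b i)" by (auto simp: zero_less_mult_iff)
  define m where "m = 2 * ip v (b i) / ip (b i) (b i)"
  have m: "0 < m"
    unfolding m_def using ci ip_pos[OF root_nonzero[OF good_root[OF assms(1)], of i]] by simp
  have refl: "refl (b i) v = comb b ((\<lambda>i. c i)(i := c i - m))"
    using comb_inject_upd[of b "\<lambda>i. c i" i "- m"] by (simp add: refl_def m_def less.prems(2)[symmetric])
  have "refl (b i) v \<in> P" by (rule closed[OF less.prems(1)])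
  then obtain d :: "'n \<Rightarrow> nat" where
    d: "refl (b i) v = comb b (\<lambda>i. d i) \<or> refl (b i) v = - comb b (\<lambda>i. d i)"
    using signed by blast
  show ?case
  proof (cases "refl (b i) v = comb b (\<lambda>i. d i)")
    case True
    then have "(\<lambda>i. real (d i)) = (\<lambda>i. c i)(i := c i - m)" using refl good_inj[OF assms(1)] by metis
    then have *: "real (d k) = ((\<lambda>i. c i)(i := c i - m)) k" for k by metis
    have "(\<Sum>i\<in>UNIV. d i) < (\<Sum>i\<in>UNIV. c i)"
    proof (rule sum_strict_mono_ex1)
      have "real (d k) \<le> real (c k)" for k using *[of k] m by (cases "k = i") auto
      then show "\<forall>k\<in>UNIV. d k \<le> c k" by simp
      have "real (d i) < real (c i)" using *[of i] m by simp
      then show "\<exists>k\<in>UNIV. d k < c k" by auto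
    qed simp
    then have "D (refl (b i) v)" by (rule less.hyps) (fact \<open>refl (b i) v \<in> P\<close>, fact True)
    then show ?thesis by (rule descend[OF less.prems(1)])
  next
    case False
    with d have "refl (b i) v = comb b (\<lambda>i. - real (d i))" by (simp add: comb_def sum_negf)
    then have "(\<lambda>i. - real (d i)) = (\<lambda>i. c i)(i := c i - m)" using refl good_inj[OF assms(1)] by metis
    then have *: "- real (d k) = ((\<lambda>i. c i)(i := c i - m)) k" for k by metis
    have "real (c k) = 0" if "k \<noteq> i" for k using *[of k] that by simp
    then have "(\<lambda>i. real (c i)) = (\<lambda>k. 0)(i := real (c i))" by auto
    then have "v = real (c i) *\<^sub>R b i" using less.prems(2) comb_single by metis
    then show ?thesis using base less.prems(1) by metis
  qed
qed

text \<open>Negating the base turns negative vectors into positive ones and leaves the reflections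
  unchanged.\<close>

lemma one_signed_induct:
  assumes "good b"
    and signed: "\<And>v. v \<in> P \<Longrightarrow> v \<noteq> 0 \<and> (\<exists>c :: 'n \<Rightarrow> nat. v = comb b (\<lambda>i. c i) \<or> v = - comb b (\<lambda>i. c i))"
    and closed: "\<And>v i. v \<in> P \<Longrightarrow> refl (b i) v \<in> P"
    and base: "\<And>r i. r *\<^sub>R b i \<in> P \<Longrightarrow> D (r *\<^sub>R b i)"
    and descend: "\<And>v i. v \<in> P \<Longrightarrow> D (refl (b i) v) \<Longrightarrow> D v"
    and "v \<in> P"
  shows "D v"
proof -
  let ?b = "\<lambda>i. - b i"
  have "steps b ?b" using steps_flip[of UNIV b] by simp
  then have good: "good ?b" using assms(1) by (rule good_steps)
  have comb: "comb ?b c = - comb b c" for c by (simp add: comb_def sum_negf)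
  have refl: "refl (- a) u = refl a u" for a u by (simp add: refl_def)
  obtain c :: "'n \<Rightarrow> nat" where "v = comb b (\<lambda>i. c i) \<or> v = comb ?b (\<lambda>i. c i)"
    using signed[OF assms(6)] unfolding comb by blast
  then show ?thesis
  proof
    assume v: "v = comb b (\<lambda>i. c i)"
    show ?thesis
      by (rule one_signed_induct_pos[where P = P and D = D and b = b and v = v and c = c, OF assms v])
  next
    assume v: "v = comb ?b (\<lambda>i. c i)"
    show ?thesis
    proof (rule one_signed_induct_pos[where P = P and D = D and b = ?b and v = v and c = c, OF good _ _ _ _ assms(6) v])
      show "u \<noteq> 0 \<and> (\<exists>c :: 'n \<Rightarrow> nat. u = comb ?b (\<lambda>i. c i) \<or> u = - comb ?b (\<lambda>i. c i))" if "u \<in> P" for u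
        using signed[OF that] unfolding comb by auto
      show "D (r *\<^sub>R ?b i)" if "r *\<^sub>R ?b i \<in> P" for r i
        using base[of "- r" i] that by simp
      show "refl (?b i) u \<in> P" if "u \<in> P" for u i
        unfolding refl using that by (rule closed)
      show "D u" if "u \<in> P" "D (refl (?b i) u)" for u i
        using that unfolding refl by (rule descend)
    qed
  qed
qed

text \<open>A move between the two sides of an orthogonal splitting does nothing, and a move within
  one side only adds vectors of that side. Since moves are reversible, this carries
  indecomposability to every base.\<close>

lemma split_step:
  assumes "step b b'" "\<And>i j. i \<in> A \<Longrightarrow> j \<notin> A \<Longrightarrow> ip (b i) (b j) = 0" "i \<in> A" "j \<notin> A"
  shows "ip (b' i) (b' j) = 0"
proof -
  obtain k l where b': "b' = b(l := refl (b k) (b l))" using assms(1) by (auto simp: step_def)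
  have s: "ip (b p) (b q) = 0" if "p \<in> A \<longleftrightarrow> q \<notin> A" for p q
    using that assms(2)[of p q] assms(2)[of q p] by (auto simp: ip_commute)
  have "b' = b" if "k \<in> A \<longleftrightarrow> l \<notin> A"
    using s[of l k] that by (auto simp: b' refl_def)
  moreover have "ip (b' i) (b' j) = 0" if "k \<in> A \<longleftrightarrow> l \<in> A"
  proof -
    have "ip (b i) (b j) = 0" "l = i \<Longrightarrow> ip (b k) (b j) = 0" "l = j \<Longrightarrow> ip (b i) (b k) = 0"
      using assms(3,4) that by (auto intro!: s)
    then show ?thesis using assms(3,4) by (auto simp: b' refl_def ip_simps)
  qed
  ultimately show ?thesis using assms(2-4) by blast
qed

lemma split_steps:
  assumes "steps b b'" "\<And>i j. i \<in> A \<Longrightarrow> j \<notin> A \<Longrightarrow> ip (b i) (b j) = 0" "i \<in> A" "j \<notin> A"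
  shows "ip (b' i) (b' j) = 0"
  using assms
proof (induction arbitrary: i j rule: rtranclp_induct)
  case (step b' b'')
  show ?case by (rule split_step[OF step.hyps(2) step.IH]) (use step.prems in auto)
qed auto

end

section \<open>Chevalley generators and weights\<close>

text \<open>Coefficient vectors are realised twice: as functionals on the torus by
  \<open>rt\<close>, and as torus elements by \<open>tv\<close>, through the form. The last two
  assumptions, that the prime roots span the torus and separate its points, reflect corank
  0.\<close>

locale realization = torus: vector_space tscale + integral_form g
  for tscale :: "complex \<Rightarrow> 'h \<Rightarrow> 'h::ab_group_add" and g :: "'n::finite \<Rightarrow> 'n \<Rightarrow> real" +
  fixes rt :: "real^'n \<Rightarrow> 'h \<Rightarrow> complex" and tv :: "real^'n \<Rightarrow> 'h"
  assumes rt_add: "rt (u + v) t = rt u t + rt v t"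
    and rt_scale: "rt (r *\<^sub>R v) t = of_real r * rt v t"
    and rt_plus: "rt v (s + t) = rt v s + rt v t"
    and rt_tscale: "rt v (tscale c t) = c * rt v t"
    and rt_inj: "rt u = rt v \<Longrightarrow> u = v"
    and tv_add: "tv (u + v) = tv u + tv v"
    and tv_scale: "tv (r *\<^sub>R v) = tscale (of_real r) (tv v)"
    and rt_tv: "rt u (tv v) = of_real (ip u v)"
    and tv_span: "torus.span (range (\<lambda>i. tv (axis i 1))) = UNIV"
    and rt_faithful: "(\<And>i. rt (axis i 1) t = 0) \<Longrightarrow> t = 0"
begin

lemma rt_minus: "rt (- v) t = - rt v t"
  using rt_scale[of "-1" v t] by simp

lemma rt_diff: "rt (u - v) t = rt u t - rt v t"
  using rt_add[of u "- v" t] by (simp add: rt_minus)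

lemma rt_zero [simp]: "rt 0 t = 0"
  using rt_scale[of 0 0 t] by simp

lemma rt_uminus: "rt v (- t) = - rt v t"
  using rt_tscale[of v "-1" t] by simp

lemma rt_minus_right: "rt v (s - t) = rt v s - rt v t"
  using rt_plus[of v s "- t"] by (simp add: rt_uminus)

lemma rt_sum: "rt (sum f A) t = (\<Sum>i\<in>A. rt (f i) t)"
  by (induction A rule: infinite_finite_induct) (auto simp: rt_add)

lemma tv_zero [simp]: "tv 0 = 0"
  using tv_scale[of 0 0] by simp

lemma tv_minus: "tv (- v) = - tv v"
  using tv_scale[of "-1" v] by simp

lemma tv_diff: "tv (u - v) = tv u - tv v"
  using tv_add[of u "- v"] by (simp add: tv_minus)

lemma tv_sum: "tv (sum f A) = (\<Sum>i\<in>A. tv (f i))"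
  by (induction A rule: infinite_finite_induct) (auto simp: tv_add)

definition co :: "real^'n \<Rightarrow> 'h" where
  "co v = tscale (of_real (2 / ip v v)) (tv v)"

lemma rt_co: "rt u (co v) = of_real (2 * ip u v / ip v v)"
  by (simp add: co_def rt_tscale rt_tv)

lemma rt_co_self: "v \<noteq> 0 \<Longrightarrow> rt v (co v) = 2"
  by (simp add: rt_co)

lemma co_minus: "co (- v) = - co v"
  by (simp add: co_def tv_minus)

lemma co_refl: "a \<noteq> 0 \<Longrightarrow> co (refl a v) = co v - tscale (rt a (co v)) (co a)"
  unfolding rt_co
  by (simp add: co_def ip_refl)
    (simp add: refl_def tv_diff tv_scale torus.scale_right_diff_distrib ip_commute[of v a])

lemma rt_refl: "rt (refl a v) t = rt v t - rt a t * rt v (co a)"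
  by (simp add: refl_def rt_diff rt_scale rt_co)

lemma tv_mem:
  assumes "good b" "torus.subspace S" "\<And>i. tv (b i) \<in> S"
  shows "t \<in> S"
proof -
  have "tv (axis i 1) \<in> S" for i
  proof -
    obtain c where "axis i 1 = comb b c"
      using assms(1) axis_root[of i] unfolding good_def by blast
    then show ?thesis
      using assms(2,3) by (simp add: comb_def tv_sum tv_scale torus.subspace_sum torus.subspace_scale)
  qed
  then have "torus.span (range (\<lambda>i. tv (axis i 1))) \<subseteq> S"
    by (intro torus.span_minimal assms(2)) auto
  then show ?thesis unfolding tv_span by auto
qed

lemma rt_faithful_base:
  assumes "good b" "\<And>i. rt (b i) t = 0"
  shows "t = 0"
proof (rule rt_faithful)
  fix i
  obtain c where "axis i 1 = comb b c"
    using assms(1) axis_root[of i] unfolding good_def by blast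
  then show "rt (axis i 1) t = 0" by (simp add: comb_def rt_sum rt_scale assms(2))
qed

end

locale root_lie = lie_torus scale br tscale T + realization tscale g rt tv
  for scale :: "complex \<Rightarrow> 'a \<Rightarrow> 'a::ab_group_add" and br
    and tscale :: "complex \<Rightarrow> 'h \<Rightarrow> 'h::ab_group_add" and T
    and g :: "'n::finite \<Rightarrow> 'n \<Rightarrow> real" and rt tv +
  fixes G :: "'a set"
  assumes G: "subalg G" "range T \<subseteq> G"
begin

text \<open>Brackets of \<open>e i\<close> and \<open>f j\<close> with different indices are left
  free: the notion has to survive every braid move, and for a base with positive inner products
  these brackets need not vanish.\<close>

definition chevalley :: "('n \<Rightarrow> real^'n) \<Rightarrow> ('n \<Rightarrow> 'a) \<Rightarrow> ('n \<Rightarrow> 'a) \<Rightarrow> bool" where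
  "chevalley b e f \<longleftrightarrow> good b \<and> (\<forall>i. e i \<in> G \<and> f i \<in> G \<and> wt (rt (b i)) (e i) \<and> wt (rt (- b i)) (f i) \<and>
     br (e i) (f i) = T (co (b i)))"

definition generates :: "('n \<Rightarrow> 'a) \<Rightarrow> ('n \<Rightarrow> 'a) \<Rightarrow> bool" where
  "generates e f \<longleftrightarrow> (\<forall>S. subalg S \<longrightarrow> range T \<subseteq> S \<longrightarrow> range e \<subseteq> S \<longrightarrow> range f \<subseteq> S \<longrightarrow> G \<subseteq> S)"

lemma generatesD: "generates e f \<Longrightarrow> subalg S \<Longrightarrow> range T \<subseteq> S \<Longrightarrow> range e \<subseteq> S \<Longrightarrow> range f \<subseteq> S \<Longrightarrow> G \<subseteq> S"
  by (simp add: generates_def)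

lemma zero_in_range_T [simp]: "0 \<in> range T"
  by (metis T_zero rangeI)

lemma nonzero_span: "x \<in> span A \<Longrightarrow> x \<noteq> 0 \<Longrightarrow> \<exists>y. y \<in> A"
  by (cases "A = {}") auto

lemma lie_sl2I:
  assumes "chevalley b e f" "\<And>x. x \<in> G \<Longrightarrow> nilp (e i) x" "\<And>x. x \<in> G \<Longrightarrow> nilp (f i) x"
  shows "lie_sl2 scale br tscale T G (rt (b i)) (co (b i)) (e i) (f i)"
proof
  show "subalg G" "range T \<subseteq> G" by (rule G)+
  show "sl2 (rt (b i)) (co (b i)) (e i) (f i)"
    using assms(1) root_nonzero[OF good_root[of b i]]
    by (auto simp: chevalley_def sl2_def rt_co_self wt_def rt_minus)
qed (use assms in \<open>auto simp: chevalley_def rt_minus_right rt_tscale\<close>)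

lemma theta_wt_refl:
  assumes "lie_sl2 scale br tscale T G (rt a) (co a) e f" "x \<in> G" "wt (rt v) x"
  shows "wt (rt (refl a v)) (theta e f x)"
proof -
  interpret lie_sl2 scale br tscale T G "rt a" "co a" e f by (rule assms(1))
  have "wt (\<lambda>t. rt v t - rt a t * rt v (co a)) (theta e f x)"
    by (rule theta_wt[OF assms(2,3)]) (simp_all add: rt_minus_right rt_tscale)
  then show ?thesis by (simp add: wt_def rt_refl)
qed

text \<open>A move with equal indices exchanges \<open>e j\<close> and \<open>f j\<close>; any other
  move applies the reflection automorphism of the triple at i to the pair at j. That triple itself
  stays, so the old generators can be recovered from the new ones.\<close>

lemma chevalley_step:
  assumes ch: "chevalley b e f" and nil: "\<And>i x. x \<in> G \<Longrightarrow> nilp (e i) x \<and> nilp (f i) x" and "step b b'"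
  shows "\<exists>e' f'. chevalley b' e' f' \<and> (generates e f \<longrightarrow> generates e' f')"
proof -
  obtain i j where b': "b' = b(j := refl (b i) (b j))" using assms(3) by (auto simp: step_def)
  have good: "good b'" using ch assms(3) good_step by (auto simp: chevalley_def)
  have nz: "b k \<noteq> 0" for k
    using ch root_nonzero[OF good_root[of b k]] by (auto simp: chevalley_def)
  have c: "e k \<in> G" "f k \<in> G" "wt (rt (b k)) (e k)" "wt (rt (- b k)) (f k)" "br (e k) (f k) = T (co (b k))" for k
    using ch by (auto simp: chevalley_def)
  show ?thesis
  proof (cases "i = j")
    case True
    have "br (f j) (e j) = T (co (- b j))"
      using br_swap[of "f j" "e j"] c(5)[of j] by (simp add: co_minus T_minus)
    then have "chevalley b' (e(j := f j)) (f(j := e j))"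
      using good c True by (auto simp: chevalley_def b' refl_self)
    moreover have "generates (e(j := f j)) (f(j := e j))" if "generates e f"
      unfolding generates_def
    proof (intro allI impI)
      fix S assume S: "subalg S" "range T \<subseteq> S" "range (e(j := f j)) \<subseteq> S" "range (f(j := e j)) \<subseteq> S"
      have "e k \<in> S \<and> f k \<in> S" for k
      proof (cases "k = j")
        case True
        have "(f(j := e j)) j \<in> S" "(e(j := f j)) j \<in> S" using S by blast+
        with True show ?thesis by simp
      next
        case False
        have "(f(j := e j)) k \<in> S" "(e(j := f j)) k \<in> S" using S by blast+
        with False show ?thesis by simp
      qed
      then have "range e \<subseteq> S" "range f \<subseteq> S" by auto
      with that S show "G \<subseteq> S" unfolding generates_def by blast
    qed
    ultimately show ?thesis by blast
  next
    case False
    have sl: "lie_sl2 scale br tscale T G (rt (b i)) (co (b i)) (e i) (f i)"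
      using ch nil by (intro lie_sl2I) auto
    interpret sl: lie_sl2 scale br tscale T G "rt (b i)" "co (b i)" "e i" "f i" by (rule sl)
    let ?th = "theta (e i) (f i)"
    let ?e = "e(j := ?th (e j))" and ?f = "f(j := ?th (f j))"
    have "br (?th (e j)) (?th (f j)) = ?th (T (co (b j)))"
      using c by (simp flip: sl.theta_br)
    also have "\<dots> = T (co (refl (b i) (b j)))"
      by (simp add: theta_T[OF sl.sl2] co_refl nz)
    finally have "chevalley b' ?e ?f"
      using good c sl.G_closed theta_wt_refl[OF sl c(1,3), of j] theta_wt_refl[OF sl c(2,4), of j]
      by (auto simp: chevalley_def b' refl_minus)
    moreover have "generates ?e ?f" if "generates e f"
      unfolding generates_def
    proof (intro allI impI)
      fix S assume S: "subalg S" "range T \<subseteq> S" "range ?e \<subseteq> S" "range ?f \<subseteq> S"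
      have mem: "?e k \<in> S" "?f k \<in> S" for k using S by blast+
      have "e i \<in> S" "f i \<in> S" using mem[of i] False by auto
      then have cl: "br (e i) x \<in> S" "br (f i) x \<in> S" if "x \<in> S" for x
        using that S(1) by (auto simp: subalg_def)
      have "e k \<in> S \<and> f k \<in> S" for k
      proof (cases "k = j")
        case True
        have "?th (e j) \<in> S" "?th (f j) \<in> S" using mem[of j] by auto
        then show ?thesis using True c cl sl.theta_reflects[OF subalg_subspace[OF S(1)]] by blast
      next
        case False
        then show ?thesis using mem[of k] by simp
      qed
      then have "range e \<subseteq> S" "range f \<subseteq> S" by auto
      with that S show "G \<subseteq> S" unfolding generates_def by blast
    qed
    ultimately show ?thesis by blast
  qed
qed

text \<open>The elements of \<open>U\<close> whose adjoint action preserves \<open>U\<close> form a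
  subalgebra that contains the generators. So stability under the generators suffices although
  \<open>U\<close> is only a subspace.\<close>

lemma generated_subset:
  assumes "generates e f" "subspace U" "range T \<subseteq> U" "range e \<subseteq> U" "range f \<subseteq> U"
    and "\<And>t x. x \<in> U \<Longrightarrow> br (T t) x \<in> U" "\<And>i x. x \<in> U \<Longrightarrow> br (e i) x \<in> U" "\<And>i x. x \<in> U \<Longrightarrow> br (f i) x \<in> U"
  shows "G \<subseteq> U"
proof -
  let ?S = "{x \<in> U. \<forall>u\<in>U. br x u \<in> U}"
  have "br (br x y) u \<in> U" if "x \<in> ?S" "y \<in> ?S" "u \<in> U" for x y u
  proof -
    have "br (br x y) u = br x (br y u) - br y (br x u)" by (simp add: br_br[of x y u])
    also have "\<dots> \<in> U" using that by (intro subspace_diff assms(2)) auto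
    finally show ?thesis .
  qed
  moreover have "subspace ?S"
    using assms(2) by (auto simp: subspace_def br_add_left br_scale_left)
  ultimately have "subalg ?S" by (auto simp: subalg_def)
  moreover have "range T \<subseteq> ?S" "range e \<subseteq> ?S" "range f \<subseteq> ?S" using assms by auto
  ultimately have "G \<subseteq> ?S" by (rule generatesD[OF assms(1)])
  then show ?thesis by blast
qed

fun word :: "('n \<Rightarrow> 'a) \<Rightarrow> 'n list \<Rightarrow> 'a" where
  "word e [] = 0"
| "word e (i # w) = (if w = [] then e i else br (e i) (word e w))"

lemma word_wt:
  assumes "\<And>i. wt (rt (b i)) (e i)"
  shows "wt (rt (\<Sum>i\<leftarrow>w. b i)) (word e w)"
proof (induction w)
  case (Cons i w)
  then show ?case
    using assms[of i] wt_br[OF assms[of i] Cons] by (auto simp: wt_def rt_add)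
qed simp

lemma br_word_span:
  assumes "\<And>i. wt (\<phi> i) (f i)" "x \<in> span (range T \<union> range (word f))"
  shows "br (f j) x \<in> span (range T \<union> range (word f))"
  using assms(2)
proof (induction rule: span_induct_alt)
  case (step c x y)
  from step(1) have "br (f j) x \<in> span (range T \<union> range (word f))"
  proof
    assume "x \<in> range T"
    then obtain t where "x = T t" by auto
    then have "br (f j) x = scale (- \<phi> j t) (word f [j])"
      using br_T_right[OF assms(1)[of j]] by simp
    then show ?thesis by (simp add: span_scale span_base span_neg del: word.simps)
  next
    assume "x \<in> range (word f)"
    then obtain w where x: "x = word f w" by auto
    show ?thesis
    proof (cases "w = []")
      case False
      then have "br (f j) x = word f (j # w)" using x by simp
      then show ?thesis by (simp add: span_base del: word.simps)
    qed (simp add: x span_zero)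
  qed
  then show ?case
    using step by (simp add: br_add_right br_scale_right span_add span_scale)
qed (simp add: span_zero)

text \<open>Moving \<open>e\<close> past a letter of the word leaves a torus element, which acts on
  the remaining word by a scalar.\<close>

lemma br_opposite_word:
  assumes "\<And>i. wt (\<phi> i) (f i)" "\<And>j. br e (f j) \<in> range T"
  shows "br e (word f w) \<in> span (range T \<union> range (word f))"
proof (induction w)
  case (Cons j w)
  show ?case
  proof (cases "w = []")
    case True
    then show ?thesis using assms(2)[of j] by (simp add: span_base)
  next
    case False
    obtain t where t: "br e (f j) = T t" using assms(2)[of j] by auto
    have "\<exists>\<psi>. wt \<psi> (word f w)"
    proof (induction w)
      case (Cons i w)
      then obtain \<psi> where "wt \<psi> (word f w)" ..
      with wt_br[OF assms(1)[of i] this] assms(1)[of i] show ?case by (cases "w = []") auto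
    qed (auto intro: wt_zero)
    then obtain \<psi> where "wt \<psi> (word f w)" ..
    then have "br (T t) (word f w) = scale (\<psi> t) (word f w)" by (simp add: wt_def)
    then have "br (T t) (word f w) \<in> span (range T \<union> range (word f))"
      by (simp add: span_scale span_base)
    moreover have "br (f j) (br e (word f w)) \<in> span (range T \<union> range (word f))"
      by (rule br_word_span[OF assms(1) Cons])
    ultimately show ?thesis
      using False by (simp add: br_br[of e "f j"] t span_add)
  qed
qed (simp add: span_zero)

lemma sum_list_comb: "(\<Sum>i\<leftarrow>w. b i) = comb b (\<lambda>i. real (count_list w i))"
proof (induction w)
  case (Cons j w)
  have "(\<lambda>i. real (count_list (j # w) i)) = (\<lambda>i. real (count_list w i))(j := real (count_list w j) + 1)"
    by auto
  then show ?case using Cons comb_inject_upd[of b "\<lambda>i. real (count_list w i)" j 1] by simp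
qed (simp add: comb_zero)

end

section \<open>Weights and ideals over a base of Cartan type\<close>

locale cartan_lie = root_lie scale br tscale T g rt tv G
  for scale :: "complex \<Rightarrow> 'a \<Rightarrow> 'a::ab_group_add" and br
    and tscale :: "complex \<Rightarrow> 'h \<Rightarrow> 'h::ab_group_add" and T
    and g :: "'n::finite \<Rightarrow> 'n \<Rightarrow> real" and rt tv G +
  fixes b :: "'n \<Rightarrow> real^'n" and e f :: "'n \<Rightarrow> 'a"
  assumes ch: "chevalley b e f" and gen: "generates e f"
    and nil: "x \<in> G \<Longrightarrow> nilp (e i) x" "x \<in> G \<Longrightarrow> nilp (f i) x"
    and commute: "i \<noteq> j \<Longrightarrow> br (e i) (f j) = 0"
begin

lemma good: "good b" and eG: "e i \<in> G" and fG: "f i \<in> G"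
  and e_wt: "wt (rt (b i)) (e i)" and f_wt: "wt (rt (- b i)) (f i)"
  and ef: "br (e i) (f i) = T (co (b i))"
  using ch by (auto simp: chevalley_def)

lemma b_nonzero: "b i \<noteq> 0"
  by (rule root_nonzero[OF good_root[OF good]])

lemma sl2_i: "lie_sl2 scale br tscale T G (rt (b i)) (co (b i)) (e i) (f i)"
  by (rule lie_sl2I[OF ch nil])

lemma T_in_G: "T t \<in> G"
  using G(2) by auto

definition spanning :: "'a set" where
  "spanning = range T \<union> range (word e) \<union> range (word f)"

text \<open>A relation and not a function, since a spanning element may arise in several ways; the
  zero vector does.\<close>

definition shape :: "real^'n \<Rightarrow> 'a \<Rightarrow> bool" where
  "shape v y \<longleftrightarrow> v = 0 \<and> y \<in> range T \<or> (\<exists>w. w \<noteq> [] \<and> v = (\<Sum>i\<leftarrow>w. b i) \<and> y = word e w) \<or>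
     (\<exists>w. w \<noteq> [] \<and> v = - (\<Sum>i\<leftarrow>w. b i) \<and> y = word f w)"

lemma spanning_shape: "y \<in> spanning \<Longrightarrow> \<exists>v. shape v y"
proof -
  assume "y \<in> spanning"
  then consider "y \<in> range T" | w where "y = word e w" | w where "y = word f w"
    by (auto simp: spanning_def)
  then show ?thesis
  proof cases
    case (2 w)
    then show ?thesis by (cases "w = []") (auto simp: shape_def)
  next
    case (3 w)
    then show ?thesis by (cases "w = []") (auto simp: shape_def)
  qed (auto simp: shape_def)
qed

lemma shape_wt: "shape v y \<Longrightarrow> wt (rt v) y"
proof -
  have "wt (rt (\<Sum>i\<leftarrow>w. - b i)) (word f w)" for w by (rule word_wt) (rule f_wt)
  moreover have "(\<Sum>i\<leftarrow>w. - b i) = - (\<Sum>i\<leftarrow>w. b i)" for w by (induction w) auto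
  moreover have "wt (rt (\<Sum>i\<leftarrow>w. b i)) (word e w)" for w by (rule word_wt) (rule e_wt)
  moreover have "wt (rt 0) (T t)" for t by (simp add: wt_def T_comm)
  ultimately show "shape v y \<Longrightarrow> wt (rt v) y" unfolding shape_def by auto
qed

lemma word_G: "(\<And>i. x i \<in> G) \<Longrightarrow> word x w \<in> G"
  using G(1) by (induction w) (auto simp: subalg_def subspace_0)

lemma spanning_G: "spanning \<subseteq> G"
  using word_G[of e] word_G[of f] eG fG T_in_G by (auto simp: spanning_def)

text \<open>This is the triangular decomposition. Cartan type enters through \<open>commute\<close>:
  bracketing a generator with a letter of the opposite kind gives a torus element or 0.\<close>

lemma G_subset: "G \<subseteq> span spanning"
proof (rule generated_subset[OF gen])
  have mono: "span (range T \<union> range (word x)) \<subseteq> span spanning" if "x = e \<or> x = f" for x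
    using that by (intro span_mono) (auto simp: spanning_def)
  have word1: "x i = word x [i]" for x i by simp
  have e': "br (e i) y \<in> span spanning" if "y \<in> spanning" for i y
  proof -
    have "br (e i) (f j) \<in> range T" for j
      using ef commute[of i j] by (cases "i = j") auto
    then have "br (e i) (word f w) \<in> span spanning" for w
      using br_opposite_word[of "\<lambda>i. rt (- b i)" f "e i" w] f_wt mono by blast
    moreover have "br (e i) y \<in> span spanning" if "y \<in> range T \<union> range (word e)"
      using br_word_span[of "\<lambda>i. rt (b i)" e y i] that e_wt mono by (blast intro: span_base)
    ultimately show ?thesis using that by (auto simp: spanning_def)
  qed
  have f': "br (f i) y \<in> span spanning" if "y \<in> spanning" for i y
  proof -
    have "br (f i) (e j) \<in> range T" for j
    proof (cases "i = j")
      case True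
      then have "br (f i) (e j) = T (- co (b j))" using ef[of j] br_swap[of "f i" "e j"] by (simp add: T_minus)
      then show ?thesis by simp
    next
      case False
      then have "br (f i) (e j) = 0" using commute[of j i] br_swap[of "f i" "e j"] by simp
      then show ?thesis by simp
    qed
    then have "br (f i) (word e w) \<in> span spanning" for w
      using br_opposite_word[of "\<lambda>i. rt (b i)" e "f i" w] e_wt mono by blast
    moreover have "br (f i) y \<in> span spanning" if "y \<in> range T \<union> range (word f)"
      using br_word_span[of "\<lambda>i. rt (- b i)" f y i] that f_wt mono by (blast intro: span_base)
    ultimately show ?thesis using that by (auto simp: spanning_def)
  qed
  have T': "br (T t) y \<in> span spanning" if y: "y \<in> spanning" for t y
  proof -
    obtain v where "shape v y" using spanning_shape[OF y] ..
    then have "br (T t) y = scale (rt v t) y" using shape_wt by (simp add: wt_def)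
    then show ?thesis using y by (simp add: span_scale span_base)
  qed
  have ext: "br z x \<in> span spanning" if "\<And>y. y \<in> spanning \<Longrightarrow> br z y \<in> span spanning" "x \<in> span spanning" for z x
    using that(2)
  proof (induction rule: span_induct_alt)
    case (step c x y)
    then show ?case using that(1) by (simp add: br_add_right br_scale_right span_add span_scale)
  qed (simp add: span_zero)
  show "x \<in> span spanning \<Longrightarrow> br (T t) x \<in> span spanning"
    "x \<in> span spanning \<Longrightarrow> br (e i) x \<in> span spanning"
    "x \<in> span spanning \<Longrightarrow> br (f i) x \<in> span spanning" for x t i
    using ext T' e' f' by blast+
  show "range T \<subseteq> span spanning" by (auto simp: spanning_def intro: span_base)
  have "e i \<in> spanning" "f i \<in> spanning" for i
    unfolding spanning_def by (metis UnI1 UnI2 rangeI word1)+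
  then show "range e \<subseteq> span spanning" "range f \<subseteq> span spanning" by (auto intro: span_base)
qed simp

definition shape_wt_of :: "'a \<Rightarrow> real^'n" where
  "shape_wt_of y = (SOME v. shape v y)"

lemma shape_wt_of: "y \<in> spanning \<Longrightarrow> shape (shape_wt_of y) y"
  unfolding shape_wt_of_def using spanning_shape by (rule someI_ex)

lemma spanning_wt: "y \<in> spanning \<Longrightarrow> wt (rt (shape_wt_of y)) y"
  by (rule shape_wt[OF shape_wt_of])

lemma weight_space_span:
  assumes "x \<in> G" "wt (rt v) x"
  shows "x \<in> span {y. shape v y}"
proof -
  have "x \<in> span {y \<in> spanning. rt (shape_wt_of y) = rt v}"
    using assms G_subset by (intro wt_span_eq[where w = "\<lambda>y. rt (shape_wt_of y)"] spanning_wt) auto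
  also have "\<dots> \<subseteq> span {y. shape v y}"
    using rt_inj shape_wt_of by (intro span_mono) blast
  finally show ?thesis .
qed

lemma sum_list_b_eq:
  assumes "(\<Sum>i\<leftarrow>w. b i) = r *\<^sub>R b i"
  shows "set w \<subseteq> {i}" "r = length w"
proof -
  have "comb b (\<lambda>i. real (count_list w i)) = comb b ((\<lambda>k. 0)(i := r))"
    using assms by (simp only: sum_list_comb comb_single)
  then have "(\<lambda>i. real (count_list w i)) = ((\<lambda>k. 0)(i := r))" by (rule good_inj[OF good])
  then have *: "real (count_list w k) = ((\<lambda>k. 0)(i := r)) k" for k by metis
  have "count_list w k = 0" if "k \<noteq> i" for k using *[of k] that by simp
  then show sub: "set w \<subseteq> {i}" using count_list_0_iff by (metis insertI1 subsetI singletonD)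
  have "count_list w i = length w" using sub by (induction w) auto
  then show "r = length w" using *[of i] by simp
qed

lemma sum_list_b_nonzero: "w \<noteq> [] \<Longrightarrow> (\<Sum>i\<leftarrow>w. b i) \<noteq> 0"
  using sum_list_b_eq(2)[of w 0] by auto

lemma zero_weight: "x \<in> G \<Longrightarrow> wt (rt 0) x \<Longrightarrow> x \<in> range T"
proof -
  assume "x \<in> G" "wt (rt 0) x"
  then have "x \<in> span {y. shape 0 y}" by (rule weight_space_span)
  moreover have "{y. shape 0 y} \<subseteq> range T"
    using sum_list_b_nonzero by (auto simp: shape_def)
  ultimately show "x \<in> range T" using span_minimal[OF _ subspace_range_T] by blast
qed

text \<open>The bracket of a generator with itself vanishes, so a nonzero word in one letter has
  length one. It follows that the only nonzero multiples of \<open>b i\<close> that can be weights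
  are \<open>b i\<close> and \<open>- b i\<close>.\<close>

lemma word_constant:
  assumes "set w \<subseteq> {i}" "word x w \<noteq> 0"
  shows "w = [i]"
proof -
  have "length w \<ge> 2 \<Longrightarrow> set w \<subseteq> {i} \<Longrightarrow> word x w = 0"
  proof (induction w)
    case (Cons j w)
    then have "j = i" "w \<noteq> []" by auto
    show ?case
    proof (cases "length w \<ge> 2")
      case True
      then show ?thesis using Cons by auto
    next
      case False
      moreover have "length w \<noteq> 0" using \<open>w \<noteq> []\<close> by simp
      ultimately have "length w = 1" by linarith
      then have "w = [i]" using Cons.prems by (auto simp: length_Suc_conv)
      then show ?thesis using \<open>j = i\<close> by (simp add: br_self)
    qed
  qed simp
  then have "length w < 2" using assms by (meson not_le)
  then have "length w = 0 \<or> length w = 1" by linarith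
  then have "w = [] \<or> (\<exists>x. w = [x])" by (auto simp: length_Suc_conv)
  then show ?thesis using assms by auto
qed

lemma shape_multiple:
  assumes "shape (r *\<^sub>R b i) y" "y \<noteq> 0" "r \<noteq> 0"
  shows "r = 1 \<and> y = e i \<or> r = - 1 \<and> y = f i"
proof -
  have "r *\<^sub>R b i \<noteq> 0" using assms(3) b_nonzero by simp
  with assms(1) consider w where "r *\<^sub>R b i = (\<Sum>i\<leftarrow>w. b i)" "y = word e w"
    | w where "- (r *\<^sub>R b i) = (\<Sum>i\<leftarrow>w. b i)" "y = word f w"
    unfolding shape_def by (metis minus_minus)
  then show ?thesis
  proof cases
    case (1 w)
    from sum_list_b_eq[OF 1(1)[symmetric]] have "w = [i]" "r = length w"
      using word_constant assms(2) 1(2) by auto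
    then show ?thesis using 1 by simp
  next
    case (2 w)
    then have "(\<Sum>i\<leftarrow>w. b i) = (- r) *\<^sub>R b i" by simp
    from sum_list_b_eq[OF this] have "w = [i]" "- r = length w"
      using word_constant assms(2) 2(2) by auto
    then show ?thesis using 2 by simp
  qed
qed

lemma multiple_weight:
  assumes "x \<in> G" "wt (rt (r *\<^sub>R b i)) x" "x \<noteq> 0" "r \<noteq> 0"
  shows "r = 1 \<and> (\<exists>c. x = scale c (e i)) \<or> r = - 1 \<and> (\<exists>c. x = scale c (f i))"
proof -
  have "x \<in> span {y. shape (r *\<^sub>R b i) y}" by (rule weight_space_span) (use assms in auto)
  moreover have "{y. shape (r *\<^sub>R b i) y} \<subseteq> insert 0 (if r = 1 then {e i} else if r = - 1 then {f i} else {})"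
  proof
    fix y assume "y \<in> {y. shape (r *\<^sub>R b i) y}"
    then show "y \<in> insert 0 (if r = 1 then {e i} else if r = - 1 then {f i} else {})"
      using shape_multiple[of r i y] assms(4) by (cases "y = 0") auto
  qed
  ultimately have "x \<in> span (if r = 1 then {e i} else if r = - 1 then {f i} else {})"
    using span_mono span_insert_0 by blast
  then show ?thesis using assms(3) by (auto simp: span_singleton split: if_splits)
qed

section \<open>The nonzero weights are roots of multiplicity one\<close>

definition weights :: "(real^'n) set" where
  "weights = {v. v \<noteq> 0 \<and> (\<exists>x\<in>G. x \<noteq> 0 \<and> wt (rt v) x)}"

lemma weights_signed:
  assumes "v \<in> weights"
  shows "v \<noteq> 0 \<and> (\<exists>c :: 'n \<Rightarrow> nat. v = comb b (\<lambda>i. c i) \<or> v = - comb b (\<lambda>i. c i))"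
proof -
  obtain x where x: "v \<noteq> 0" "x \<in> G" "x \<noteq> 0" "wt (rt v) x" using assms by (auto simp: weights_def)
  then have "x \<in> span {y. shape v y}" by (intro weight_space_span)
  from nonzero_span[OF this x(3)] obtain y where "shape v y" by auto
  with x(1) show ?thesis unfolding shape_def sum_list_comb by metis
qed

lemma weights_refl:
  assumes "v \<in> weights"
  shows "refl (b i) v \<in> weights"
proof -
  interpret sl: lie_sl2 scale br tscale T G "rt (b i)" "co (b i)" "e i" "f i" by (rule sl2_i)
  obtain x where x: "v \<noteq> 0" "x \<in> G" "x \<noteq> 0" "wt (rt v) x" using assms by (auto simp: weights_def)
  have "refl (b i) v \<noteq> 0" using x(1) refl_refl[of "b i" v] by (auto simp: refl_def)
  moreover have "theta (e i) (f i) x \<in> G" "theta (e i) (f i) x \<noteq> 0" "wt (rt (refl (b i) v)) (theta (e i) (f i) x)"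
    using x sl.G_closed(3) sl.theta_eq_0 theta_wt_refl[OF sl2_i] by auto
  ultimately show ?thesis unfolding weights_def by blast
qed

definition root_line :: "real^'n \<Rightarrow> bool" where
  "root_line v \<longleftrightarrow> v \<in> roots \<and>
     (\<forall>x\<in>G. \<forall>y\<in>G. wt (rt v) x \<longrightarrow> wt (rt v) y \<longrightarrow> x \<noteq> 0 \<longrightarrow> (\<exists>c. y = scale c x))"

text \<open>Every weight is reflected to a multiple of some \<open>b i\<close>, where the weight
  space is known, and the automorphisms carry the conclusion back. Weights are thereby confined to
  the finite set \<open>roots\<close>, which is the source of finite dimension.\<close>

lemma root_space:
  assumes "v \<in> weights"
  shows "root_line v"
proof (rule one_signed_induct[OF good weights_signed weights_refl _ _ assms])
  fix r i assume "r *\<^sub>R b i \<in> weights"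
  then obtain x where x: "r *\<^sub>R b i \<noteq> 0" "x \<in> G" "x \<noteq> 0" "wt (rt (r *\<^sub>R b i)) x" by (auto simp: weights_def)
  then have r: "r \<noteq> 0" by auto
  have root: "r *\<^sub>R b i \<in> roots"
    using multiple_weight[OF x(2,4,3) r] good_root[OF good, of i] minus_root by auto
  have "\<exists>c. z = scale c y" if yz: "y \<in> G" "z \<in> G" "wt (rt (r *\<^sub>R b i)) y" "wt (rt (r *\<^sub>R b i)) z" "y \<noteq> 0" for y z
  proof (cases "z = 0")
    case True
    then have "z = scale 0 y" by simp
    then show ?thesis ..
  next
    case False
    obtain u c d where "y = scale c u" "z = scale d u"
      using multiple_weight[OF yz(1,3,5) r] multiple_weight[OF yz(2,4) False r] by force
    then have "z = scale (d / c) y" using yz(5) by auto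
    then show ?thesis ..
  qed
  with root show "root_line (r *\<^sub>R b i)" unfolding root_line_def by blast
next
  fix v i
  assume "root_line (refl (b i) v)"
  note D = this[unfolded root_line_def]
  interpret sl: lie_sl2 scale br tscale T G "rt (b i)" "co (b i)" "e i" "f i" by (rule sl2_i)
  let ?th = "theta (e i) (f i)"
  have "v \<in> roots" using refl_root[OF good_root[OF good, of i], of "refl (b i) v"] D by simp
  moreover have "\<exists>c. y = scale c x" if xy: "x \<in> G" "y \<in> G" "wt (rt v) x" "wt (rt v) y" "x \<noteq> 0" for x y
  proof -
    have "?th x \<noteq> 0" using sl.theta_eq_0 xy by auto
    then obtain c where c: "?th y = scale c (?th x)"
      using D xy sl.G_closed(3) theta_wt_refl[OF sl2_i] by meson
    have mem: "scale (- c) x \<in> G"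
      using xy by (intro subspace_scale subalg_subspace G(1))
    have "?th (y + scale (- c) x) = 0"
      by (subst sl.theta_add) (use c xy mem in \<open>simp_all add: sl.theta_scale del: scale_minus_left\<close>, simp)
    moreover have "y + scale (- c) x \<in> G" using mem xy by (intro subspace_add subalg_subspace G(1))
    ultimately have "y + scale (- c) x = 0" by (rule sl.theta_eq_0[rotated])
    then show ?thesis by (auto simp: algebra_simps)
  qed
  ultimately show "root_line v" unfolding root_line_def by blast
qed

lemma weight_is_root:
  assumes "x \<in> G" "x \<noteq> 0" "wt \<phi> x"
  shows "\<exists>v\<in>insert 0 roots. \<phi> = rt v"
proof -
  have "x \<in> span {y \<in> spanning. rt (shape_wt_of y) = \<phi>}"
    using assms G_subset by (intro wt_span_eq[where w = "\<lambda>y. rt (shape_wt_of y)"] spanning_wt) auto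
  from nonzero_span[OF this assms(2)] obtain v where v: "\<phi> = rt v" by auto
  then have "v \<noteq> 0 \<Longrightarrow> v \<in> weights" using assms by (auto simp: weights_def)
  then show ?thesis using root_space v by (auto simp: root_line_def)
qed

lemma root_decomposition:
  assumes "x \<in> G"
  shows "\<exists>c. x = (\<Sum>v\<in>insert 0 roots. c v) \<and> (\<forall>v. c v \<in> G \<and> wt (rt v) (c v))"
proof -
  have "x \<in> span spanning" using assms G_subset by auto
  from span_weight_decomposition[OF this, of "\<lambda>y. rt (shape_wt_of y)"] spanning_wt
  obtain c where c: "finite {\<psi>. c \<psi> \<noteq> 0}" "x = (\<Sum>\<psi>\<in>{\<psi>. c \<psi> \<noteq> 0}. c \<psi>)"
    "\<And>\<psi>. c \<psi> \<in> span {y \<in> spanning. rt (shape_wt_of y) = \<psi>}" "\<And>\<psi>. wt \<psi> (c \<psi>)" by blast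
  have cG: "c \<psi> \<in> G" for \<psi>
    using span_minimal[OF _ subalg_subspace[OF G(1)], of "{y \<in> spanning. rt (shape_wt_of y) = \<psi>}"]
      spanning_G c(3)[of \<psi>] by blast
  have "x = (\<Sum>\<psi>\<in>rt ` insert 0 roots. c \<psi>)"
    unfolding c(2)
  proof (rule sum.mono_neutral_left)
    show "finite (rt ` insert 0 roots)" using finite_roots by simp
    show "{\<psi>. c \<psi> \<noteq> 0} \<subseteq> rt ` insert 0 roots"
      using weight_is_root[OF cG _ c(4)] by blast
  qed simp
  also have "\<dots> = (\<Sum>v\<in>insert 0 roots. c (rt v))"
    by (subst sum.reindex) (auto intro: rt_inj injI inj_on_subset)
  finally show ?thesis using cG c(4) by blast
qed

lemma finitely_spanned: "\<exists>A. finite A \<and> A \<subseteq> G \<and> G \<subseteq> span A"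
proof -
  define r where "r v = (SOME x. x \<in> G \<and> x \<noteq> 0 \<and> wt (rt v) x)" for v
  let ?A = "range (\<lambda>i. T (tv (b i))) \<union> r ` weights"
  have r: "r v \<in> G \<and> r v \<noteq> 0 \<and> wt (rt v) (r v)" if "v \<in> weights" for v
  proof -
    have "\<exists>x. x \<in> G \<and> x \<noteq> 0 \<and> wt (rt v) x" using that unfolding weights_def by blast
    from someI_ex[OF this] show ?thesis unfolding r_def by blast
  qed
  have "T t \<in> span ?A" for t
  proof -
    have "torus.subspace {t. T t \<in> span ?A}"
      by (auto simp: torus.subspace_def T_add T_scale span_zero span_add span_scale)
    then have "t \<in> {t. T t \<in> span ?A}"
      by (rule tv_mem[OF good]) (auto intro: span_base)
    then show ?thesis by simp
  qed
  moreover have "x \<in> span ?A" if x: "v \<in> roots" "x \<in> G" "wt (rt v) x" for x v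
  proof (cases "x = 0")
    case False
    have v: "v \<in> weights" using x False root_nonzero[OF x(1)] unfolding weights_def by blast
    from root_space[OF v, unfolded root_line_def] obtain c where "x = scale c (r v)" using r[OF v] x by blast
    moreover have "r v \<in> span ?A" using v by (intro span_base) blast
    ultimately show ?thesis by (simp only: span_scale)
  qed (simp add: span_zero)
  ultimately have wt: "x \<in> span ?A" if "v \<in> insert 0 roots" "x \<in> G" "wt (rt v) x" for x v
    using that zero_weight[of x] by auto
  have "x \<in> span ?A" if x: "x \<in> G" for x
  proof -
    obtain c where c: "x = (\<Sum>v\<in>insert 0 roots. c v)" "\<And>v. c v \<in> G" "\<And>v. wt (rt v) (c v)"
      using root_decomposition[OF x] by blast
    show ?thesis unfolding c(1) by (rule span_sum) (use wt c in blast)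
  qed
  moreover have "finite ?A"
    using finite_subset[OF _ finite_roots, of weights] root_space by (auto simp: root_line_def)
  moreover have "?A \<subseteq> G" using r T_in_G by auto
  ultimately show ?thesis by (meson subsetI)
qed

lemma ideal_contains_generators:
  assumes J: "subspace J" "J \<subseteq> G" "\<And>x y. x \<in> G \<Longrightarrow> y \<in> J \<Longrightarrow> br x y \<in> J" "J \<noteq> {0}"
    and connected: "\<And>A. A \<noteq> {} \<Longrightarrow> A \<noteq> UNIV \<Longrightarrow> \<exists>i\<in>A. \<exists>j\<in>-A. ip (b i) (b j) \<noteq> 0"
  shows "J = G"
proof -
  have J': "br y x \<in> J" if "x \<in> G" "y \<in> J" for x y
    using J(3)[OF that] br_swap[of y x] subspace_neg[OF J(1)] by simp
  have cancel: "x \<in> J" if "scale c x \<in> J" "c \<noteq> 0" for c x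
    using subspace_scale[OF J(1) that(1), of "1 / c"] that(2) by simp
  have e_T: "T (co (b i)) \<in> J" if "e i \<in> J \<or> f i \<in> J" for i
    using that J' J(3) eG fG ef by metis
  have T_e: "e j \<in> J" if "T t \<in> J" "rt (b j) t \<noteq> 0" for j t
    using J'[OF eG that(1), of j] e_wt[of j] cancel that(2) by (auto simp: wt_def)
  have T_f: "f j \<in> J" if "T t \<in> J" "rt (b j) t \<noteq> 0" for j t
    using J'[OF fG that(1), of j] f_wt[of j] cancel[of "rt (- b j) t" "f j"] that(2) by (auto simp: wt_def rt_minus)
  have start: "\<exists>i. e i \<in> J \<or> f i \<in> J" if v: "v \<in> weights" and x: "x \<in> J" "x \<noteq> 0" "wt (rt v) x" for v x
  proof -
    have "\<forall>x. x \<in> J \<longrightarrow> x \<noteq> 0 \<longrightarrow> wt (rt v) x \<longrightarrow> (\<exists>i. e i \<in> J \<or> f i \<in> J)"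
    proof (rule one_signed_induct[OF good weights_signed weights_refl _ _ v])
      fix r i assume "r *\<^sub>R b i \<in> weights"
      then have r: "r \<noteq> 0" by (auto simp: weights_def)
      show "\<forall>x. x \<in> J \<longrightarrow> x \<noteq> 0 \<longrightarrow> wt (rt (r *\<^sub>R b i)) x \<longrightarrow> (\<exists>i. e i \<in> J \<or> f i \<in> J)"
      proof (intro allI impI)
        fix x assume "x \<in> J" "x \<noteq> 0" "wt (rt (r *\<^sub>R b i)) x"
        then show "\<exists>i. e i \<in> J \<or> f i \<in> J"
          using multiple_weight[of x r i] r J(2) cancel by (metis scale_zero_left subsetD)
      qed
    next
      fix v i
      assume D: "\<forall>x. x \<in> J \<longrightarrow> x \<noteq> 0 \<longrightarrow> wt (rt (refl (b i) v)) x \<longrightarrow> (\<exists>i. e i \<in> J \<or> f i \<in> J)"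
      interpret sl: lie_sl2 scale br tscale T G "rt (b i)" "co (b i)" "e i" "f i" by (rule sl2_i)
      show "\<forall>x. x \<in> J \<longrightarrow> x \<noteq> 0 \<longrightarrow> wt (rt v) x \<longrightarrow> (\<exists>i. e i \<in> J \<or> f i \<in> J)"
      proof (intro allI impI)
        fix x assume x: "x \<in> J" "x \<noteq> 0" "wt (rt v) x"
        then have xG: "x \<in> G" using J(2) by auto
        have "theta (e i) (f i) x \<in> J"
          using J(3) eG fG x(1) by (intro sl.theta_closed J(1)) auto
        moreover have "theta (e i) (f i) x \<noteq> 0" using sl.theta_eq_0[OF xG] x(2) by auto
        ultimately show "\<exists>i. e i \<in> J \<or> f i \<in> J"
          using D theta_wt_refl[OF sl2_i xG x(3)] by blast
      qed
    qed
    with x show ?thesis by blast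
  qed
  obtain x where x: "x \<in> J" "x \<noteq> 0" using J(1,4) subspace_0 by blast
  then obtain c where c: "x = (\<Sum>v\<in>insert 0 roots. c v)" "\<And>v. c v \<in> G" "\<And>v. wt (rt v) (c v)"
    using root_decomposition J(2) by blast
  \<comment> \<open>\<open>weight_components\<close> indexes summands by functionals; injectivity of
    \<open>rt\<close> allows passing between these and coefficient vectors.\<close>
  let ?inv = "inv_into UNIV rt"
  have inv: "?inv (rt v) = v" for v by (rule inv_into_f_f) (auto intro: injI rt_inj)
  have sum: "(\<Sum>\<psi>\<in>rt ` insert 0 roots. c (?inv \<psi>)) = x"
    unfolding c(1) by (subst sum.reindex) (auto simp: inv inj_on_def intro: rt_inj)
  have cJ: "c v \<in> J" if "v \<in> insert 0 roots" for v
  proof -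
    have "c (?inv (rt v)) \<in> J"
      by (rule weight_components[where x = "\<lambda>\<psi>. c (?inv \<psi>)" and A = "rt ` insert 0 roots", OF J(1)])
        (use J(3) T_in_G finite_roots sum x(1) c(3) inv that in auto)
    then show ?thesis by (simp add: inv)
  qed
  obtain v where v: "v \<in> insert 0 roots" "c v \<noteq> 0"
    using x(2) c(1) by (metis sum.neutral)
  have "\<exists>i. e i \<in> J \<or> f i \<in> J"
  proof (cases "v = 0")
    case True
    then obtain t where t: "c v = T t" using zero_weight[of "c v"] c(2,3) by auto
    with v have "t \<noteq> 0" by auto
    \<comment> \<open>A torus element of the ideal puts into the ideal the generator of any base
      root that does not vanish on it.\<close>
    then obtain i where "rt (b i) t \<noteq> 0" using rt_faithful_base[OF good] by blast
    then show ?thesis using T_e[of t i] cJ[OF v(1)] t by auto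
  next
    case False
    then have "v \<in> weights" using v(2) c(2,3) by (auto simp: weights_def)
    then show ?thesis using start cJ[OF v(1)] v(2) c(3) by blast
  qed
  then obtain i0 where "T (co (b i0)) \<in> J" using e_T by blast
  \<comment> \<open>The coroots in the ideal are closed under passing to a nonorthogonal neighbour,
    so they exhaust a connected base.\<close>
  define A where "A = {i. T (co (b i)) \<in> J}"
  have "A = UNIV"
  proof (rule ccontr)
    assume "A \<noteq> UNIV"
    moreover have "A \<noteq> {}" using \<open>T (co (b i0)) \<in> J\<close> by (auto simp: A_def)
    ultimately obtain i j where ij: "i \<in> A" "j \<notin> A" "ip (b i) (b j) \<noteq> 0" using connected by blast
    then have "rt (b j) (co (b i)) \<noteq> 0" using b_nonzero[of i] by (simp add: rt_co ip_commute[of "b j" "b i"])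
    then have "e j \<in> J" using T_e ij(1) by (auto simp: A_def)
    then show False using e_T ij(2) by (auto simp: A_def)
  qed
  then have co: "T (co (b i)) \<in> J" for i by (auto simp: A_def)
  have "rt (b i) (co (b i)) \<noteq> 0" for i by (simp add: rt_co_self b_nonzero)
  then have ef: "e i \<in> J" "f i \<in> J" for i using T_e[OF co] T_f[OF co] by blast+
  have "torus.subspace {t. T t \<in> J}"
    using J(1) by (auto simp: torus.subspace_def T_add T_scale subspace_0 subspace_add subspace_scale)
  moreover have "T (tv (b i)) \<in> J" for i
  proof -
    have "scale (of_real (2 / ip (b i) (b i))) (T (tv (b i))) \<in> J"
      using co[of i] by (simp add: co_def T_scale)
    then show ?thesis by (rule cancel) (simp add: b_nonzero)
  qed
  ultimately have "T t \<in> J" for t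
    using tv_mem[OF good, of "{t. T t \<in> J}" t] by simp
  moreover have "subalg J" using J by (auto simp: subalg_def)
  ultimately have "G \<subseteq> J" using gen ef unfolding generates_def by blast
  with J(2) show ?thesis by blast
qed

end

section \<open>Quotients of the algebra of Lie terms\<close>

text \<open>Only the axioms of Lie algebras, free of parameters, so that the quotient can be a type;
  the defining relations are divided out afterwards, inside this type.\<close>

inductive lie_eq :: "('h, 'n) lie_term \<Rightarrow> ('h, 'n) lie_term \<Rightarrow> bool" where
  refl: "lie_eq s s"
| sym: "lie_eq s t \<Longrightarrow> lie_eq t s"
| trans: "lie_eq s t \<Longrightarrow> lie_eq t u \<Longrightarrow> lie_eq s u"
| plus_cong: "lie_eq s s' \<Longrightarrow> lie_eq t t' \<Longrightarrow> lie_eq (Plus s t) (Plus s' t')"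
| scale_cong: "lie_eq s s' \<Longrightarrow> lie_eq (Scale c s) (Scale c s')"
| bracket_cong: "lie_eq s s' \<Longrightarrow> lie_eq t t' \<Longrightarrow> lie_eq (Bracket s t) (Bracket s' t')"
| plus_assoc: "lie_eq (Plus (Plus s t) u) (Plus s (Plus t u))"
| plus_commute: "lie_eq (Plus s t) (Plus t s)"
| plus_zero: "lie_eq (Plus Zero s) s"
| plus_inverse: "lie_eq (Plus s (Scale (- 1) s)) Zero"
| scale_plus: "lie_eq (Scale c (Plus s t)) (Plus (Scale c s) (Scale c t))"
| scale_add: "lie_eq (Scale (b + c) s) (Plus (Scale b s) (Scale c s))"
| scale_scale: "lie_eq (Scale b (Scale c s)) (Scale (b * c) s)"
| scale_one: "lie_eq (Scale 1 s) s"
| bracket_plus_left: "lie_eq (Bracket (Plus s t) u) (Plus (Bracket s u) (Bracket t u))"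
| bracket_plus_right: "lie_eq (Bracket s (Plus t u)) (Plus (Bracket s t) (Bracket s u))"
| bracket_scale_left: "lie_eq (Bracket (Scale c s) t) (Scale c (Bracket s t))"
| bracket_scale_right: "lie_eq (Bracket s (Scale c t)) (Scale c (Bracket s t))"
| bracket_self: "lie_eq (Bracket s s) Zero"
| jacobi:
    "lie_eq (Plus (Plus (Bracket s (Bracket t u)) (Bracket t (Bracket u s))) (Bracket u (Bracket s t))) Zero"

quotient_type ('h, 'n) free_lie = "('h, 'n) lie_term" / lie_eq
  by (intro equivpI reflpI sympI transpI) (auto intro: lie_eq.intros)

instantiation free_lie :: (type, type) ab_group_add
begin

lift_definition zero_free_lie :: "('a, 'b) free_lie" is Zero .

lift_definition plus_free_lie :: "('a, 'b) free_lie \<Rightarrow> ('a, 'b) free_lie \<Rightarrow> ('a, 'b) free_lie" is Plus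
  by (rule lie_eq.plus_cong)

lift_definition uminus_free_lie :: "('a, 'b) free_lie \<Rightarrow> ('a, 'b) free_lie" is "Scale (- 1)"
  by (rule lie_eq.scale_cong)

definition minus_free_lie :: "('a, 'b) free_lie \<Rightarrow> ('a, 'b) free_lie \<Rightarrow> ('a, 'b) free_lie" where
  "minus_free_lie x y = x + (- y)"

instance
proof
  fix x y z :: "('a, 'b) free_lie"
  show "x + y + z = x + (y + z)" by transfer (rule lie_eq.plus_assoc)
  show "x + y = y + x" by transfer (rule lie_eq.plus_commute)
  show "0 + x = x" by transfer (rule lie_eq.plus_zero)
  show "- x + x = 0" by transfer (rule lie_eq.trans[OF lie_eq.plus_commute lie_eq.plus_inverse])
  show "x - y = x + - y" by (rule minus_free_lie_def)
qed

end

lift_definition free_scale :: "complex \<Rightarrow> ('h, 'n) free_lie \<Rightarrow> ('h, 'n) free_lie" is Scale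
  by (rule lie_eq.scale_cong)

lift_definition free_bracket :: "('h, 'n) free_lie \<Rightarrow> ('h, 'n) free_lie \<Rightarrow> ('h, 'n) free_lie" is Bracket
  by (rule lie_eq.bracket_cong)

interpretation free_lie: lie_bilinear free_scale free_bracket
proof
  fix a b :: complex and x y z :: "('h, 'n) free_lie"
  show "free_scale a (x + y) = free_scale a x + free_scale a y" by transfer (rule lie_eq.scale_plus)
  show "free_scale (a + b) x = free_scale a x + free_scale b x" by transfer (rule lie_eq.scale_add)
  show "free_scale a (free_scale b x) = free_scale (a * b) x" by transfer (rule lie_eq.scale_scale)
  show "free_scale 1 x = x" by transfer (rule lie_eq.scale_one)
  show "free_bracket (x + y) z = free_bracket x z + free_bracket y z" by transfer (rule lie_eq.bracket_plus_left)
  show "free_bracket x (y + z) = free_bracket x y + free_bracket x z" by transfer (rule lie_eq.bracket_plus_right)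
  show "free_bracket (free_scale a x) y = free_scale a (free_bracket x y)" by transfer (rule lie_eq.bracket_scale_left)
  show "free_bracket x (free_scale a y) = free_scale a (free_bracket x y)" by transfer (rule lie_eq.bracket_scale_right)
  show "free_bracket x x = 0" by transfer (rule lie_eq.bracket_self)
  show "free_bracket x (free_bracket y z) + free_bracket y (free_bracket z x) + free_bracket z (free_bracket x y) = 0"
    by transfer (rule lie_eq.jacobi)
qed

lemma (in vector_space) projection_exists:
  assumes "subspace I"
  shows "\<exists>p. Vector_Spaces.linear scale scale p \<and> (\<forall>x\<in>I. p x = 0) \<and> (\<forall>x. x - p x \<in> I)"
proof -
  interpret vector_space_pair scale scale ..
  obtain B where B: "B \<subseteq> I" "independent B" "I \<subseteq> span B"
    using maximal_independent_subset[of I] by blast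
  let ?C = "extend_basis B"
  obtain p where lin: "Vector_Spaces.linear scale scale p" and p: "\<And>x. x \<in> ?C \<Longrightarrow> p x = (if x \<in> B then 0 else x)"
    using linear_independent_extend[OF independent_extend_basis[OF B(2)], of "\<lambda>x. if x \<in> B then 0 else x"] by blast
  interpret p: Vector_Spaces.linear scale scale p by (rule lin)
  have "p x = 0" if "x \<in> I" for x
  proof -
    have "x \<in> span B" using that B by auto
    then show ?thesis
      by (induction rule: span_induct_alt)
        (use p extend_basis_superset[OF B(2)] in \<open>auto simp: p.add p.scale\<close>)
  qed
  moreover have "x - p x \<in> I" for x
  proof -
    have "x \<in> span ?C" using span_extend_basis[OF B(2)] by simp
    then show ?thesis
    proof (induction rule: span_induct_alt)
      case (step c x y)
      have "x - p x \<in> I" using p[OF step(1)] B(1) subspace_0[OF assms] by auto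
      then have "scale c (x - p x) + (y - p y) \<in> I"
        using step(2) by (intro subspace_add subspace_scale assms)
      also have "scale c (x - p x) + (y - p y) = scale c x + y - p (scale c x + y)"
        by (simp add: p.add p.scale scale_right_diff_distrib)
      finally show ?case .
    qed (simp add: subspace_0 assms)
  qed
  ultimately show ?thesis using lin by blast
qed

section \<open>The quotient by a congruence of terms\<close>

locale lie_congruence =
  fixes R :: "('h, 'n) lie_term \<Rightarrow> ('h, 'n) lie_term \<Rightarrow> bool"
  assumes lie_eq: "lie_eq s t \<Longrightarrow> R s t"
    and R_sym: "R s t \<Longrightarrow> R t s"
    and R_trans: "R s t \<Longrightarrow> R t u \<Longrightarrow> R s u"
    and R_plus: "R s s' \<Longrightarrow> R t t' \<Longrightarrow> R (Plus s t) (Plus s' t')"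
    and R_scale: "R s s' \<Longrightarrow> R (Scale c s) (Scale c s')"
    and R_bracket: "R s s' \<Longrightarrow> R t t' \<Longrightarrow> R (Bracket s t) (Bracket s' t')"

text \<open>The quotient by the ideal of a congruence is the range of \<open>q\<close>, a linear complement of the ideal.
  The bracket \<open>br\<close> is the free bracket followed by the projection \<open>p\<close> that kills the ideal; it
  satisfies the axioms on the whole type, where the ideal becomes a central summand.\<close>

locale lie_quotient = lie_bilinear free_scale br
  for br :: "('h, 'n) free_lie \<Rightarrow> ('h, 'n) free_lie \<Rightarrow> ('h, 'n) free_lie" +
  fixes q :: "('h, 'n) lie_term \<Rightarrow> ('h, 'n) free_lie" and R
  assumes q_eq: "q s = q t \<longleftrightarrow> R s t"
    and q_Zero: "q Zero = 0"
    and q_Plus: "q (Plus s t) = q s + q t"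
    and q_Scale: "q (Scale c s) = free_scale c (q s)"
    and q_Bracket: "q (Bracket s t) = br (q s) (q t)"
begin

lemma subalg_range: "subalg (range q)"
  unfolding subalg_def subspace_def
  by (auto simp flip: q_Zero q_Plus q_Scale q_Bracket)

lemma range_subset:
  assumes S: "subalg S" and "range (\<lambda>t. q (Cartan t)) \<subseteq> S" "range (\<lambda>i. q (E i)) \<subseteq> S" "range (\<lambda>i. q (F i)) \<subseteq> S"
  shows "range q \<subseteq> S"
proof
  fix x assume "x \<in> range q"
  then obtain s where "x = q s" by blast
  moreover have "q s \<in> S"
  proof (induction s)
    case (Plus s t)
    then show ?case unfolding q_Plus by (rule subspace_add[OF subalg_subspace[OF S]])
  next
    case (Scale c s)
    then show ?case unfolding q_Scale by (rule subspace_scale[OF subalg_subspace[OF S]])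
  next
    case (Bracket s t)
    then show ?case unfolding q_Bracket by (rule subalg_br[OF S])
  next
    case Zero
    then show ?case unfolding q_Zero by (rule subspace_0[OF subalg_subspace[OF S]])
  qed (use assms in auto)
  ultimately show "x \<in> S" by simp
qed

lemma q_bracket_pow: "q ((Bracket s ^^ k) t) = (br (q s) ^^ k) (q t)"
  by (induction k) (simp_all add: q_Bracket)

end

text \<open>The projection \<open>p\<close> along the ideal changes a bracket only by elements of
  the ideal. Hence the free bracket followed by \<open>p\<close> keeps all axioms, and
  \<open>p\<close> kills exactly the terms congruent to \<open>Zero\<close>.\<close>

lemma lie_quotient_exists:
  assumes "lie_congruence R"
  shows "\<exists>br q. lie_quotient br q R"
proof -
  interpret lie_congruence R by (rule assms)
  have R_refl: "R s s" for s by (rule lie_eq[OF lie_eq.refl])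
  define I where "I = {abs_free_lie t | t. R t Zero}"
  have I_iff: "abs_free_lie t \<in> I \<longleftrightarrow> R t Zero" for t
  proof
    assume "abs_free_lie t \<in> I"
    then obtain s where "R s Zero" "lie_eq t s" by (auto simp: I_def free_lie.abs_eq_iff)
    then show "R t Zero" using lie_eq R_trans by blast
  qed (auto simp: I_def)
  have zero: "abs_free_lie Zero = 0" and plus: "abs_free_lie (Plus s t) = abs_free_lie s + abs_free_lie t"
    and scale: "abs_free_lie (Scale c s) = free_scale c (abs_free_lie s)"
    and bracket: "abs_free_lie (Bracket s t) = free_bracket (abs_free_lie s) (abs_free_lie t)" for s t c
    by (simp_all add: zero_free_lie_def plus_free_lie.abs_eq free_scale.abs_eq free_bracket.abs_eq)
  have rep: "\<exists>s. x = abs_free_lie s" for x by (metis Quotient3_abs_rep Quotient3_free_lie)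
  have minus: "abs_free_lie (Plus s (Scale (- 1) t)) = abs_free_lie s - abs_free_lie t" for s t
    by (simp add: plus scale)
  have PZ: "R (Plus Zero Zero) Zero" by (rule lie_eq[OF lie_eq.plus_zero])
  have "x + y \<in> I" if "x \<in> I" "y \<in> I" for x y
  proof -
    obtain s t where "x = abs_free_lie s" "y = abs_free_lie t" using rep by blast
    then show ?thesis using that R_trans[OF R_plus[of s Zero t Zero] PZ] by (simp add: I_iff flip: plus)
  qed
  moreover have "free_scale c x \<in> I" if "x \<in> I" for c x
  proof -
    obtain s where "x = abs_free_lie s" using rep by blast
    moreover have "R (Scale c Zero) Zero"
    proof -
      have "abs_free_lie (Scale c Zero) = abs_free_lie Zero" by (simp add: scale zero)
      then show ?thesis by (intro lie_eq) (simp add: free_lie.abs_eq_iff)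
    qed
    ultimately show ?thesis using that R_trans[OF R_scale[of s Zero c]] by (simp add: I_iff flip: scale)
  qed
  moreover have "0 \<in> I" by (simp add: I_iff R_refl flip: zero)
  ultimately have "free_lie.subspace I" by (simp add: free_lie.subspace_def)
  note subI = this
  have idl: "free_bracket x y \<in> I" if "y \<in> I" for x y
  proof -
    obtain s t where st: "x = abs_free_lie s" "y = abs_free_lie t" using rep by blast
    have "R (Bracket s Zero) Zero"
    proof -
      have "abs_free_lie (Bracket s Zero) = abs_free_lie Zero" by (simp add: bracket zero)
      then show ?thesis by (intro lie_eq) (simp add: free_lie.abs_eq_iff)
    qed
    then show ?thesis using that R_trans[OF R_bracket[OF R_refl[of s], of t Zero]] st by (simp add: I_iff flip: bracket)
  qed
  obtain p where lin: "Vector_Spaces.linear free_scale free_scale p"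
    and pI: "\<And>x. x \<in> I \<Longrightarrow> p x = 0" and p_diff: "\<And>x. x - p x \<in> I"
    using free_lie.projection_exists[OF subI] by blast
  interpret p: Vector_Spaces.linear free_scale free_scale p by (rule lin)
  have p0: "p x = 0 \<longleftrightarrow> x \<in> I" for x using pI p_diff[of x] by auto
  have br_right: "p (free_bracket x (p y)) = p (free_bracket x y)" for x y
  proof -
    have "p (free_bracket x (y - p y)) = 0" by (intro pI idl p_diff)
    then show ?thesis by (simp add: free_lie.br_diff_right p.diff)
  qed
  have br_left: "p (free_bracket (p x) y) = p (free_bracket x y)" for x y
    using br_right[of y x] free_lie.br_swap[of "p x" y] free_lie.br_swap[of x y] by (simp add: p.neg)
  let ?br = "\<lambda>x y. p (free_bracket x y)" and ?q = "\<lambda>t. p (abs_free_lie t)"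
  have "lie_quotient ?br ?q R"
  proof
    fix x y z :: "('a, 'b) free_lie" and c and s t :: "('a, 'b) lie_term"
    show "?br (x + y) z = ?br x z + ?br y z" by (simp add: free_lie.br_add_left p.add)
    show "?br x (y + z) = ?br x y + ?br x z" by (simp add: free_lie.br_add_right p.add)
    show "?br (free_scale c x) y = free_scale c (?br x y)" by (simp add: free_lie.br_scale_left p.scale)
    show "?br x (free_scale c y) = free_scale c (?br x y)" by (simp add: free_lie.br_scale_right p.scale)
    show "?br x x = 0" by (simp add: free_lie.br_self)
    show "?br x (?br y z) + ?br y (?br z x) + ?br z (?br x y) = 0"
      using free_lie.br_jacobi[of x y z] by (simp add: br_right flip: p.add)
    have "?q s = ?q t \<longleftrightarrow> p (abs_free_lie s - abs_free_lie t) = 0" by (simp add: p.diff)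
    also have "\<dots> \<longleftrightarrow> R (Plus s (Scale (- 1) t)) Zero" unfolding p0 by (simp only: I_iff flip: minus)
    also have "\<dots> \<longleftrightarrow> R s t"
    proof
      have inv: "R (Plus t (Scale (- 1) t)) Zero" by (rule lie_eq[OF lie_eq.plus_inverse])
      show "R s t" if "R (Plus s (Scale (- 1) t)) Zero"
      proof -
        have "R (Plus (Plus s (Scale (- 1) t)) t) (Plus Zero t)" by (rule R_plus[OF that R_refl])
        moreover have "lie_eq (Plus (Plus s (Scale (- 1) t)) t) s"
          unfolding free_lie.abs_eq_iff[symmetric] by (simp add: plus scale)
        ultimately show ?thesis by (meson lie_eq lie_eq.plus_zero R_sym R_trans)
      qed
      show "R (Plus s (Scale (- 1) t)) Zero" if "R s t"
        by (rule R_trans[OF R_plus[OF that R_refl] inv])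
    qed
    finally show "?q s = ?q t \<longleftrightarrow> R s t" .
    show "?q Zero = 0" by (simp add: zero)
    show "?q (Plus s t) = ?q s + ?q t" by (simp add: plus p.add)
    show "?q (Scale c s) = free_scale c (?q s)" by (simp add: scale p.scale)
    show "?q (Bracket s t) = ?br (?q s) (?q t)" by (simp add: bracket br_left br_right)
  qed
  then show ?thesis by blast
qed

section \<open>The irreducible quotient of a Verma module\<close>

context root_lie
begin

text \<open>On the torus \<open>ad z\<close> squares to zero because \<open>z\<close> is a weight
  vector, so only the generators have to be tested.\<close>

lemma nil_from_generators:
  assumes "generates e f" "wt \<phi> z" "\<And>j. nilp z (e j)" "\<And>j. nilp z (f j)" "y \<in> G"
  shows "nilp z y"
proof -
  have "nilp z (T t)" for t
  proof (rule nilpI)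
    show "(br z ^^ 2) (T t) = 0"
      by (simp add: numeral_2_eq_2 br_T_right[OF assms(2)] br_minus_right br_scale_right br_self)
  qed
  then have "G \<subseteq> {y. nilp z y}"
    using assms by (intro generatesD[OF assms(1)] subalg_nilp) auto
  then show ?thesis using assms(5) by auto
qed

lemma nilp_opposite:
  assumes "wt \<phi> e" "br e f = T k"
  shows "nilp e f"
  by (rule nilpI[where n = 3])
    (simp add: numeral_3_eq_3 assms(2) br_T_right[OF assms(1)] br_minus_right br_scale_right br_self)

text \<open>The sl2 computation behind the Serre relations: the factor on the right vanishes for
  \<open>m = - rt c (co a)\<close>, so that \<open>Suc m\<close> is the Serre exponent.\<close>

lemma br_raise_lowered:
  assumes f: "wt (rt (- a)) f" "wt (rt (- c)) f'" and "br e f = T (co a)" "br e f' = 0" "a \<noteq> 0"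
  shows "br e ((br f ^^ Suc m) f') = scale (of_nat (Suc m) * (- rt c (co a) - of_nat m)) ((br f ^^ m) f')"
proof (induction m)
  case 0
  show ?case using f(2) by (simp add: br_br[of e f] assms wt_def rt_minus)
next
  case (Suc m)
  let ?y = "(br f ^^ Suc m) f'"
  have weight: "of_nat (Suc m) * rt (- a) (co a) + rt (- c) (co a) = - rt c (co a) - 2 * of_nat (Suc m)"
    by (simp add: rt_minus rt_co_self[OF assms(5)] algebra_simps)
  have "br (T (co a)) ?y = scale (of_nat (Suc m) * rt (- a) (co a) + rt (- c) (co a)) ?y"
    using wt_br_pow[OF f, of "Suc m"] unfolding wt_def by blast
  then have "br (T (co a)) ?y = scale (- rt c (co a) - 2 * of_nat (Suc m)) ?y"
    unfolding weight .
  moreover have "br e ((br f ^^ Suc (Suc m)) f') = br (T (co a)) ?y + br f (br e ?y)"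
    by (simp add: br_br[of e f] assms(3))
  moreover have "br f (br e ?y) = scale (of_nat (Suc m) * (- rt c (co a) - of_nat m)) ?y"
    unfolding Suc br_scale_right by simp
  ultimately have "br e ((br f ^^ Suc (Suc m)) f') =
      scale ((- rt c (co a) - 2 * of_nat (Suc m)) + of_nat (Suc m) * (- rt c (co a) - of_nat m)) ?y"
    by (simp only: scale_left_distrib)
  also have "(- rt c (co a) - 2 * of_nat (Suc m)) + of_nat (Suc m) * (- rt c (co a) - of_nat m)
      = of_nat (Suc (Suc m)) * (- rt c (co a) - of_nat (Suc m))"
    by (simp add: algebra_simps)
  finally show ?case .
qed

text \<open>For \<open>k = i\<close> this is the vanishing factor in
  \<open>br_raise_lowered\<close>. For \<open>k \<noteq> i\<close> the raising operator passes
  through to \<open>f j\<close>. If \<open>k = j\<close> it leaves a torus element, which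
  \<open>ad (f i)\<close> kills after two steps, and after one step if the exponent is 1, for then
  the roots are orthogonal.\<close>

lemma serre_commute:
  assumes f: "\<And>i. wt (rt (- b i)) (f i)" and ef: "\<And>i. br (e i) (f i) = T (co (b i))"
    and comm: "\<And>i j. i \<noteq> j \<Longrightarrow> br (e i) (f j) = 0" and nz: "\<And>i. b i \<noteq> 0"
    and ij: "i \<noteq> j" "ip (b i) (b j) \<le> 0" and n: "of_nat n = 1 - rt (b j) (co (b i))"
  shows "br (e k) ((br (f i) ^^ n) (f j)) = 0"
proof -
  have npos: "n \<noteq> 0"
  proof
    assume "n = 0"
    then have "rt (b j) (co (b i)) = 1" using n by simp
    then have "2 * ip (b j) (b i) / ip (b i) (b i) = 1" by (simp only: rt_co of_real_eq_1_iff)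
    moreover have "2 * ip (b j) (b i) / ip (b i) (b i) \<le> 0"
      using ij(2) ip_pos[OF nz[of i]] by (simp add: ip_commute[of "b j" "b i"] divide_nonpos_pos)
    ultimately show False by linarith
  qed
  show ?thesis
  proof (cases "k = i")
    case True
    obtain m where m: "n = Suc m" using npos by (cases n) auto
    then have "- rt (b j) (co (b i)) - of_nat m = 0" using n by simp
    then show ?thesis
      using br_raise_lowered[OF f f ef[of i] comm[OF ij(1)] nz, of m] by (simp only: True m mult_zero_right scale_zero_left)
  next
    case False
    have "br (e k) ((br (f i) ^^ m) y) = (br (f i) ^^ m) (br (e k) y)" for m y
      by (induction m) (simp_all add: br_br[of "e k" "f i"] comm[OF False])
    then have *: "br (e k) ((br (f i) ^^ n) (f j)) = (br (f i) ^^ n) (br (e k) (f j))" .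
    show ?thesis
    proof (cases "k = j")
      case True
      have 1: "br (f i) (T t) = scale (rt (b i) t) (f i)" for t
        using br_T_right[OF f[of i], of t] by (simp add: rt_minus)
      then have 2: "(br (f i) ^^ 2) (T t) = 0" for t by (simp add: numeral_2_eq_2 br_scale_right br_self)
      have "(br (f i) ^^ n) (T (co (b j))) = 0"
      proof (cases "n = 1")
        case True
        then have "rt (b j) (co (b i)) = 0" using n by simp
        then have "ip (b i) (b j) = 0" using nz[of i] by (simp add: rt_co ip_commute[of "b j" "b i"])
        then show ?thesis using True by (simp add: 1 rt_co)
      next
        case False
        then have "2 \<le> n" using npos by linarith
        then show ?thesis using br_pow_eq_0_mono[OF 2] by blast
      qed
      then show ?thesis using * True ef by simp
    next
      case False
      then show ?thesis using * comm by simp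
    qed
  qed
qed

end

text \<open>A string of weights \<open>v + n a\<close> must leave the finite set of roots. In the
  model this provides nilpotency for the generators of every base, not only of one of Cartan
  type.\<close>

lemma (in cartan_lie) nilp_weight_vector:
  assumes z: "z \<in> G" "wt (rt a) z" "a \<noteq> 0" and "y \<in> G"
  shows "nilp z y"
proof -
  obtain c where c: "y = (\<Sum>v\<in>insert 0 roots. c v)" "\<And>v. c v \<in> G" "\<And>v. wt (rt v) (c v)"
    using root_decomposition[OF assms(4)] by blast
  have "nilp z (c v)" for v
  proof (rule ccontr)
    assume "\<not> nilp z (c v)"
    then have nz: "(br z ^^ n) (c v) \<noteq> 0" for n by (auto simp: nilp_def)
    have mem: "(br z ^^ n) (c v) \<in> G" for n
      using z(1) c(2) G(1) by (induction n) (auto simp: subalg_def)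
    have "wt (rt (real n *\<^sub>R a + v)) ((br z ^^ n) (c v))" for n
      using wt_br_pow[OF z(2) c(3), of n v] by (simp add: wt_def rt_add rt_scale)
    then have "real n *\<^sub>R a + v \<in> insert 0 roots" for n
      using weight_is_root[OF mem nz] rt_inj by metis
    then have "range (\<lambda>n. real n *\<^sub>R a + v) \<subseteq> insert 0 roots" by blast
    then have "finite (range (\<lambda>n::nat. real n *\<^sub>R a + v))" using finite_roots finite_subset by blast
    moreover have "inj (\<lambda>n::nat. real n *\<^sub>R a + v)" using z(3) by (auto simp: inj_def)
    ultimately show False using finite_imageD by blast
  qed
  then have "y \<in> {y. nilp z y}"
    unfolding c(1) by (intro subspace_sum subalg_subspace subalg_nilp) auto
  then show ?thesis by simp
qed

section \<open>Operators on the dual of a Verma module\<close>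

locale dual_verma = realization tscale g rt tv
  for tscale :: "complex \<Rightarrow> 'h \<Rightarrow> 'h::ab_group_add" and g :: "'n::finite \<Rightarrow> 'n \<Rightarrow> real" and rt tv +
  fixes b :: "'n \<Rightarrow> real^'n" and lam :: "real^'n"
  assumes good_b: "good b" and obtuse: "i \<noteq> j \<Longrightarrow> ip (b i) (b j) \<le> 0"
begin

abbreviation wsum :: "'n list \<Rightarrow> real^'n" where
  "wsum w \<equiv> (\<Sum>i\<leftarrow>w. b i)"

text \<open>The function supported on the word \<open>w\<close> has weight \<open>lam\<close> minus
  the sum of the letters of \<open>w\<close>.\<close>

definition t_op :: "'h \<Rightarrow> ('n list \<Rightarrow> complex) \<Rightarrow> 'n list \<Rightarrow> complex" where
  "t_op t x w = (rt lam t - rt (wsum w) t) * x w"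

definition e_op :: "'n \<Rightarrow> ('n list \<Rightarrow> complex) \<Rightarrow> 'n list \<Rightarrow> complex" where
  "e_op i x w = x (i # w)"

text \<open>The vector space \<open>'n list \<Rightarrow> complex\<close> is the dual of a Verma module: \<open>x w\<close> is the coefficient
  of the highest weight vector after the raising operators have been applied to \<open>x\<close> in the order
  given by the word \<open>w\<close>. The recursion for the lowering operator is forced by
  \<open>[e j, f i] = \<delta> i j (h i)\<close>.\<close>

primrec f_rec :: "'n list \<Rightarrow> 'n \<Rightarrow> ('n list \<Rightarrow> complex) \<Rightarrow> complex" where
  "f_rec [] i x = 0"
| "f_rec (j # w) i x = f_rec w i (e_op j x) + (if i = j then t_op (co (b i)) x w else 0)"

definition f_op :: "'n \<Rightarrow> ('n list \<Rightarrow> complex) \<Rightarrow> 'n list \<Rightarrow> complex" where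
  "f_op i x w = f_rec w i x"

primrec ev :: "('h, 'n) lie_term \<Rightarrow> ('n list \<Rightarrow> complex) \<Rightarrow> 'n list \<Rightarrow> complex" where
  "ev (Cartan t) = t_op t"
| "ev (E i) = e_op i"
| "ev (F i) = f_op i"
| "ev Zero = (\<lambda>x w. 0)"
| "ev (Plus s t) = (\<lambda>x w. ev s x w + ev t x w)"
| "ev (Scale c s) = (\<lambda>x w. c * ev s x w)"
| "ev (Bracket s t) = (\<lambda>x w. ev s (ev t x) w - ev t (ev s x) w)"

definition lin :: "(('n list \<Rightarrow> complex) \<Rightarrow> 'n list \<Rightarrow> complex) \<Rightarrow> bool" where
  "lin A \<longleftrightarrow> (\<forall>x y c. A (\<lambda>w. x w + c * y w) = (\<lambda>w. A x w + c * A y w))"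

lemma lin_comb: "lin A \<Longrightarrow> A (\<lambda>w. x w + c * y w) = (\<lambda>w. A x w + c * A y w)"
  by (simp add: lin_def)

lemma lin_zero: "lin A \<Longrightarrow> A (\<lambda>w. 0) = (\<lambda>w. 0)"
  using lin_comb[of A "\<lambda>w. 0" "- 1" "\<lambda>w. 0"] by simp

lemma lin_add: "lin A \<Longrightarrow> A (\<lambda>w. x w + y w) = (\<lambda>w. A x w + A y w)"
  using lin_comb[of A x 1 y] by simp

lemma lin_diff: "lin A \<Longrightarrow> A (\<lambda>w. x w - y w) = (\<lambda>w. A x w - A y w)"
  using lin_comb[of A x "- 1" y] by simp

lemma lin_scale: "lin A \<Longrightarrow> A (\<lambda>w. c * y w) = (\<lambda>w. c * A y w)"
  using lin_comb[of A "\<lambda>w. 0" c y] lin_zero[of A] by simp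

lemma lin_t_op: "lin (t_op t)"
  by (simp add: lin_def t_op_def fun_eq_iff algebra_simps)

lemma lin_e_op: "lin (e_op i)"
  by (simp add: lin_def e_op_def fun_eq_iff)

lemma f_rec_lin: "f_rec w i (\<lambda>w. x w + c * y w) = f_rec w i x + c * f_rec w i y"
  by (induction w arbitrary: x y)
    (simp_all add: lin_comb[OF lin_t_op] lin_comb[OF lin_e_op] algebra_simps)

lemma lin_f_op: "lin (f_op i)"
  by (simp add: lin_def f_op_def f_rec_lin fun_eq_iff)

lemma lin_ev: "lin (ev s)"
proof (induction s)
  case (Bracket s t)
  show ?case unfolding lin_def
  proof (intro allI)
    fix x y c
    show "ev (Bracket s t) (\<lambda>w. x w + c * y w) = (\<lambda>w. ev (Bracket s t) x w + c * ev (Bracket s t) y w)"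
      by (simp add: lin_comb[OF Bracket(1)] lin_comb[OF Bracket(2)] algebra_simps)
  qed
next
  case (Plus s t)
  then show ?case by (simp add: lin_def fun_eq_iff algebra_simps)
next
  case (Scale c s)
  then show ?case by (simp add: lin_def fun_eq_iff algebra_simps)
qed (simp_all add: lin_t_op lin_e_op lin_f_op, simp add: lin_def)

lemmas ev_linear = lin_zero[OF lin_ev] lin_add[OF lin_ev] lin_diff[OF lin_ev] lin_scale[OF lin_ev]

lemma lie_eq_ev: "lie_eq s t \<Longrightarrow> ev s = ev t"
  by (induction rule: lie_eq.induct) (simp_all add: ev_linear algebra_simps)

text \<open>Terms modulo this relation form the Lie algebra of operators on \<open>A\<close>. It is
  used with all functions, to see that Serre elements commute with generators of the other sign, and
  with the span of the lowered vectors, where the Serre elements become zero.\<close>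

definition agree :: "('n list \<Rightarrow> complex) set \<Rightarrow> ('h, 'n) lie_term \<Rightarrow> ('h, 'n) lie_term \<Rightarrow> bool" where
  "agree A s t \<longleftrightarrow> (\<forall>x\<in>A. ev s x = ev t x)"

lemma agree_congruence: "(\<And>s x. x \<in> A \<Longrightarrow> ev s x \<in> A) \<Longrightarrow> lie_congruence (agree A)"
  by standard (auto simp: agree_def dest: lie_eq_ev)

lemma e_f_op: "e_op j (f_op i x) w = f_op i (e_op j x) w + (if i = j then t_op (co (b i)) x w else 0)"
  by (simp add: e_op_def[of j "f_op i x"] f_op_def)

lemma t_e_op: "t_op t (e_op i x) = (\<lambda>w. e_op i (t_op t x) w + rt (b i) t * e_op i x w)"
  by (simp add: t_op_def e_op_def fun_eq_iff rt_add algebra_simps)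

lemma t_f_op: "t_op t (f_op i x) = (\<lambda>w. f_op i (t_op t x) w - rt (b i) t * f_op i x w)"
proof
  fix w
  show "t_op t (f_op i x) w = f_op i (t_op t x) w - rt (b i) t * f_op i x w"
  proof (induction w arbitrary: x)
    case (Cons j w)
    have shift: "y (j # w) = e_op j y w" for y by (simp add: e_op_def)
    have e_t: "e_op j (t_op t x) = (\<lambda>w. t_op t (e_op j x) w - rt (b j) t * e_op j x w)" for x
      by (simp add: t_e_op)
    have t: "t_op t x w = (rt lam t - rt (wsum w) t) * x w" for x w by (simp add: t_op_def)
    have IH: "f_op i (t_op t (e_op j x)) w = t_op t (f_op i (e_op j x)) w + rt (b i) t * f_op i (e_op j x) w"
      using Cons[of "e_op j x"] by simp
    have fl: "f_op i (\<lambda>w. t_op t (e_op j x) w - rt (b j) t * e_op j x w) w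
        = f_op i (t_op t (e_op j x)) w - rt (b j) t * f_op i (e_op j x) w"
      by (simp add: lin_diff[OF lin_f_op] lin_scale[OF lin_f_op])
    show ?case
      unfolding shift
      by (simp add: e_t e_f_op fl IH) (simp add: t_op_def e_f_op algebra_simps)
  qed (simp add: t_op_def f_op_def)
qed

section \<open>The submodule generated by the vacuum\<close>

definition vac :: "'n list \<Rightarrow> complex" where
  "vac w = (if w = [] then 1 else 0)"

primrec lowered :: "'n list \<Rightarrow> 'n list \<Rightarrow> complex" where
  "lowered [] = vac"
| "lowered (i # u) = f_op i (lowered u)"

inductive_set low_span :: "'n list set \<Rightarrow> ('n list \<Rightarrow> complex) set" for W where
  zero: "(\<lambda>w. 0) \<in> low_span W"
| step: "u \<in> W \<Longrightarrow> x \<in> low_span W \<Longrightarrow> (\<lambda>w. x w + c * lowered u w) \<in> low_span W"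

lemma low_span_base: "u \<in> W \<Longrightarrow> (\<lambda>w. c * lowered u w) \<in> low_span W"
  using low_span.step[OF _ low_span.zero, of u W c] by simp

lemma low_span_lin:
  assumes "x \<in> low_span W" "y \<in> low_span W"
  shows "(\<lambda>w. x w + c * y w) \<in> low_span W"
  using assms(2)
proof (induction rule: low_span.induct)
  case (step u y d)
  have "(\<lambda>w. (\<lambda>w. x w + c * y w) w + (c * d) * lowered u w) \<in> low_span W"
    by (rule low_span.step) (use step in auto)
  then show ?case by (simp add: algebra_simps)
qed (simp add: assms)

lemma low_span_mono: "x \<in> low_span W \<Longrightarrow> W \<subseteq> W' \<Longrightarrow> x \<in> low_span W'"
  by (induction rule: low_span.induct) (auto intro: low_span.intros)

lemma lin_low_span:
  assumes "lin A" "\<And>u. u \<in> W \<Longrightarrow> A (lowered u) \<in> low_span W'" "x \<in> low_span W"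
  shows "A x \<in> low_span W'"
  using assms(3)
proof (induction rule: low_span.induct)
  case (step u x c)
  then show ?case using assms(2) by (simp add: lin_comb[OF assms(1)] low_span_lin)
qed (simp add: lin_zero[OF assms(1)] low_span.zero)

lemma lin_low_span_zero:
  assumes "lin A" "\<And>u. u \<in> W \<Longrightarrow> A (lowered u) = (\<lambda>w. 0)" "x \<in> low_span W"
  shows "A x = (\<lambda>w. 0)"
  using assms(3)
proof (induction rule: low_span.induct)
  case (step u x c)
  then show ?case using assms(2) by (simp add: lin_comb[OF assms(1)])
qed (simp add: lin_zero[OF assms(1)])

lemma t_lowered: "t_op t (lowered u) = (\<lambda>w. (rt lam t - rt (wsum u) t) * lowered u w)"
proof (induction u)
  case Nil
  then show ?case by (auto simp: t_op_def vac_def)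
next
  case (Cons i u)
  show ?case
    unfolding lowered.simps t_f_op Cons lin_scale[OF lin_f_op] by (simp add: rt_add algebra_simps)
qed

lemma e_vac: "e_op k vac = (\<lambda>w. 0)"
  by (simp add: e_op_def vac_def fun_eq_iff)

text \<open>Raising shortens words; this length is the induction measure by which the lowering Serre
  elements are shown to vanish.\<close>

lemma e_lowered: "e_op k (lowered u) \<in> low_span {u'. length u' < length u}"
proof (induction u)
  case (Cons i u)
  let ?W = "{u' :: 'n list. length u' < length u}" and ?W' = "{u' :: 'n list. length u' < Suc (length u)}"
  have "f_op i (e_op k (lowered u)) \<in> low_span ?W'"
  proof (rule lin_low_span[OF lin_f_op _ Cons])
    fix v assume "v \<in> ?W"
    then have "lowered (i # v) = (\<lambda>w. 1 * lowered (i # v) w)" "i # v \<in> ?W'" by auto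
    then show "f_op i (lowered v) \<in> low_span ?W'" using low_span_base by (metis lowered.simps(2))
  qed
  moreover have "t_op (co (b i)) (lowered u) \<in> low_span ?W'"
    unfolding t_lowered by (rule low_span_base) simp
  ultimately have "(\<lambda>w. f_op i (e_op k (lowered u)) w + (if i = k then 1 else 0) * t_op (co (b i)) (lowered u) w) \<in> low_span ?W'"
    by (rule low_span_lin)
  also have "(\<lambda>w. f_op i (e_op k (lowered u)) w + (if i = k then 1 else 0) * t_op (co (b i)) (lowered u) w)
      = e_op k (lowered (i # u))"
    by (auto simp: e_f_op fun_eq_iff)
  finally show ?case by simp
qed (simp add: e_vac low_span.zero)

text \<open>Words are free, so the space of all functions is dual to a Verma module in which no
  Serre relations are imposed. Its submodule generated by the vacuum is the irreducible quotient of
  that Verma module, embedded in the dual.\<close>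

abbreviation irr :: "('n list \<Rightarrow> complex) set" where
  "irr \<equiv> low_span UNIV"

lemma ev_irr: "x \<in> irr \<Longrightarrow> ev s x \<in> irr"
proof (induction s arbitrary: x)
  case (Cartan t)
  show ?case unfolding ev.simps
    by (rule lin_low_span[OF lin_t_op _ Cartan]) (simp add: t_lowered low_span_base)
next
  case (E i)
  show ?case unfolding ev.simps
    by (rule lin_low_span[OF lin_e_op _ E]) (rule low_span_mono[OF e_lowered], simp)
next
  case (F i)
  show ?case unfolding ev.simps
  proof (rule lin_low_span[OF lin_f_op _ F])
    show "f_op i (lowered u) \<in> irr" for u using low_span_base[of "i # u" UNIV 1] by simp
  qed
next
  case Zero
  show ?case by (simp add: low_span.zero)
next
  case (Plus s t)
  then show ?case using low_span_lin[of "ev s x" UNIV "ev t x" 1] by simp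
next
  case (Scale c s)
  then show ?case using low_span_lin[OF low_span.zero, of "ev s x" UNIV c] by simp
next
  case (Bracket s t)
  then show ?case using low_span_lin[of "ev s (ev t x)" UNIV "ev t (ev s x)" "-1"] by simp
qed

lemma model_root_lie:
  assumes "lie_quotient br q (agree A)"
  shows "root_lie free_scale br tscale (\<lambda>t. q (Cartan t)) g rt tv (range q)"
proof -
  interpret lie_quotient br q "agree A" by (rule assms)
  have eq: "q s = q t" if "ev s = ev t" for s t
    using that by (simp add: q_eq agree_def)
  show ?thesis
  proof
    show "q (Cartan (s + t)) = q (Cartan s) + q (Cartan t)" for s t
      unfolding q_Plus[symmetric] by (rule eq) (simp add: t_op_def fun_eq_iff rt_plus algebra_simps)
    show "q (Cartan (tscale c t)) = free_scale c (q (Cartan t))" for c t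
      unfolding q_Scale[symmetric] by (rule eq) (simp add: t_op_def fun_eq_iff rt_tscale algebra_simps)
    show "br (q (Cartan s)) (q (Cartan t)) = 0" for s t
      unfolding q_Bracket[symmetric] q_Zero[symmetric] by (rule eq) (simp add: t_op_def fun_eq_iff)
    show "subalg (range q)" by (rule subalg_range)
  qed auto
qed

lemma model_relations:
  assumes "lie_quotient br q (agree A)"
  shows "lie_torus.wt free_scale br (\<lambda>t. q (Cartan t)) (rt (b i)) (q (E i))"
    and "lie_torus.wt free_scale br (\<lambda>t. q (Cartan t)) (rt (- b i)) (q (F i))"
    and "br (q (E i)) (q (F i)) = q (Cartan (co (b i)))"
    and "i \<noteq> j \<Longrightarrow> br (q (E i)) (q (F j)) = 0"
proof -
  interpret lie_quotient br q "agree A" by (rule assms)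
  interpret root_lie free_scale br tscale "\<lambda>t. q (Cartan t)" g rt tv "range q"
    by (rule model_root_lie[OF assms])
  have eq: "q s = q t" if "ev s = ev t" for s t
    using that by (simp add: q_eq agree_def)
  show "wt (rt (b i)) (q (E i))"
    unfolding wt_def q_Bracket[symmetric] q_Scale[symmetric]
    by (intro allI eq) (simp add: t_e_op)
  show "wt (rt (- b i)) (q (F i))"
    unfolding wt_def q_Bracket[symmetric] q_Scale[symmetric]
    by (intro allI eq) (simp add: t_f_op rt_minus)
  show "br (q (E i)) (q (F i)) = q (Cartan (co (b i)))"
    unfolding q_Bracket[symmetric] by (rule eq) (simp add: e_f_op fun_eq_iff)
  show "i \<noteq> j \<Longrightarrow> br (q (E i)) (q (F j)) = 0"
    unfolding q_Bracket[symmetric] q_Zero[symmetric] by (rule eq) (simp add: e_f_op fun_eq_iff)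
qed

text \<open>Both equations are \<open>serre_commute\<close> in the Lie algebra of all operators; for
  the second, the base is negated and the two kinds of generators exchange roles.\<close>

lemma serre_ev:
  assumes "i \<noteq> j" "of_nat n = 1 - rt (b j) (co (b i))"
  shows "ev ((Bracket (F i) ^^ n) (F j)) (e_op k x) = e_op k (ev ((Bracket (F i) ^^ n) (F j)) x)"
    and "ev ((Bracket (E i) ^^ n) (E j)) (f_op k x) = f_op k (ev ((Bracket (E i) ^^ n) (E j)) x)"
proof -
  obtain br q where q: "lie_quotient br q (agree UNIV)"
    using lie_quotient_exists[OF agree_congruence[of UNIV]] by auto
  interpret lie_quotient br q "agree UNIV" by (rule q)
  interpret root_lie free_scale br tscale "\<lambda>t. q (Cartan t)" g rt tv "range q"
    by (rule model_root_lie[OF q])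
  note rel = model_relations[OF q]
  have nz: "b i \<noteq> 0" for i by (rule root_nonzero[OF good_root[OF good_b]])
  have ev_commute: "ev s (ev t x) = ev t (ev s x)" if "br (q s) (q t) = 0" for s t
  proof -
    have "q (Bracket s t) = q Zero" using that by (simp add: q_Bracket q_Zero)
    then have "ev (Bracket s t) x w = ev Zero x w" for w by (simp only: q_eq agree_def UNIV_I ball_simps)
    then show ?thesis by auto
  qed
  have "br (q (E k)) ((br (q (F i)) ^^ n) (q (F j))) = 0"
    by (rule serre_commute[of b "\<lambda>i. q (F i)" "\<lambda>i. q (E i)"]) (use rel nz assms obtuse in auto)
  then show "ev ((Bracket (F i) ^^ n) (F j)) (e_op k x) = e_op k (ev ((Bracket (F i) ^^ n) (F j)) x)"
    using ev_commute[of "E k"] by (simp add: q_bracket_pow)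
  have "br (q (F k)) ((br (q (E i)) ^^ n) (q (E j))) = 0"
  proof (rule serre_commute[of "\<lambda>i. - b i" "\<lambda>i. q (E i)" "\<lambda>i. q (F i)"])
    show "wt (rt (- (- b i))) (q (E i))" for i using rel(1) by simp
    show "br (q (F i)) (q (E i)) = q (Cartan (co (- b i)))" for i
      using rel(3)[of i] br_swap[of "q (F i)" "q (E i)"] T_minus[of "co (b i)"] by (simp add: co_minus)
    show "br (q (F i)) (q (E j)) = 0" if "i \<noteq> j" for i j
      using rel(4)[of j i] that br_swap[of "q (F i)" "q (E j)"] by simp
    show "of_nat n = 1 - rt (- b j) (co (- b i))" using assms(2) by (simp add: co_minus rt_minus rt_uminus)
  qed (use nz assms obtuse in auto)
  then show "ev ((Bracket (E i) ^^ n) (E j)) (f_op k x) = f_op k (ev ((Bracket (E i) ^^ n) (E j)) x)"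
    using ev_commute[of "F k"] by (simp add: q_bracket_pow)
qed

lemma f_word_nil: "ev ((Bracket (F i) ^^ n) (F j)) x [] = 0"
proof (induction n arbitrary: x)
  case (Suc n)
  then show ?case by (simp add: f_op_def)
qed (simp add: f_op_def)

lemma e_word_vac: "ev ((Bracket (E i) ^^ n) (E j)) vac = (\<lambda>w. 0)"
proof (induction n)
  case (Suc n)
  then show ?case by (simp add: e_vac ev_linear lin_zero[OF lin_e_op])
qed (simp add: e_vac)

text \<open>The only vectors killed by all raising operators are the multiples of the vacuum, so the Serre
  elements, which commute with the raising operators, vanish on \<open>irr\<close>.\<close>

lemma singular_zero:
  assumes "\<And>k. e_op k x = (\<lambda>w. 0)" "x [] = 0"
  shows "x = (\<lambda>w. 0)"
proof
  fix w show "x w = 0"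
    using assms(2) fun_cong[OF assms(1)[of "hd w"], of "tl w"] by (cases w) (auto simp: e_op_def)
qed

lemma serre_irr:
  assumes "i \<noteq> j" "of_nat n = 1 - rt (b j) (co (b i))" "x \<in> irr"
  shows "ev ((Bracket (F i) ^^ n) (F j)) x = (\<lambda>w. 0)"
    and "ev ((Bracket (E i) ^^ n) (E j)) x = (\<lambda>w. 0)"
proof -
  let ?S = "(Bracket (F i) ^^ n) (F j)" and ?S' = "(Bracket (E i) ^^ n) (E j)"
  have "ev ?S (lowered u) = (\<lambda>w. 0)" for u
  proof (induction "length u" arbitrary: u rule: less_induct)
    case less
    show ?case
    proof (rule singular_zero)
      fix k
      \<comment> \<open>Raising produces combinations of shorter words, to which the induction
        hypothesis applies.\<close>
      have "e_op k (ev ?S (lowered u)) = ev ?S (e_op k (lowered u))"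
        by (rule serre_ev(1)[OF assms(1,2), symmetric])
      also have "\<dots> = (\<lambda>w. 0)"
        by (rule lin_low_span_zero[OF lin_ev _ e_lowered]) (use less in auto)
      finally show "e_op k (ev ?S (lowered u)) = (\<lambda>w. 0)" .
    qed (rule f_word_nil)
  qed
  then show "ev ?S x = (\<lambda>w. 0)" by (intro lin_low_span_zero[OF lin_ev _ assms(3)])
  \<comment> \<open>The raising Serre element kills the vacuum and commutes with lowering, so it
    kills everything obtained from the vacuum.\<close>
  have "ev ?S' (lowered u) = (\<lambda>w. 0)" for u
    by (induction u) (simp_all add: e_word_vac serre_ev(2)[OF assms(1,2)] lin_zero[OF lin_f_op])
  then show "ev ?S' x = (\<lambda>w. 0)" by (intro lin_low_span_zero[OF lin_ev _ assms(3)])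
qed

lemma cartan_nat: "i \<noteq> j \<Longrightarrow> \<exists>n. of_nat n = 1 - rt (b j) (co (b i))"
proof -
  assume "i \<noteq> j"
  then have "ip (b j) (b i) \<le> 0" by (intro obtuse) auto
  then have "2 * ip (b j) (b i) / ip (b i) (b i) \<le> 0"
    using ip_pos[OF root_nonzero[OF good_root[OF good_b, of i]]] by (simp add: divide_nonpos_pos)
  moreover obtain k where k: "2 * ip (b j) (b i) / ip (b i) (b i) = of_int k"
    using root_cartan_int[OF good_root[OF good_b] good_root[OF good_b], of i j]
    by (auto simp: ip_commute[of "b j" "b i"] elim: Ints_cases)
  ultimately have "of_nat (nat (1 - k)) = 1 - rt (b j) (co (b i))" by (simp add: rt_co)
  then show ?thesis ..
qed

lemma model_cartan_lie:
  assumes "lie_quotient br q (agree irr)"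
  shows "cartan_lie free_scale br tscale (\<lambda>t. q (Cartan t)) g rt tv (range q) b (\<lambda>i. q (E i)) (\<lambda>i. q (F i))"
proof -
  interpret lie_quotient br q "agree irr" by (rule assms)
  interpret root_lie free_scale br tscale "\<lambda>t. q (Cartan t)" g rt tv "range q"
    by (rule model_root_lie[OF assms])
  note rel = model_relations[OF assms]
  have gen: "generates (\<lambda>i. q (E i)) (\<lambda>i. q (F i))"
    using range_subset unfolding generates_def by blast
  have serre: "nilp (q (F i)) (q (F j)) \<and> nilp (q (E i)) (q (E j))" for i j
  proof (cases "i = j")
    case True
    have "(br z ^^ 1) z = 0" for z by (simp add: br_self)
    then show ?thesis unfolding True nilp_def by blast
  next
    case False
    then obtain n where n: "of_nat n = 1 - rt (b j) (co (b i))" using cartan_nat by blast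
    have "q ((Bracket (F i) ^^ n) (F j)) = q Zero" "q ((Bracket (E i) ^^ n) (E j)) = q Zero"
      unfolding q_eq agree_def using serre_irr[OF False n] by auto
    then have "(br (q (F i)) ^^ n) (q (F j)) = 0" "(br (q (E i)) ^^ n) (q (E j)) = 0"
      by (simp_all add: q_bracket_pow q_Zero)
    then show ?thesis by (auto intro: nilpI)
  qed
  have nil: "(br z ^^ 1) y = 0 \<Longrightarrow> nilp z y" for z y by (rule nilpI)
  have ef: "nilp (q (E i)) (q (F j))" for i j
  proof (cases "i = j")
    case True
    then show ?thesis using nilp_opposite[OF rel(1) rel(3)] by simp
  qed (simp add: nil rel(4))
  have fe: "nilp (q (F i)) (q (E j))" for i j
  proof (cases "i = j")
    case True
    have "br (q (F i)) (q (E i)) = q (Cartan (- co (b i)))"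
      using rel(3)[of i] br_swap[of "q (F i)" "q (E i)"] T_minus[of "co (b i)"] by simp
    then show ?thesis using nilp_opposite[OF rel(2)] True by simp
  next
    case False
    then have "br (q (F i)) (q (E j)) = 0" using rel(4)[of j i] br_swap[of "q (F i)" "q (E j)"] by simp
    then show ?thesis by (intro nil) simp
  qed
  show ?thesis
  proof
    show "chevalley b (\<lambda>i. q (E i)) (\<lambda>i. q (F i))"
      unfolding chevalley_def using rel good_b by auto
    show "generates (\<lambda>i. q (E i)) (\<lambda>i. q (F i))" by (rule gen)
    show "nilp (q (E i)) x" if "x \<in> range q" for i x
      by (rule nil_from_generators[OF gen rel(1) _ _ that]) (use serre ef in auto)
    show "nilp (q (F i)) x" if "x \<in> range q" for i x
      by (rule nil_from_generators[OF gen rel(2) _ _ that]) (use serre fe in auto)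
    show "br (q (E i)) (q (F j)) = 0" if "i \<noteq> j" for i j using rel(4) that by blast
  qed
qed

text \<open>On the vacuum, \<open>Cartan t\<close> acts by the value of the highest weight at
  t.\<close>

lemma model_nontrivial:
  assumes "lie_quotient br q (agree irr)" "rt lam t \<noteq> 0"
  shows "q (Cartan t) \<noteq> 0"
proof
  interpret lie_quotient br q "agree irr" by (rule assms)
  assume "q (Cartan t) = 0"
  then have "agree irr (Cartan t) Zero" by (simp flip: q_Zero q_eq)
  moreover have "lowered [] \<in> irr" using low_span_base[of "[]" UNIV 1] by simp
  ultimately have "t_op t vac = (\<lambda>w. 0)" by (auto simp: agree_def)
  then have "t_op t vac [] = 0" by simp
  then show False using assms(2) by (simp add: t_op_def vac_def)
qed

end

section \<open>Braid moves of prime root systems\<close>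

locale pra_positive = pra_realization smul M h d \<alpha> form
  for smul :: "complex \<Rightarrow> 'h \<Rightarrow> 'h::ab_group_add" and M :: "int^'n^'n"
    and h :: "'n \<Rightarrow> 'h" and d \<alpha> form +
  assumes gim: "generalized_intersection_matrix M"
    and indec: "indecomposable M"
    and posdef: "\<exists>S :: real^'n^'n. diagonal_matrix S \<and> (\<forall>i. 0 < S $ i $ i) \<and>
           positive_definite (S ** map_matrix of_int M)"
begin

section \<open>The Gram matrix of the prime roots and the realization it gives\<close>

definition gram :: "'n \<Rightarrow> 'n \<Rightarrow> real" where
  "gram i j = Re (form (\<alpha> i) (\<alpha> j))"

lemma gram_diag: "0 < gram i i" "form (\<alpha> i) (\<alpha> i) = of_real (gram i i)"
  using form_normalized[of i] by (auto simp: gram_def less_complex_def complex_eq_iff)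

text \<open>The diagonal values are real by normalisation, and all others are integer multiples of
  halves of these; taking real parts in \<open>gram\<close> thus loses nothing.\<close>

lemma form_gram: "form (\<alpha> i) (\<alpha> j) = of_real (gram i j)" and gram_M: "2 * gram i j / gram i i = of_int (M $ i $ j)"
proof -
  have nz: "gram i i \<noteq> 0" using gram_diag(1)[of i] by simp
  have "2 * form (\<alpha> i) (\<alpha> j) = of_real (of_int (M $ i $ j) * gram i i)"
    using form_root[of i j] nz by (simp add: gram_diag(2) divide_eq_eq)
  then have "form (\<alpha> i) (\<alpha> j) = of_real (of_int (M $ i $ j) * gram i i / 2)" by (simp add: field_simps)
  note F = this
  have G: "gram i j = of_int (M $ i $ j) * gram i i / 2"
    unfolding gram_def[of i j] F by (rule Re_complex_of_real)
  show "form (\<alpha> i) (\<alpha> j) = of_real (gram i j)" unfolding F G ..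
  show "2 * gram i j / gram i i = of_int (M $ i $ j)" unfolding G using nz by simp
qed

lemma gram_sym: "gram i j = gram j i"
  using form root_dual unfolding gram_def nondegenerate_symmetric_form_def by metis

text \<open>The symmetriser is unique up to a factor because \<open>M\<close> is indecomposable, so the given form is
  positive definite as well.\<close>

lemma gram_pos:
  fixes v :: "real^'n"
  assumes "v \<noteq> 0"
  shows "0 < (\<Sum>i\<in>UNIV. \<Sum>j\<in>UNIV. v $ i * v $ j * gram i j)"
proof -
  obtain S :: "real^'n^'n" where S: "diagonal_matrix S" "\<And>i. 0 < S $ i $ i"
    and pd: "positive_definite (S ** map_matrix of_int M)"
    using posdef by blast
  let ?A = "S ** map_matrix of_int M :: real^'n^'n"
  have A: "?A $ i $ j = S $ i $ i * of_int (M $ i $ j)" for i j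
  proof -
    have "?A $ i $ j = (\<Sum>k\<in>UNIV. S $ i $ k * of_int (M $ k $ j))"
      by (simp add: matrix_matrix_mult_def map_matrix_def)
    also have "\<dots> = (\<Sum>k\<in>UNIV. if k = i then S $ i $ i * of_int (M $ i $ j) else 0)"
      by (rule sum.cong) (use S(1) in \<open>auto simp: diagonal_matrix_def\<close>)
    finally show ?thesis by simp
  qed
  have A_sym: "?A $ i $ j = ?A $ j $ i" for i j

  proof -
    have "transpose ?A = ?A" using pd unfolding positive_definite_def symmetric_matrix_def by blast
    then have "?A $ i $ j = transpose ?A $ i $ j" by (simp only:)
    also have "\<dots> = ?A $ j $ i" unfolding transpose_def by (simp only: vec_lambda_beta)
    finally show ?thesis .
  qed
  \<comment> \<open>The ratio of the two symmetrisers. Both symmetrised matrices are symmetric, so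
    \<open>r i = r j\<close> wherever the entry of \<open>M\<close> is nonzero.\<close>
  define r where "r i = gram i i / S $ i $ i" for i
  have gram: "gram i j = r i / 2 * ?A $ i $ j" for i j
    using gram_M[of i j] gram_diag(1)[of i] S(2)[of i] unfolding A r_def by (simp add: field_simps)
  have r_eq: "r i = r j" if "M $ i $ j \<noteq> 0" for i j
  proof -
    have "?A $ i $ j \<noteq> 0" using that S(2)[of i] by (simp add: A)
    moreover have "r i / 2 * ?A $ i $ j = r j / 2 * ?A $ i $ j"

    proof -
      have "r i / 2 * ?A $ i $ j = gram i j" by (rule gram[symmetric])
      also have "\<dots> = gram j i" by (rule gram_sym)
      also have "\<dots> = r j / 2 * ?A $ j $ i" by (rule gram)
      also have "?A $ j $ i = ?A $ i $ j" by (rule A_sym)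
      finally show ?thesis .
    qed
    ultimately show ?thesis by simp
  qed
  have const: "r i = r j" for i j
  proof (rule ccontr)
    assume "r i \<noteq> r j"
    let ?I = "{k. r k = r j}"
    have "i \<in> - ?I" "j \<in> ?I" using \<open>r i \<noteq> r j\<close> by auto
    moreover have "M $ k $ l = 0 \<and> M $ l $ k = 0" if "k \<in> ?I" "l \<in> - ?I" for k l
      using r_eq[of k l] r_eq[of l k] that by auto
    ultimately have "\<exists>I J. I \<noteq> {} \<and> J \<noteq> {} \<and> I \<inter> J = {} \<and> I \<union> J = UNIV \<and>
          (\<forall>i\<in>I. \<forall>j\<in>J. M $ i $ j = 0 \<and> M $ j $ i = 0)"
      by (intro exI[of _ ?I] exI[of _ "- ?I"]) auto
    then show False using indec unfolding indecomposable_def by blast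
  qed
  fix i0 :: 'n
  have "0 < v \<bullet> (?A *v v)" using pd assms by (auto simp: positive_definite_def)
  also have "v \<bullet> (?A *v v) = (\<Sum>i\<in>UNIV. \<Sum>j\<in>UNIV. v $ i * v $ j * ?A $ i $ j)"
    by (simp add: inner_vec_def matrix_vector_mult_def sum_distrib_left mult_ac)
  finally have pos: "0 < (\<Sum>i\<in>UNIV. \<Sum>j\<in>UNIV. v $ i * v $ j * ?A $ i $ j)" .
  have "v $ i * v $ j * gram i j = r i0 / 2 * (v $ i * v $ j * ?A $ i $ j)" for i j
    unfolding gram[of i j] const[of i i0] by (simp only: mult_ac)
  then have "(\<Sum>i\<in>UNIV. \<Sum>j\<in>UNIV. v $ i * v $ j * gram i j)
      = r i0 / 2 * (\<Sum>i\<in>UNIV. \<Sum>j\<in>UNIV. v $ i * v $ j * ?A $ i $ j)"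
    by (simp only: sum_distrib_left)
  also have "0 < \<dots>"
    using gram_diag(1)[of i0] S(2)[of i0] by (intro mult_pos_pos pos) (simp add: r_def)
  finally show ?thesis .
qed

definition rt :: "real^'n \<Rightarrow> 'h \<Rightarrow> complex" where
  "rt v t = (\<Sum>i\<in>UNIV. of_real (v $ i) * \<alpha> i t)"

definition tv :: "real^'n \<Rightarrow> 'h" where
  "tv v = (\<Sum>i\<in>UNIV. smul (of_real (v $ i * gram i i / 2)) (h i))"

lemma complex_kernel:
  fixes z :: "'n \<Rightarrow> complex"
  assumes "\<And>i. (\<Sum>j\<in>UNIV. of_real (gram i j) * z j) = 0"
  shows "z j = 0"
proof -
  have zero: "u = 0" if "\<And>i. (\<Sum>j\<in>UNIV. gram i j * u $ j) = 0" for u :: "real^'n"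
  proof (rule ccontr)
    assume "u \<noteq> 0"
    then have "0 < (\<Sum>i\<in>UNIV. \<Sum>j\<in>UNIV. u $ i * u $ j * gram i j)" by (rule gram_pos)
    also have "\<dots> = (\<Sum>i\<in>UNIV. u $ i * (\<Sum>j\<in>UNIV. gram i j * u $ j))"
      by (simp add: sum_distrib_left mult_ac)
    also have "\<dots> = 0" by (simp add: that)
    finally show False by simp
  qed
  have "(\<Sum>j\<in>UNIV. gram i j * Re (z j)) = Re (\<Sum>j\<in>UNIV. of_real (gram i j) * z j)"
    "(\<Sum>j\<in>UNIV. gram i j * Im (z j)) = Im (\<Sum>j\<in>UNIV. of_real (gram i j) * z j)" for i
    by simp_all
  then have "(\<chi> j. Re (z j)) = 0" "(\<chi> j. Im (z j)) = 0"
    using assms by (auto intro!: zero)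
  then show ?thesis by (simp add: vec_eq_iff complex_eq_iff)
qed

text \<open>A positive definite Gram matrix is nonsingular, over the complex numbers too. The Cartan
  space therefore has no basis vectors \<open>d\<close> and is spanned by the
  \<open>h i\<close>.\<close>

lemma corank_zero: "corank M = 0"
proof -
  let ?A = "map_matrix of_int M :: complex^'n^'n"
  have "\<forall>x. ?A *v x = 0 \<longrightarrow> x = 0"
  proof (intro allI impI)
    fix x assume x: "?A *v x = 0"
    have "(\<Sum>j\<in>UNIV. of_real (gram i j) * x $ j) = 0" for i
    proof -
      have "gram i j = gram i i / 2 * of_int (M $ i $ j)" for j
        using gram_M[of i j] gram_diag(1)[of i] by (simp add: field_simps)
      then have c: "complex_of_real (gram i j) = of_real (gram i i / 2) * of_int (M $ i $ j)" for j
        by (metis of_real_mult of_real_of_int_eq)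
      have "(\<Sum>j\<in>UNIV. of_real (gram i j) * x $ j) = of_real (gram i i / 2) * (\<Sum>j\<in>UNIV. of_int (M $ i $ j) * x $ j)"
        unfolding c sum_distrib_left mult.assoc ..
      also have "(\<Sum>j\<in>UNIV. of_int (M $ i $ j) * x $ j) = (?A *v x) $ i"
        by (simp add: matrix_vector_mult_def map_matrix_def)
      finally show ?thesis using x by simp
    qed
    then have "x $ j = 0" for j by (rule complex_kernel)
    then show "x = 0" by (simp add: vec_eq_iff)
  qed
  then have "vec.span (rows ?A) = UNIV"
    using matrix_left_invertible_ker[of ?A] matrix_left_invertible_span_rows_gen[of ?A] by blast
  then have "vec.dim (rows ?A) = CARD('n)"
    using vec.dim_span[of "rows ?A"] vec_dim_card[where ?'a = complex and ?'n = 'n] by metis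
  then show ?thesis by (simp add: corank_def row_rank_def_gen)
qed

lemma span_h: "span (range h) = UNIV"
proof -
  have "(UNIV :: 'n set) <+> {..<corank M} = range Inl" by (auto simp: corank_zero)
  then have "case_sum h d ` (UNIV <+> {..<corank M}) = range h"
    by (simp add: image_image)
  then show ?thesis using basis_span by simp
qed

lemma \<alpha>_linear: "\<alpha> i (s + t) = \<alpha> i s + \<alpha> i t" "\<alpha> i (smul c t) = c * \<alpha> i t"
proof -
  interpret l: Vector_Spaces.linear smul "(*)" "\<alpha> i" using root_dual[of i] by (simp add: dual_space_def)
  show "\<alpha> i (s + t) = \<alpha> i s + \<alpha> i t" "\<alpha> i (smul c t) = c * \<alpha> i t" by (rule l.add, rule l.scale)
qed

lemma \<alpha>_zero: "\<alpha> i 0 = 0"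
  using \<alpha>_linear(2)[of i 0 0] by simp

lemma \<alpha>_sum: "\<alpha> i (sum x A) = (\<Sum>j\<in>A. \<alpha> i (x j))"
  by (induction A rule: infinite_finite_induct) (auto simp: \<alpha>_linear \<alpha>_zero)

lemma gram_h: "gram j j / 2 * of_int (M $ j $ i) = gram i j"
  using gram_M[of j i] gram_diag(1)[of j] gram_sym[of i j] by (simp add: field_simps)

lemma rt_axis: "rt (axis i 1) = \<alpha> i"
proof
  fix t
  have "rt (axis i 1) t = (\<Sum>k\<in>UNIV. if k = i then \<alpha> i t else 0)"
    unfolding rt_def by (intro sum.cong) (auto simp: axis_def)
  then show "rt (axis i 1) t = \<alpha> i t" by simp
qed

lemma tv_axis: "tv (axis i 1) = smul (of_real (gram i i / 2)) (h i)"
proof -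
  have "tv (axis i 1) = (\<Sum>k\<in>UNIV. if k = i then smul (of_real (gram i i / 2)) (h i) else 0)"
    unfolding tv_def by (intro sum.cong) (auto simp: axis_def)
  then show ?thesis by simp
qed

sublocale realization smul gram rt tv
proof
  fix u v :: "real^'n" and r :: real and s t :: 'h and c :: complex
  show "rt (u + v) t = rt u t + rt v t"
    by (simp add: rt_def algebra_simps sum.distrib)
  show "rt (r *\<^sub>R v) t = of_real r * rt v t"
    by (simp add: rt_def sum_distrib_left mult.assoc)
  show "rt v (s + t) = rt v s + rt v t"
    by (simp add: rt_def \<alpha>_linear algebra_simps sum.distrib)
  show "rt v (smul c t) = c * rt v t"
    by (simp add: rt_def \<alpha>_linear sum_distrib_left mult_ac)
  show "tv (u + v) = tv u + tv v"
    by (simp add: tv_def algebra_simps add_divide_distrib scale_left_distrib sum.distrib)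
  show "tv (r *\<^sub>R v) = smul (of_real r) (tv v)"
    by (simp add: tv_def scale_sum_right mult.assoc)
  show "u = v" if "rt u = rt v"
  proof -
    have "of_real (u $ i - v $ i) = (0 :: complex)" for i
    proof (rule roots_independent[where c = "\<lambda>i. of_real (u $ i - v $ i)"])
      fix x
      have "(\<Sum>i\<in>UNIV. of_real (u $ i - v $ i) * \<alpha> i x) = rt u x - rt v x"
        by (simp add: rt_def algebra_simps sum_subtractf)
      then show "(\<Sum>i\<in>UNIV. of_real (u $ i - v $ i) * \<alpha> i x) = 0" using that by simp
    qed
    then show ?thesis by (simp add: vec_eq_iff flip: of_real_diff)
  qed
  show "gram i j = gram j i" for i j by (rule gram_sym)
  show "0 < (\<Sum>i\<in>UNIV. \<Sum>j\<in>UNIV. v $ i * v $ j * gram i j)" if "v \<noteq> 0" using that by (rule gram_pos)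
  show "2 * gram i j / gram i i \<in> \<int>" for i j by (simp add: gram_M)
  show "span (range (\<lambda>i. tv (axis i 1))) = UNIV"
  proof -
    have "h i \<in> span (range (\<lambda>i. tv (axis i 1)))" for i
    proof -
      have "smul (of_real (2 / gram i i)) (tv (axis i 1)) \<in> span (range (\<lambda>i. tv (axis i 1)))"
        by (intro span_scale span_base) auto
      then show ?thesis using gram_diag(1)[of i] by (simp add: tv_axis flip: of_real_mult)
    qed
    then have "span (range h) \<subseteq> span (range (\<lambda>i. tv (axis i 1)))"
      by (intro span_minimal subspace_span) auto
    then show ?thesis by (simp add: span_h top.extremum_unique)
  qed
  show "t = 0" if "\<And>i. rt (axis i 1) t = 0"
  proof -
    have "\<exists>c. t = (\<Sum>i\<in>UNIV. smul (c i) (h i))"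
    proof -
      have "t \<in> span (range h)" by (simp add: span_h)
      then show ?thesis
      proof (induction rule: span_induct_alt)
        case base
        show ?case by (intro exI[of _ "\<lambda>i. 0"]) simp
      next
        case (step a x y)
        then obtain j c where x: "x = h j" and y: "y = (\<Sum>i\<in>UNIV. smul (c i) (h i))" by auto
        have "(\<Sum>i\<in>UNIV. smul ((c(j := c j + a)) i) (h i)) = (\<Sum>i\<in>UNIV. smul (c i) (h i) + (if i = j then smul a (h j) else 0))"
          by (intro sum.cong) (auto simp: scale_left_distrib)
        then have "smul a x + y = (\<Sum>i\<in>UNIV. smul ((c(j := c j + a)) i) (h i))"
          by (simp add: sum.distrib x y)
        then show ?case by (rule exI[of _ "c(j := c j + a)"])
      qed
    qed
    then obtain c where c: "t = (\<Sum>i\<in>UNIV. smul (c i) (h i))" ..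
    \<comment> \<open>Rescaling the coefficients from coroots to roots turns \<open>M\<close> into
      the symmetric Gram matrix, whose kernel is trivial.\<close>
    have "(\<Sum>j\<in>UNIV. of_real (gram i j) * (2 * c j / of_real (gram j j))) = 0" for i
    proof -
      have "(\<Sum>j\<in>UNIV. of_real (gram i j) * (2 * c j / of_real (gram j j))) = (\<Sum>j\<in>UNIV. c j * of_int (M $ j $ i))"
      proof (rule sum.cong)
        fix j
        have "complex_of_real (gram j j / 2 * of_int (M $ j $ i)) = of_real (gram i j)" by (simp only: gram_h)
        then have G: "of_real (gram i j) = of_real (gram j j) / 2 * (of_int (M $ j $ i) :: complex)" by simp
        show "of_real (gram i j) * (2 * c j / of_real (gram j j)) = c j * of_int (M $ j $ i)"
          unfolding G using gram_diag(1)[of j] by (simp add: field_simps)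
      qed simp
      also have "\<dots> = \<alpha> i t" by (simp add: c \<alpha>_sum \<alpha>_linear root_coroot)
      finally show ?thesis using that by (simp add: rt_axis)
    qed
    then have "2 * c j / of_real (gram j j) = 0" for j by (rule complex_kernel)
    then have "c j = 0" for j using gram_diag(1)[of j] by (metis divide_eq_0_iff less_irrefl mult_eq_0_iff of_real_eq_0_iff zero_neq_numeral)
    then show ?thesis by (simp add: c)
  qed
  interpret iform: integral_form gram
    by standard (rule gram_sym, erule gram_pos, simp add: gram_M)
  show "rt u (tv v) = of_real (iform.ip u v)"
  proof -
    have "\<alpha> i (tv v) = (\<Sum>j\<in>UNIV. of_real (v $ j * (gram j j / 2 * of_int (M $ j $ i))))" for i
      unfolding tv_def \<alpha>_sum by (simp add: \<alpha>_linear root_coroot mult.assoc)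
    then have "\<alpha> i (tv v) = (\<Sum>j\<in>UNIV. of_real (v $ j * gram i j))" for i
      by (simp only: gram_h)
    then have "rt u (tv v) = (\<Sum>i\<in>UNIV. \<Sum>j\<in>UNIV. of_real (u $ i * v $ j * gram i j))"
      by (simp add: rt_def sum_distrib_left mult.assoc)
    then show ?thesis by (simp add: iform.ip_def)
  qed
qed

lemma co_axis: "co (axis i 1) = h i"
  using gram_diag(1)[of i] by (simp add: co_def ip_axis tv_axis flip: of_real_mult)

lemma rt_dual: "rt v \<in> dual_space smul"
proof -
  have "Vector_Spaces.linear smul (*) (rt v)"
    unfolding Vector_Spaces.linear_iff
    using vector_space_axioms vector_space_over_itself.vector_space_axioms rt_plus rt_tscale by blast
  then show ?thesis by (simp add: dual_space_def)
qed

lemma form_rt: "form (rt u) (rt v) = of_real (ip u v)"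
proof -
  have f: "\<forall>\<phi>\<in>dual_space smul. \<forall>\<psi>\<in>dual_space smul. form \<phi> \<psi> = form \<psi> \<phi>"
    "\<forall>\<phi>\<in>dual_space smul. \<forall>\<psi>\<in>dual_space smul. \<forall>\<xi>\<in>dual_space smul.
        form (\<lambda>x. \<phi> x + \<psi> x) \<xi> = form \<phi> \<xi> + form \<psi> \<xi>"
    "\<forall>c. \<forall>\<phi>\<in>dual_space smul. \<forall>\<psi>\<in>dual_space smul. form (\<lambda>x. c * \<phi> x) \<psi> = c * form \<phi> \<psi>"
    using form unfolding nondegenerate_symmetric_form_def by blast+
  have sum: "form (rt u) \<psi> = (\<Sum>i\<in>UNIV. of_real (u $ i) * form (\<alpha> i) \<psi>)" if \<psi>: "\<psi> \<in> dual_space smul" for u \<psi>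
  proof -
    have add: "form (rt (v + w)) \<psi> = form (rt v) \<psi> + form (rt w) \<psi>" for v w
    proof -
      have "rt (v + w) = (\<lambda>t. rt v t + rt w t)" by (rule ext) (rule rt_add)
      then show ?thesis using f(2)[rule_format, OF rt_dual rt_dual \<psi>] by simp
    qed
    have scale: "form (rt (r *\<^sub>R v)) \<psi> = of_real r * form (rt v) \<psi>" for r v
    proof -
      have "rt (r *\<^sub>R v) = (\<lambda>t. of_real r * rt v t)" by (rule ext) (rule rt_scale)
      then show ?thesis using f(3)[rule_format, OF rt_dual \<psi>] by simp
    qed
    have "form (rt (\<Sum>i\<in>A. u $ i *\<^sub>R axis i 1)) \<psi> = (\<Sum>i\<in>A. of_real (u $ i) * form (\<alpha> i) \<psi>)" for A
    proof (induction A rule: infinite_finite_induct)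
      case empty
      show ?case using scale[of 0 0] by (simp only: sum.empty scaleR_zero_left of_real_0 mult_zero_left)
    next
      case (insert i A)
      then show ?case by (simp add: add scale rt_axis)
    qed simp
    from this[of UNIV] show ?thesis by (simp add: basis_expansion flip: scalar_mult_eq_scaleR)
  qed
  have "form (\<alpha> i) (rt v) = (\<Sum>j\<in>UNIV. of_real (v $ j) * of_real (gram i j))" for i
  proof -
    have "form (\<alpha> i) (rt v) = form (rt v) (\<alpha> i)" by (rule f(1)[rule_format, OF root_dual rt_dual])
    then show ?thesis by (simp add: sum[OF root_dual] form_gram gram_sym[of _ i])
  qed
  then show ?thesis by (simp add: sum[OF rt_dual] ip_def sum_distrib_left mult_ac)
qed

section \<open>Braid equivalence of sets and moves of indexed bases\<close>

lemma reflection_rt: "reflection form (rt a) (rt v) = rt (refl a v)"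
  by (simp add: reflection_def form_rt refl_def rt_diff rt_scale fun_eq_iff)

lemma good_inj_on: "good b \<Longrightarrow> inj (\<lambda>i. rt (b i))"
proof (rule injI)
  fix i j assume b: "good b" and "rt (b i) = rt (b j)"
  then have "1 *\<^sub>R b i = 1 *\<^sub>R b j" using rt_inj by simp
  then have "((\<lambda>k. 0)(i := 1)) = ((\<lambda>k. 0)(j := 1 :: real))"
    unfolding comb_single[symmetric] by (rule good_inj[OF b])
  then have "((\<lambda>k. 0)(i := 1)) i = ((\<lambda>k. 0)(j := 1 :: real)) i" by (rule fun_cong)
  then show "i = j" by (simp split: if_splits)
qed

text \<open>A braid move removes an element from a set, whereas \<open>step\<close> updates one
  index; the two agree because a \<open>good\<close> family has no repetitions.\<close>

lemma braid_step_range: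
  assumes "good b"
  shows "range (\<lambda>k. rt ((b(j := refl (b i) (b j))) k))
    = (range (\<lambda>k. rt (b k)) - {rt (b j)}) \<union> {reflection form (rt (b i)) (rt (b j))}"
  using good_inj_on[OF assms] by (auto simp: reflection_rt image_iff inj_def split: if_splits)

lemma steps_braid: "steps std b \<Longrightarrow> braid_equivalent form (range \<alpha>) (range (\<lambda>k. rt (b k)))"
proof (induction rule: rtranclp_induct)
  case base
  then show ?case by (simp add: rt_axis braid_equivalent_def)
next
  case (step b b')
  have good: "good b" using good_steps[OF step(1) good_std] .
  obtain i j where "b' = b(j := refl (b i) (b j))" using step(2) by (auto simp: step_def)
  then have "braid_step form (range (\<lambda>k. rt (b k))) (range (\<lambda>k. rt (b' k)))"
    unfolding braid_step_def using braid_step_range[OF good, of j i] by blast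
  then show ?case using step(3) by (simp add: braid_equivalent_def rtranclp.rtrancl_into_rtrancl)
qed

lemma braid_steps:
  assumes "braid_equivalent form (range \<alpha>) B"
  shows "\<exists>b. steps std b \<and> B = range (\<lambda>k. rt (b k))"
  using assms unfolding braid_equivalent_def
proof (induction rule: rtranclp_induct)
  case base
  show ?case by (intro exI[of _ std]) (simp add: rt_axis)
next
  case (step P Q)
  then obtain b where b: "steps std b" "P = range (\<lambda>k. rt (b k))" by blast
  have good: "good b" using good_steps[OF b(1) good_std] .
  from step(2) b(2) obtain i j where
    "Q = (P - {rt (b j)}) \<union> {reflection form (rt (b i)) (rt (b j))}" unfolding braid_step_def by blast
  then have "Q = range (\<lambda>k. rt ((b(j := refl (b i) (b j))) k))"
    unfolding b(2) braid_step_range[OF good] .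
  moreover have "step b (b(j := refl (b i) (b j)))" unfolding step_def by blast
  then have "steps std (b(j := refl (b i) (b j)))" using b(1) by simp
  ultimately show ?case by blast
qed

text \<open>An orthogonal splitting of this base could be carried back along the reversed moves to
  the prime root system, where it would decompose \<open>M\<close>.\<close>

lemma connected_base:
  assumes "steps std b" "A \<noteq> {}" "A \<noteq> UNIV"
  shows "\<exists>i\<in>A. \<exists>j\<in>-A. ip (b i) (b j) \<noteq> 0"
proof (rule ccontr)
  assume "\<not> ?thesis"
  then have split: "ip (axis i 1) (axis j 1) = 0" if "i \<in> A" "j \<notin> A" for i j
    using split_steps[OF steps_sym[OF assms(1)], of A i j] that by auto
  have "M $ i $ j = 0 \<and> M $ j $ i = 0" if "i \<in> A" "j \<in> - A" for i j
  proof -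
    have "gram i j = 0" using split[of i j] that by (simp add: ip_axis)
    then show ?thesis using gram_M[of i j] gram_M[of j i] gram_sym[of i j] by simp
  qed
  moreover have "- A \<noteq> {}" using assms(3) by auto
  ultimately have "\<exists>I J. I \<noteq> {} \<and> J \<noteq> {} \<and> I \<inter> J = {} \<and> I \<union> J = UNIV \<and>
          (\<forall>i\<in>I. \<forall>j\<in>J. M $ i $ j = 0 \<and> M $ j $ i = 0)"
    using assms(2) by (intro exI[of _ A] exI[of _ "- A"]) auto
  then show False using indec unfolding indecomposable_def by blast
qed

end

section \<open>Structure of the partial reflection algebra\<close>

context pra_positive
begin

abbreviation R :: "('h, 'n) lie_term \<Rightarrow> ('h, 'n) lie_term \<Rightarrow> bool" where
  "R \<equiv> pra_cong smul h \<alpha> form"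

lemma lie_eq_pra: "lie_eq s t \<Longrightarrow> R s t"
  by (induction rule: lie_eq.induct) (blast intro: pra_cong.intros)+

lemma pra_congruence: "lie_congruence R"
  by standard (rule lie_eq_pra pra_cong.sym pra_cong.trans pra_cong.plus_cong pra_cong.scale_cong
      pra_cong.bracket_cong; assumption)+

lemma minus_rt: "- rt v = rt (- v)"
  by (simp add: fun_eq_iff rt_minus)

lemma base_vector:
  assumes "steps std b"
  shows "good b" "0 < ip (b i) (b i)"
  using good_steps[OF assms good_std] ip_pos[OF root_nonzero[OF good_root]] by auto

end

section \<open>Evaluation of terms in the model\<close>

primrec interp :: "(complex \<Rightarrow> 'a \<Rightarrow> 'a::ab_group_add) \<Rightarrow> ('a \<Rightarrow> 'a \<Rightarrow> 'a) \<Rightarrow> ('h \<Rightarrow> 'a) \<Rightarrow> ('n \<Rightarrow> 'a) \<Rightarrow> ('n \<Rightarrow> 'a) \<Rightarrow>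
    ('h, 'n) lie_term \<Rightarrow> 'a" where
  "interp sc br T e f (Cartan t) = T t"
| "interp sc br T e f (E i) = e i"
| "interp sc br T e f (F i) = f i"
| "interp sc br T e f Zero = 0"
| "interp sc br T e f (Plus s t) = interp sc br T e f s + interp sc br T e f t"
| "interp sc br T e f (Scale c s) = sc c (interp sc br T e f s)"
| "interp sc br T e f (Bracket s t) = br (interp sc br T e f s) (interp sc br T e f t)"

lemma interp_bracket_pow:
  "interp sc br T e f ((Bracket s ^^ k) t) = (br (interp sc br T e f s) ^^ k) (interp sc br T e f t)"
  by (induction k) auto

context pra_positive
begin

text \<open>Each relation concerns a weight \<open>b j + r b i\<close> one step beyond the end of a
  root string. With m the Cartan integer, r is 1 - m, -1, -(1 + m) or 1, and for distinct indices
  the vector is longer than \<open>b j\<close>, which \<open>non_root\<close> excludes. The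
  relations also allow \<open>\<alpha>' = \<beta>\<close>; then m = 2 and the weight is plus or
  minus twice \<open>b j\<close>.\<close>

lemma forbidden_weights:
  assumes "braid_equivalent form (range \<alpha>) B" "\<alpha>' \<in> B" "\<beta> \<in> B"
  obtains u v where "\<alpha>' = rt u" "\<beta> = rt v"
    "\<And>k. form \<alpha>' \<beta> < 0 \<Longrightarrow> of_nat k = 1 - 2 * form \<alpha>' \<beta> / form \<alpha>' \<alpha>' \<Longrightarrow> v + real k *\<^sub>R u \<notin> insert 0 roots"
    "form \<alpha>' \<beta> < 0 \<or> form \<alpha>' \<beta> = 0 \<Longrightarrow> v + - u \<notin> insert 0 roots"
    "\<And>k. form \<alpha>' \<beta> > 0 \<Longrightarrow> of_nat k = 1 + 2 * form \<alpha>' \<beta> / form \<alpha>' \<alpha>' \<Longrightarrow> v + real k *\<^sub>R - u \<notin> insert 0 roots"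
    "form \<alpha>' \<beta> > 0 \<or> form \<alpha>' \<beta> = 0 \<Longrightarrow> v + u \<notin> insert 0 roots"
proof -
  obtain b i j where b: "good b" "\<alpha>' = rt (b i)" "\<beta> = rt (b j)" "0 < ip (b i) (b i)"
    using braid_steps[OF assms(1)] assms(2,3) base_vector by blast
  define m where "m = 2 * ip (b i) (b j) / ip (b i) (b i)"
  have ip: "2 * ip (b i) (b j) = m * ip (b i) (b i)" using b(4) by (simp add: m_def)
  have sign: "form \<alpha>' \<beta> < 0 \<longleftrightarrow> m < 0" "form \<alpha>' \<beta> > 0 \<longleftrightarrow> m > 0" "form \<alpha>' \<beta> = 0 \<longleftrightarrow> m = 0"
    using b(4) unfolding b(2,3) form_rt m_def
    by (auto simp: less_complex_def divide_less_0_iff zero_less_divide_iff)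
  have quot: "2 * form \<alpha>' \<beta> / form \<alpha>' \<alpha>' = of_real m" by (simp add: b form_rt m_def)
  have pow: "real k = 1 - m" if "of_nat k = 1 - 2 * form \<alpha>' \<beta> / form \<alpha>' \<alpha>'" for k
    using that unfolding quot by (simp add: complex_eq_iff)
  have pow': "real k = 1 + m" if "of_nat k = 1 + 2 * form \<alpha>' \<beta> / form \<alpha>' \<alpha>'" for k
    using that unfolding quot by (simp add: complex_eq_iff)
  have m2: "m = 2" if "i = j" using ip b(4) that by auto
  have far: "b j + r *\<^sub>R b i \<notin> insert 0 roots" if "i \<noteq> j" "0 < r * (m + r)" for r
  proof (rule non_root[OF b(1) that(1)])
    have "r * (2 * ip (b i) (b j)) + r\<^sup>2 * ip (b i) (b i) = (r * (m + r)) * ip (b i) (b i)"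
      unfolding ip by (simp add: algebra_simps power2_eq_square)
    then show "0 < r * (2 * ip (b i) (b j)) + r\<^sup>2 * ip (b i) (b i)" using that(2) b(4) by simp
  qed
  have twice: "2 *\<^sub>R b j \<notin> insert 0 roots" "- (2 *\<^sub>R b j) \<notin> insert 0 roots"
    using twice_non_root[OF b(1), of j] minus_root[of "- (2 *\<^sub>R b j)"] by auto
  show thesis
  proof (rule that[OF b(2,3)])
    fix k
    show "b j + real k *\<^sub>R b i \<notin> insert 0 roots" if "form \<alpha>' \<beta> < 0" "of_nat k = 1 - 2 * form \<alpha>' \<beta> / form \<alpha>' \<alpha>'"
      using that m2 pow sign by (intro far) auto
    show "b j + real k *\<^sub>R - b i \<notin> insert 0 roots" if "form \<alpha>' \<beta> > 0" "of_nat k = 1 + 2 * form \<alpha>' \<beta> / form \<alpha>' \<alpha>'"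
    proof (cases "i = j")
      case True
      then have "b j + real k *\<^sub>R - b i = (1 - real k) *\<^sub>R b j" by (simp add: scaleR_left_diff_distrib)
      then show ?thesis using twice pow'[OF that(2)] m2[OF True] by simp
    next
      case False
      have "b j + (- real k) *\<^sub>R b i \<notin> insert 0 roots"
        using pow'[OF that(2)] that(1) sign by (intro far False) simp
      then show ?thesis by simp
    qed
  next
    show "b j + - b i \<notin> insert 0 roots" if "form \<alpha>' \<beta> < 0 \<or> form \<alpha>' \<beta> = 0"
    proof -
      have "m \<le> 0" using that unfolding sign by auto
      then have "b j + (-1) *\<^sub>R b i \<notin> insert 0 roots" using m2 by (intro far) auto
      then show ?thesis by simp
    qed
    show "b j + b i \<notin> insert 0 roots" if "form \<alpha>' \<beta> > 0 \<or> form \<alpha>' \<beta> = 0"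
    proof -
      have "0 \<le> m" using that unfolding sign by auto
      then show ?thesis using far[of 1] twice by (cases "i = j") (simp_all add: scaleR_2)
    qed
  qed
qed

text \<open>All weights of the model are roots, and each of the relations for weight vectors asserts that
  an element vanishes whose weight is neither a root nor zero.\<close>

lemma interp_respects:
  assumes cartan: "cartan_lie sc br smul T gram rt tv G b e f"
    and ch: "root_lie.chevalley sc br smul T gram rt tv G std e' f'"
    and st: "R s t"
  shows "interp sc br T e' f' s = interp sc br T e' f' t"
proof -
  interpret C: cartan_lie sc br smul T gram rt tv G b e f by (rule cartan)
  let ?I = "interp sc br T e' f'"
  have c: "e' i \<in> G" "f' i \<in> G" "C.wt (\<alpha> i) (e' i)" "C.wt (rt (- axis i 1)) (f' i)" "br (e' i) (f' i) = T (h i)" for i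
    using ch by (auto simp: C.chevalley_def rt_axis co_axis)
  have mem: "?I s \<in> G" for s
    using C.G(1) c(1,2) C.T_in_G
    by (induction s) (auto simp: C.subalg_def C.subspace_0 C.subspace_add C.subspace_scale)
  have vanish: "x = 0" if "x \<in> G" "C.wt (rt v) x" "v \<notin> insert 0 roots" for x v
    using C.weight_is_root[OF that(1) _ that(2)] that(3) rt_inj by blast
  \<comment> \<open>The rules have premises about weight vectors of the congruence itself. Rule
    induction supplies these equations together with the equality of their interpretations, and the
    latter makes the interpreted term a weight vector of the model.\<close>
  have wv: "C.wt \<phi> (?I x)" if "weight_vector (\<lambda>s t. R s t \<and> ?I s = ?I t) \<phi> x" for \<phi> x
    using that by (simp add: weight_vector_def C.wt_def)
  have bracket_mem: "(br (?I s) ^^ k) (?I t) \<in> G" for s t k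
    using mem[of "(Bracket s ^^ k) t"] by (simp add: interp_bracket_pow)
  have vanish_pow: "(br (?I x) ^^ k) (?I y) = 0"
    if "C.wt (rt u) (?I x)" "C.wt (rt v) (?I y)" "v + real k *\<^sub>R u \<notin> insert 0 roots" for u v x y k
  proof (rule vanish[OF bracket_mem _ that(3)])
    show "C.wt (rt (v + real k *\<^sub>R u)) ((br (?I x) ^^ k) (?I y))"
      using C.wt_br_pow[OF that(1,2), of k] by (simp add: C.wt_def rt_add rt_scale add.commute)
  qed
  have vanish_br: "br (?I x) (?I y) = 0"
    if "C.wt (rt u) (?I x)" "C.wt (rt v) (?I y)" "v + u \<notin> insert 0 roots" for u v x y
    using vanish_pow[OF that(1,2), of 1] that(3) by simp
  show ?thesis
    using st
  proof (induction rule: pra_cong.induct)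
    case (negative_ad B \<alpha>' \<beta> k x y)
    obtain u v where w: "\<alpha>' = rt u" "\<beta> = rt v" "v + real k *\<^sub>R u \<notin> insert 0 roots"
      using forbidden_weights[OF negative_ad(1-3)] negative_ad by metis
    then have "(br (?I x) ^^ k) (?I y) = 0"
      using negative_ad wv by (intro vanish_pow[of u _ v]) (auto simp: minus_rt)
    then show ?case by (simp add: interp_bracket_pow)
  next
    case (negative_bracket B \<alpha>' \<beta> z y)
    obtain u v where w: "\<alpha>' = rt u" "\<beta> = rt v" "v + - u \<notin> insert 0 roots"
      using forbidden_weights[OF negative_bracket(1-3)] negative_bracket by metis
    then have "br (?I z) (?I y) = 0"
      using negative_bracket wv by (intro vanish_br[of "- u" _ v]) (auto simp: minus_rt)
    then show ?case by (simp add: interp_bracket_pow)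
  next
    case (positive_ad B \<alpha>' \<beta> k z y)
    obtain u v where w: "\<alpha>' = rt u" "\<beta> = rt v" "v + real k *\<^sub>R - u \<notin> insert 0 roots"
      using forbidden_weights[OF positive_ad(1-3)] positive_ad by metis
    then have "(br (?I z) ^^ k) (?I y) = 0"
      using positive_ad wv by (intro vanish_pow[of "- u" _ v]) (auto simp: minus_rt)
    then show ?case by (simp add: interp_bracket_pow)
  next
    case (positive_bracket B \<alpha>' \<beta> x y)
    obtain u v where w: "\<alpha>' = rt u" "\<beta> = rt v" "v + u \<notin> insert 0 roots"
      using forbidden_weights[OF positive_bracket(1-3)] positive_bracket by metis
    then have "br (?I x) (?I y) = 0"
      using positive_bracket wv by (intro vanish_br[of u _ v]) (auto simp: minus_rt)
    then show ?case by (simp add: interp_bracket_pow)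
  next
    case (orthogonal_bracket B \<alpha>' \<beta> x y)
    obtain u v where w: "\<alpha>' = rt u" "\<beta> = rt v" "v + u \<notin> insert 0 roots"
      using forbidden_weights[OF orthogonal_bracket(1-3)] orthogonal_bracket by metis
    then have "br (?I x) (?I y) = 0"
      using orthogonal_bracket wv by (intro vanish_br[of u _ v]) (auto simp: minus_rt)
    then show ?case by (simp add: interp_bracket_pow)
  next
    case (orthogonal_bracket_opposite B \<alpha>' \<beta> z y)
    obtain u v where w: "\<alpha>' = rt u" "\<beta> = rt v" "v + - u \<notin> insert 0 roots"
      using forbidden_weights[OF orthogonal_bracket_opposite(1-3)] orthogonal_bracket_opposite by metis
    then have "br (?I z) (?I y) = 0"
      using orthogonal_bracket_opposite wv by (intro vanish_br[of "- u" _ v]) (auto simp: minus_rt)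
    then show ?case by (simp add: interp_bracket_pow)
  qed (simp_all add: add_ac c c(3,4)[unfolded C.wt_def] rt_minus rt_axis C.scale_left_distrib C.scale_right_distrib
      C.br_add_left C.br_add_right C.br_scale_left C.br_scale_right C.br_self C.br_jacobi[unfolded add.assoc] C.T_add C.T_scale C.T_comm)
qed

text \<open>The model comes with generators for the base of Cartan type, whereas terms are built
  from generators for the prime roots. Since braid moves are reversible, Chevalley generators are
  carried back to \<open>std\<close> inside the model before terms are evaluated.\<close>

lemma pra_nontrivial: "\<not> R (Cartan (h i)) Zero"
proof
  assume R: "R (Cartan (h i)) Zero"
  obtain b where b: "steps std b" "\<And>i j. i \<noteq> j \<Longrightarrow> ip (b i) (b j) \<le> 0"
    using cartan_base_exists by blast
  \<comment> \<open>The highest weight \<open>axis i 1\<close> takes the value 2 on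
    \<open>h i\<close>, so \<open>h i\<close> acts nontrivially on the vacuum.\<close>
  interpret V: dual_verma smul gram rt tv b "axis i 1"
    by standard (use b base_vector in auto)
  obtain br q where q: "lie_quotient br q (V.agree V.irr)"
    using lie_quotient_exists[OF V.agree_congruence[OF V.ev_irr]] by blast
  let ?T = "\<lambda>t. q (Cartan t)"
  have cartan: "cartan_lie free_scale br smul ?T gram rt tv (range q) b (\<lambda>i. q (E i)) (\<lambda>i. q (F i))"
    by (rule V.model_cartan_lie[OF q])
  interpret C: cartan_lie free_scale br smul ?T gram rt tv "range q" b "\<lambda>i. q (E i)" "\<lambda>i. q (F i)"
    by (rule cartan)
  have "\<exists>e f. C.chevalley c e f" if "steps b c" for c
    using that
  proof (induction rule: rtranclp_induct)
    case base
    show ?case using C.ch by blast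
  next
    case (step c c')
    then obtain e f where ch: "C.chevalley c e f" by blast
    have "C.nilp (e i) x \<and> C.nilp (f i) x" if "x \<in> range q" for i x
    proof -
      have "good c" using ch by (simp add: C.chevalley_def)
      then have "c i \<noteq> 0" "- c i \<noteq> 0" using root_nonzero[OF good_root[of c i]] by auto
      moreover have "e i \<in> range q" "f i \<in> range q" "C.wt (rt (c i)) (e i)" "C.wt (rt (- c i)) (f i)"
        using ch by (auto simp: C.chevalley_def)
      ultimately show ?thesis using C.nilp_weight_vector that by blast
    qed
    then show ?case using C.chevalley_step[OF ch _ step(2)] by blast
  qed
  then obtain e f where ch: "C.chevalley std e f" using steps_sym[OF b(1)] by blast
  have "interp free_scale br ?T e f (Cartan (h i)) = interp free_scale br ?T e f Zero"
    by (rule interp_respects[OF cartan ch R])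
  then have "q (Cartan (h i)) = 0" by simp
  moreover have "rt (axis i 1) (h i) \<noteq> 0"
    using rt_co_self[of "axis i 1"] by (simp add: co_axis)
  ultimately show False using V.model_nontrivial[OF q] by blast
qed

end

section \<open>Chevalley generators of the partial reflection algebra\<close>

locale pra_quotient = pra_positive smul M h d \<alpha> form + Q: lie_quotient br q "pra_cong smul h \<alpha> form"
  for smul :: "complex \<Rightarrow> 'h \<Rightarrow> 'h::ab_group_add" and M :: "int^'n^'n"
    and h :: "'n \<Rightarrow> 'h" and d \<alpha> form and br q
begin

abbreviation T :: "'h \<Rightarrow> ('h, 'n) free_lie" where
  "T t \<equiv> q (Cartan t)"

lemma q_eqI: "R s t \<Longrightarrow> q s = q t"
  by (simp add: Q.q_eq)

lemma T_relations:
  "T (s + t) = T s + T t" "T (smul c t) = free_scale c (T t)" "br (T s) (T t) = 0"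
  unfolding Q.q_Plus[symmetric] Q.q_Scale[symmetric] Q.q_Bracket[symmetric] Q.q_Zero[symmetric]
  by (rule q_eqI, rule pra_cong.intros)+

sublocale L: root_lie free_scale br smul T gram rt tv "range q"
  by unfold_locales (rule T_relations Q.subalg_range | auto)+

lemma wt_q: "L.wt \<phi> (q s) \<longleftrightarrow> weight_vector R \<phi> s"
  by (simp add: L.wt_def weight_vector_def flip: Q.q_eq Q.q_Bracket Q.q_Scale)

text \<open>For distinct members of one base, each sign of the inner product has a relation that
  applies: either a power of \<open>ad x\<close> kills \<open>y\<close>, or the bracket itself is
  0.\<close>

lemma nilp_positive:
  assumes b: "steps std b" and "i \<noteq> j" and x: "x \<in> range q" "L.wt (rt (b i)) x" and y: "y \<in> range q" "L.wt (rt (b j)) y"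
  shows "Q.nilp x y"
proof -
  obtain s t where st: "x = q s" "y = q t" using x(1) y(1) by auto
  then have w: "weight_vector R (rt (b i)) s" "weight_vector R (rt (b j)) t"
    using x(2) y(2) by (simp_all add: wt_q)
  note B = steps_braid[OF b]
  have mem: "rt (b k) \<in> range (\<lambda>k. rt (b k))" for k by blast
  have bracket: "Q.nilp x y" if "R (Bracket s t) Zero"
  proof -
    have "(br x ^^ 1) y = 0" using q_eqI[OF that] by (simp add: st Q.q_Bracket Q.q_Zero)
    then show ?thesis by (rule Q.nilpI)
  qed
  consider "ip (b i) (b j) < 0" | "ip (b i) (b j) > 0" | "ip (b i) (b j) = 0" by linarith
  then show ?thesis
  proof cases
    case 1
    obtain z where z: "2 * ip (b i) (b j) / ip (b i) (b i) = of_int z"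
      using root_cartan_int[OF good_root good_root] base_vector(1)[OF b] by (metis Ints_cases)
    have "2 * ip (b i) (b j) / ip (b i) (b i) < 0"
      using 1 base_vector(2)[OF b, of i] by (simp add: divide_neg_pos)
    then have "z < 0" unfolding z by simp
    have "form (rt (b i)) (rt (b j)) < 0" using 1 by (simp add: form_rt less_complex_def)
    moreover have "complex_of_real (2 * ip (b i) (b j) / ip (b i) (b i)) = of_int z"
      unfolding z by (rule of_real_of_int_eq)
    then have "2 * form (rt (b i)) (rt (b j)) / form (rt (b i)) (rt (b i)) = of_int z"
      by (simp only: form_rt of_real_mult of_real_divide of_real_numeral)
    then have "of_nat (nat (1 - z)) = 1 - 2 * form (rt (b i)) (rt (b j)) / form (rt (b i)) (rt (b i))"
      using \<open>z < 0\<close> by simp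
    ultimately have "R ((Bracket s ^^ nat (1 - z)) t) Zero"
      by (rule pra_cong.negative_ad[OF B mem mem _ _ w])
    then have "(br x ^^ nat (1 - z)) y = 0"
      using q_eqI by (fastforce simp: st Q.q_bracket_pow Q.q_Zero)
    then show ?thesis by (rule Q.nilpI)
  next
    case 2
    then have "form (rt (b i)) (rt (b j)) > 0" by (simp add: form_rt less_complex_def)
    then show ?thesis by (intro bracket pra_cong.positive_bracket[OF B mem mem _ w])
  next
    case 3
    then have "form (rt (b i)) (rt (b j)) = 0" by (simp add: form_rt)
    then show ?thesis by (intro bracket pra_cong.orthogonal_bracket[OF B mem mem _ w])
  qed
qed

text \<open>Sign changes of base vectors are braid moves. Flipping the sign at i, at j or at both
  turns the pairs that involve lowering generators into pairs of positive ones, to which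
  \<open>nilp_positive\<close> applies.\<close>

lemma chevalley_nil:
  assumes b: "steps std b" and ch: "L.chevalley b e f" and gen: "L.generates e f" and x: "x \<in> range q"
  shows "Q.nilp (e i) x \<and> Q.nilp (f i) x"
proof -
  have c: "e k \<in> range q" "f k \<in> range q" "L.wt (rt (b k)) (e k)" "L.wt (rt (- b k)) (f k)"
    "br (e k) (f k) = T (co (b k))" for k
    using ch by (auto simp: L.chevalley_def)
  have flip: "steps std (\<lambda>k. if k \<in> A then - b k else b k)" for A
    using b steps_flip[of A b] by simp
  have self: "Q.nilp z z" for z by (rule Q.nilpI[of 1]) (simp add: Q.br_self)
  have "br (f i) (e i) = T (- co (b i))" for i
    using c(5)[of i] Q.br_swap[of "f i" "e i"] L.T_minus[of "co (b i)"] by simp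
  note opp = L.nilp_opposite[OF c(3) c(5)] L.nilp_opposite[OF c(4) this]
  have "Q.nilp (e i) (e j) \<and> Q.nilp (e i) (f j) \<and> Q.nilp (f i) (e j) \<and> Q.nilp (f i) (f j)" for i j
  proof (cases "i = j")
    case True
    then show ?thesis using self opp by simp
  next
    case False
    have "Q.nilp (e i) (e j)"
      by (rule nilp_positive[OF b False c(1,3) c(1,3)])
    moreover have "Q.nilp (e i) (f j)"
      by (rule nilp_positive[OF flip[of "{j}"] False]) (use c False in auto)
    moreover have "Q.nilp (f i) (e j)"
      by (rule nilp_positive[OF flip[of "{i}"] False]) (use c False in auto)
    moreover have "Q.nilp (f i) (f j)"
      by (rule nilp_positive[OF flip[of "{i, j}"] False]) (use c False in auto)
    ultimately show ?thesis by blast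
  qed
  then show ?thesis
    using L.nil_from_generators[OF gen c(3) _ _ x] L.nil_from_generators[OF gen c(4) _ _ x] by blast
qed

lemma steps_chevalley: "steps std b \<Longrightarrow> \<exists>e f. L.chevalley b e f \<and> L.generates e f"
proof (induction rule: rtranclp_induct)
  case base
  have "L.wt (rt (axis i 1)) (q (E i))" for i
    unfolding wt_q weight_vector_def rt_axis by (blast intro: pra_cong.cartan_e)
  moreover have "L.wt (rt (- axis i 1)) (q (F i))" for i
    unfolding wt_q weight_vector_def rt_minus rt_axis by (blast intro: pra_cong.cartan_f)
  moreover have "br (q (E i)) (q (F i)) = T (co (axis i 1))" for i
    unfolding co_axis Q.q_Bracket[symmetric] by (rule q_eqI) (rule pra_cong.e_f)
  ultimately have "L.chevalley std (\<lambda>i. q (E i)) (\<lambda>i. q (F i))"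
    using good_std by (simp add: L.chevalley_def)
  moreover have "L.generates (\<lambda>i. q (E i)) (\<lambda>i. q (F i))"
    unfolding L.generates_def using Q.range_subset by blast
  ultimately show ?case by blast
next
  case (step b b')
  then obtain e f where ef: "L.chevalley b e f" "L.generates e f" by blast
  then show ?case
    using L.chevalley_step[OF ef(1) chevalley_nil[OF step(1) ef] step(2)] by blast
qed

text \<open>When inner products are nonpositive, the relations \<open>[z, y] = 0\<close>, with
  \<open>z = f j\<close> and \<open>y = e i\<close>, give the commutation required by
  \<open>cartan_lie\<close>.\<close>

lemma cartan_type:
  "\<exists>b e f. steps std b \<and> cartan_lie free_scale br smul T gram rt tv (range q) b e f"
proof -
  obtain b where b: "steps std b" "\<And>i j. i \<noteq> j \<Longrightarrow> ip (b i) (b j) \<le> 0"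
    using cartan_base_exists by blast
  obtain e f where ef: "L.chevalley b e f" "L.generates e f" using steps_chevalley[OF b(1)] by blast
  have c: "e k \<in> range q" "f k \<in> range q" "L.wt (rt (b k)) (e k)" "L.wt (rt (- b k)) (f k)" for k
    using ef(1) by (auto simp: L.chevalley_def)
  have comm: "br (e i) (f j) = 0" if "i \<noteq> j" for i j
  proof -
    obtain s t where st: "e i = q s" "f j = q t" using c(1)[of i] c(2)[of j] by auto
    then have w: "weight_vector R (- rt (b j)) t" "weight_vector R (rt (b i)) s"
      using c(3)[of i] c(4)[of j] by (simp_all add: minus_rt wt_q)
    have mem: "rt (b k) \<in> range (\<lambda>k. rt (b k))" for k by blast
    note B = steps_braid[OF b(1)]
    have "R (Bracket t s) Zero"
    proof (cases "ip (b j) (b i) = 0")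
      case True
      then have "form (rt (b j)) (rt (b i)) = 0" by (simp add: form_rt)
      then show ?thesis by (rule pra_cong.orthogonal_bracket_opposite[OF B mem mem _ w])
    next
      case False
      then have "form (rt (b j)) (rt (b i)) < 0"
        using b(2)[of j i] that by (simp add: form_rt less_complex_def)
      then show ?thesis by (rule pra_cong.negative_bracket[OF B mem mem _ w])
    qed
    then have "br (f j) (e i) = 0" unfolding st Q.q_Bracket[symmetric] Q.q_Zero[symmetric] by (rule q_eqI)
    then show ?thesis using Q.br_swap[of "e i" "f j"] by simp
  qed
  have "cartan_lie free_scale br smul T gram rt tv (range q) b e f"
    by unfold_locales (use ef chevalley_nil[OF b(1) ef] comm in auto)
  with b(1) show ?thesis by blast
qed

lemma pra_finitely_spanned: "\<exists>A. finite A \<and> A \<subseteq> range q \<and> range q \<subseteq> Q.span A"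
proof -
  obtain b e f where "cartan_lie free_scale br smul T gram rt tv (range q) b e f" using cartan_type by blast
  then interpret C: cartan_lie free_scale br smul T gram rt tv "range q" b e f .
  show ?thesis by (rule C.finitely_spanned)
qed

lemma pra_ideal:
  assumes "Q.subspace J" "J \<subseteq> range q" "\<And>x y. x \<in> range q \<Longrightarrow> y \<in> J \<Longrightarrow> br x y \<in> J" "J \<noteq> {0}"
  shows "J = range q"
proof -
  obtain b e f where b: "steps std b" and "cartan_lie free_scale br smul T gram rt tv (range q) b e f"
    using cartan_type by blast
  then interpret C: cartan_lie free_scale br smul T gram rt tv "range q" b e f by simp
  show ?thesis by (rule C.ideal_contains_generators[OF assms connected_base[OF b]])
qed

section \<open>Transfer to the algebra of congruence classes\<close>

definition cls :: "('h, 'n) lie_term \<Rightarrow> ('h, 'n) lie_term set" where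
  "cls s = {t. R s t}"

lemma cls_eq: "cls s = cls t \<longleftrightarrow> q s = q t"
proof
  assume "cls s = cls t"
  then have "t \<in> cls s" by (simp add: cls_def pra_cong.refl)
  then show "q s = q t" by (simp add: cls_def q_eqI)
next
  assume "q s = q t"
  then have "R s t" by (simp add: Q.q_eq)
  then show "cls s = cls t" unfolding cls_def by (blast intro: pra_cong.trans pra_cong.sym)
qed

lemma mem_cls: "t \<in> cls s \<longleftrightarrow> q s = q t"
  by (simp add: cls_def Q.q_eq)

abbreviation (input) "P \<equiv> partial_reflection_algebra smul h \<alpha> form"

lemma P_carrier: "carrier P = range cls"
  by (auto simp: partial_reflection_algebra_def quotient_def cls_def)

lemma P_zero: "\<zero>\<^bsub>P\<^esub> = cls Zero"
  by (simp add: partial_reflection_algebra_def cls_def Image_singleton)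

lemma UN_cls:
  assumes "\<And>s' t'. q s' = q s \<Longrightarrow> q t' = q t \<Longrightarrow> x s' t' = x s t"
  shows "(\<Union>s'\<in>cls s. \<Union>t'\<in>cls t. x s' t') = x s t"
proof -
  have "x s' t' = x s t" if "s' \<in> cls s" "t' \<in> cls t" for s' t'
    using that by (intro assms) (simp_all add: mem_cls)
  moreover have "s \<in> cls s" "t \<in> cls t" by (simp_all add: mem_cls)
  ultimately show ?thesis by blast
qed

lemma P_add: "cls s \<oplus>\<^bsub>P\<^esub> cls t = cls (Plus s t)"
  and P_bracket: "lie_bracket P (cls s) (cls t) = cls (Bracket s t)"
  and P_smult: "c \<odot>\<^bsub>P\<^esub> cls s = cls (Scale c s)"
proof -
  have "(\<Union>s'\<in>cls s. \<Union>t'\<in>cls t. cls (Plus s' t')) = cls (Plus s t)"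
    "(\<Union>s'\<in>cls s. \<Union>t'\<in>cls t. cls (Bracket s' t')) = cls (Bracket s t)"
    by (rule UN_cls; simp add: cls_eq Q.q_Plus Q.q_Bracket)+
  moreover have "cls (Scale c s') = cls (Scale c s)" if "s' \<in> cls s" for s'
    using that by (simp add: mem_cls cls_eq Q.q_Scale)
  then have "(\<Union>s'\<in>cls s. cls (Scale c s')) = cls (Scale c s)"
    using mem_cls[of s s] by blast
  ultimately show "cls s \<oplus>\<^bsub>P\<^esub> cls t = cls (Plus s t)" "lie_bracket P (cls s) (cls t) = cls (Bracket s t)"
    "c \<odot>\<^bsub>P\<^esub> cls s = cls (Scale c s)"
    by (simp_all add: partial_reflection_algebra_def cls_def Image_singleton)
qed

lemmas P_simps = P_zero P_add P_bracket P_smult cls_eq Q.q_Zero Q.q_Plus Q.q_Scale Q.q_Bracket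

abbreviation (input) "K \<equiv> ring_of_type_algebra :: complex ring"

lemma K_simps: "carrier K = UNIV" "x \<otimes>\<^bsub>K\<^esub> y = x * y" "x \<oplus>\<^bsub>K\<^esub> y = x + y" "\<one>\<^bsub>K\<^esub> = 1"
  by (simp_all add: ring_of_type_algebra_def)

lemma P_vectorspace: "vectorspace K P"
proof (rule vectorspace.intro)
  show "field K" by (rule field_from_type_algebra)
  show "module K P"
  proof (rule moduleI)
    show "cring K" by (rule cring_from_type_algebra)
    show "abelian_group P"
    proof (rule abelian_groupI)
      fix x assume "x \<in> carrier P"
      then obtain s where x: "x = cls s" by (auto simp: P_carrier)
      have "cls (Scale (- 1) s) \<oplus>\<^bsub>P\<^esub> x = \<zero>\<^bsub>P\<^esub>" by (simp add: x P_simps)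
      then show "\<exists>y\<in>carrier P. y \<oplus>\<^bsub>P\<^esub> x = \<zero>\<^bsub>P\<^esub>" by (auto simp: P_carrier)
    qed (clarsimp simp: rangeI P_carrier P_zero P_add cls_eq Q.q_Zero Q.q_Plus add_ac)+
  qed (clarsimp simp: rangeI P_carrier P_smult P_add cls_eq Q.q_Scale Q.q_Plus K_simps Q.scale_left_distrib Q.scale_right_distrib)+
qed

lemma P_lie_algebra: "lie_algebra K P"
proof -
  interpret V: vectorspace K P by (rule P_vectorspace)
  show ?thesis
  proof
    fix x y z assume "x \<in> carrier P" "y \<in> carrier P" "z \<in> carrier P"
    then obtain s t u where "x = cls s" "y = cls t" "z = cls u" by (auto simp: P_carrier)
    then show "lie_bracket P x (lie_bracket P y z) \<oplus>\<^bsub>P\<^esub> lie_bracket P y (lie_bracket P z x)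
          \<oplus>\<^bsub>P\<^esub> lie_bracket P z (lie_bracket P x y) = \<zero>\<^bsub>P\<^esub>"
      by (simp add: P_simps Q.br_jacobi)
  qed (clarsimp simp: rangeI P_carrier P_simps
      Q.br_add_left Q.br_add_right Q.br_scale_left Q.br_scale_right Q.br_self)+
qed

text \<open>Submodules of the algebra of classes become subspaces of the range of \<open>q\<close>;
  by the second statement membership can be read off after applying \<open>q\<close>, so nothing is
  lost in the passage.\<close>

lemma submodule_preimage:
  assumes "submodule K I P"
  shows "Q.subspace (q ` {s. cls s \<in> I})" "cls s \<in> I \<longleftrightarrow> q s \<in> q ` {s. cls s \<in> I}"
proof -
  interpret S: submodule K I P by (rule assms)
  have "cls Zero \<in> I" using S.zero_closed by (simp add: P_zero)
  moreover have "cls (Plus s t) \<in> I" if "cls s \<in> I" "cls t \<in> I" for s t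
    using S.m_closed[OF that] by (simp add: P_add)
  moreover have "cls (Scale c s) \<in> I" if "cls s \<in> I" for c s
    using S.smult_closed[OF _ that, of c] by (simp add: P_smult K_simps)
  ultimately show "Q.subspace (q ` {s. cls s \<in> I})"
    unfolding Q.subspace_def by (auto simp flip: Q.q_Zero Q.q_Plus Q.q_Scale)
  show "cls s \<in> I \<longleftrightarrow> q s \<in> q ` {s. cls s \<in> I}"
  proof
    assume "q s \<in> q ` {s. cls s \<in> I}"
    then obtain t where "q s = q t" "cls t \<in> I" by blast
    then show "cls s \<in> I" using cls_eq[of s t] by simp
  qed blast
qed

lemma P_fin_dim: "vectorspace.fin_dim K P"
proof -
  interpret V: vectorspace K P by (rule P_vectorspace)
  obtain A where A: "finite A" "A \<subseteq> range q" "range q \<subseteq> Q.span A" using pra_finitely_spanned by blast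
  let ?r = "inv_into UNIV q"
  have r: "q (?r x) = x" if "x \<in> A" for x
    using A(2) that by (intro f_inv_into_f) blast
  let ?A = "cls ` ?r ` A"
  have sub: "?A \<subseteq> carrier P" by (auto simp: P_carrier)
  have span: "submodule K (V.span ?A) P" by (rule V.span_is_submodule[OF sub])
  have "A \<subseteq> q ` {s. cls s \<in> V.span ?A}"
  proof
    fix x assume x: "x \<in> A"
    then have "cls (?r x) \<in> V.span ?A" using V.in_own_span[OF sub] by blast
    then show "x \<in> q ` {s. cls s \<in> V.span ?A}" using r[OF x] by force
  qed
  then have "range q \<subseteq> q ` {s. cls s \<in> V.span ?A}"
    using A(3) Q.span_minimal[OF _ submodule_preimage(1)[OF span]] by blast
  then have "cls s \<in> V.span ?A" for s
    using submodule_preimage(2)[OF span, of s] by blast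
  then have "carrier P \<subseteq> V.span ?A" by (auto simp: P_carrier)
  then have "V.span ?A = carrier P" using V.span_is_subset2[OF sub] by blast
  then show ?thesis unfolding V.fin_dim_def using A(1) sub by (intro exI[of _ ?A]) simp
qed

lemma P_simple: "simple_lie_algebra K P"
proof -
  interpret P: lie_algebra K P by (rule P_lie_algebra)
  show ?thesis
  proof
    fix i0 :: 'n
    \<comment> \<open>If \<open>E i0\<close> vanished, so would its bracket with
      \<open>F i0\<close>, which is \<open>h i0\<close>; the model excludes this.\<close>
    have "q (E i0) \<noteq> 0"
    proof
      assume "q (E i0) = 0"
      then have "q (Bracket (E i0) (F i0)) = 0" by (simp add: Q.q_Bracket)
      then have "q (Cartan (h i0)) = q Zero"
        using q_eqI[OF pra_cong.e_f, of i0] by (simp add: Q.q_Zero)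
      then show False using pra_nontrivial[of i0] by (simp add: Q.q_eq)
    qed
    moreover have "q (Bracket (Cartan (h i0)) (E i0)) = free_scale (\<alpha> i0 (h i0)) (q (E i0))"
      using q_eqI[OF pra_cong.cartan_e] by (simp add: Q.q_Scale)
    moreover have "\<alpha> i0 (h i0) \<noteq> 0"
      using gim by (simp add: root_coroot generalized_intersection_matrix_def)
    ultimately have "q (Bracket (Cartan (h i0)) (E i0)) \<noteq> 0" by simp
    then have "lie_bracket P (cls (Cartan (h i0))) (cls (E i0)) \<noteq> \<zero>\<^bsub>P\<^esub>"
      by (simp add: P_bracket P_zero cls_eq Q.q_Zero)
    then show "\<exists>x\<in>carrier P. \<exists>y\<in>carrier P. lie_bracket P x y \<noteq> \<zero>\<^bsub>P\<^esub>"
      by (auto simp: P_carrier)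
  next
    fix I assume "lie_ideal K I P"
    then have I: "submodule K I P" "\<And>x y. x \<in> carrier P \<Longrightarrow> y \<in> I \<Longrightarrow> lie_bracket P x y \<in> I"
      by (auto simp: lie_ideal_def VectorSpace.subspace_def)
    let ?J = "q ` {s. cls s \<in> I}"
    note pre = submodule_preimage[OF I(1)]
    have sub: "I \<subseteq> range cls" using submodule.subset[OF I(1)] by (simp add: P_carrier)
    have ideal: "br x y \<in> ?J" if xy: "x \<in> range q" "y \<in> ?J" for x y
    proof -
      obtain s t where st: "x = q s" "y = q t" "cls t \<in> I" using xy by blast
      then have "cls (Bracket s t) \<in> I" using I(2)[of "cls s" "cls t"] by (simp add: P_carrier P_bracket)
      then show ?thesis unfolding st Q.q_Bracket[symmetric] by blast
    qed
    show "I = {\<zero>\<^bsub>P\<^esub>} \<or> I = carrier P"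
    proof (cases "?J = {0}")
      case True
      have "x = \<zero>\<^bsub>P\<^esub>" if x: "x \<in> I" for x
      proof -
        obtain s where s: "x = cls s" using x sub by blast
        then have "q s = 0" using True x by blast
        then show ?thesis by (simp add: s P_zero cls_eq Q.q_Zero)
      qed
      moreover have "\<zero>\<^bsub>P\<^esub> \<in> I" by (rule submodule.zero_closed[OF I(1)])
      ultimately show ?thesis by blast
    next
      case False
      have "?J = range q" by (rule pra_ideal[OF pre(1) _ ideal False]) auto
      then have "cls s \<in> I" for s using pre(2)[of s] by blast
      then show ?thesis using sub by (auto simp: P_carrier)
    qed
  qed
qed

end

theorem theorem10:
  fixes M :: "int^'n^'n"
    and smul :: "complex \<Rightarrow> 'h \<Rightarrow> 'h::ab_group_add"
    and h :: "'n \<Rightarrow> 'h" and d :: "nat \<Rightarrow> 'h"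
    and \<alpha> :: "'n \<Rightarrow> 'h \<Rightarrow> complex"
    and form :: "'h dual_form"
  assumes "3 \<le> CARD('n)"
    and "generalized_intersection_matrix M"
    and "symmetrizable M"
    and "indecomposable M"
    and "\<exists>S :: real^'n^'n. diagonal_matrix S \<and> (\<forall>i. 0 < S $ i $ i) \<and>
           positive_definite (S ** map_matrix of_int M)"
    and "pra_realization smul M h d \<alpha> form"
  shows "simple_lie_algebra ring_of_type_algebra (partial_reflection_algebra smul h \<alpha> form) \<and>
    vectorspace.fin_dim ring_of_type_algebra (partial_reflection_algebra smul h \<alpha> form)"
proof -
  interpret pra_realization smul M h d \<alpha> form by (rule assms(6))
  interpret pra_positive smul M h d \<alpha> form by unfold_locales (rule assms)+
  obtain br q where "lie_quotient br q (pra_cong smul h \<alpha> form)"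
    using lie_quotient_exists[OF pra_congruence] by blast
  then interpret Q: lie_quotient br q "pra_cong smul h \<alpha> form" .
  interpret pra_quotient smul M h d \<alpha> form br q ..
  show ?thesis using P_simple P_fin_dim by blast
qed

end
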